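(* Suppose $\varphi\in\Phi_\alpha$ and $a\in A_\beta$ for some $\alpha\in(0,2)$ and $\beta\in\mathbb R$ with $\beta-\alpha>-1$, and that $a$ has linear growth. Let $X^{\varphi,a}$ be the Harris flow with infinitesimal covariance $\varphi$ and drift $a$. Then for all $C>0$, $t>0$, $$\mathbb E\,\#\{X^{\varphi,a}_{0,t}(u): u\in[-C,C]\}<\infty .$$
   Context: $D^\uparrow(\mathbb R)$ denotes the space of non-decreasing càdlàg functions $\mathbb R\to\mathbb R$ with the Skorokhod $J_1$ topology. A Harris flow $X^{\varphi,a}$ with infinitesimal covariance $\varphi$ (continuous) and drift $a$ (measurable) is a family $\{X^{\varphi,a}_{s,t}:0\le s\le t\}$ of $D^\uparrow(\mathbb R)$-valued random elements such that: (i) $X_{s,r}=X_{t,r}\circ X_{s,t}$ a.s. for $s\le t\le r$, $X_{s,s}=\mathrm{Id}$; (ii) increments over disjoint consecutive time intervals are independent; (iii) the law of $X_{s,t}$ is invariant under time shifts; (iv) $X_{0,h}\to\mathrm{Id}$ in probability as $h\to0+$; (v) for every $x,s$, $w_t(x,s)=X_{s,t}(x)-x-\int_s^ta(X_{s,r}(x))dr$ is a Wiener process from $0$ w.r.t. the filtration generated by the flow after time $s$; (vi) $\langle w(x,s),w(y,s)\rangle_t=\int_s^t\varphi(X_{s,r}(x)-X_{s,r}(y))dr$. Such a flow exists and is unique in law when $\varphi\in\Phi_*$ and $a$ is measurable of linear growth. $\Phi_*$: continuous symmetric strictly positive definite $\varphi$ with $\varphi(0)=1$, Lipschitz outside every neighborhood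 of $0$. For $\alpha\in(0,2]$, $\Phi_\alpha$ is the set of $\varphi\in\Phi_*$ for which there are $C_\varphi,\tilde C_\varphi>0$ with $1-\varphi(x)\ge C_\varphi|x|^\alpha$ for $|x|\le\tilde C_\varphi$. For $\beta\in\mathbb R$, $A_\beta$ is the set of measurable $a:\mathbb R\to\mathbb R$ for which there exist a non-negative continuous $\rho$ on $(0,\infty)$ and $C_\rho,\tilde C_\rho>0$ with $|a(x+y)-a(x)|\le\rho(y)$ for $x\in\mathbb R$, $y>0$; $\rho(x)\le C_\rho x^\beta$ for $x\in(0,\tilde C_\rho]$; and $\rho(x)\le C_\rho(1+|x|)$ for $x>0$. *)

theory Defs
  imports "HOL-Probability.Probability"
begin

definition strictly_pos_def_fun :: "(real \<Rightarrow> real) \<Rightarrow> bool" where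
  "strictly_pos_def_fun \<phi> \<longleftrightarrow>
     (\<forall>(n::nat) (x::nat \<Rightarrow> real) (c::nat \<Rightarrow> real).
        (\<forall>i<n. \<forall>j<n. i \<noteq> j \<longrightarrow> x i \<noteq> x j) \<longrightarrow> (\<exists>i<n. c i \<noteq> 0) \<longrightarrow>
        (\<Sum>i<n. \<Sum>j<n. c i * c j * \<phi> (x i - x j)) > 0)"

definition Phi_star :: "(real \<Rightarrow> real) set" where
  "Phi_star = {\<phi>. continuous_on UNIV \<phi> \<and> (\<forall>x. \<phi> (- x) = \<phi> x)
      \<and> strictly_pos_def_fun \<phi> \<and> \<phi> 0 = 1
      \<and> (\<forall>\<delta>>0. \<exists>L. lipschitz_on L {x. \<bar>x\<bar> \<ge> \<delta>} \<phi>)}"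

definition Phi_alpha :: "real \<Rightarrow> (real \<Rightarrow> real) set" where
  "Phi_alpha \<alpha> = {\<phi>. \<phi> \<in> Phi_star \<and>
      (\<exists>C C'. C > 0 \<and> C' > 0 \<and> (\<forall>x. \<bar>x\<bar> \<le> C' \<longrightarrow> 1 - \<phi> x \<ge> C * \<bar>x\<bar> powr \<alpha>))}"

definition A_beta :: "real \<Rightarrow> (real \<Rightarrow> real) set" where
  "A_beta \<beta> = {a. a \<in> borel_measurable borel \<and>
      (\<exists>(\<rho>::real \<Rightarrow> real) C C'. continuous_on {0<..} \<rho> \<and> (\<forall>x>0. \<rho> x \<ge> 0) \<and> C > 0 \<and> C' > 0
         \<and> (\<forall>x. \<forall>y>0. \<bar>a (x + y) - a x\<bar> \<le> \<rho> y)
         \<and> (\<forall>x. 0 < x \<and> x \<le> C' \<longrightarrow> \<rho> x \<le> C * x powr \<beta>)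
         \<and> (\<forall>x>0. \<rho> x \<le> C * (1 + \<bar>x\<bar>)))}"

definition linear_growth :: "(real \<Rightarrow> real) \<Rightarrow> bool" where
  "linear_growth a \<longleftrightarrow> (\<exists>K. \<forall>x. \<bar>a x\<bar> \<le> K * (1 + \<bar>x\<bar>))"

definition cadlag :: "(real \<Rightarrow> real) \<Rightarrow> bool" where
  "cadlag f \<longleftrightarrow> (\<forall>x. (f \<longlongrightarrow> f x) (at_right x) \<and> (\<exists>l. (f \<longlongrightarrow> l) (at_left x)))"

definition D_up :: "(real \<Rightarrow> real) set" where
  "D_up = {f. mono f \<and> cadlag f}"

text \<open>Measurable structure on functions R to R: generated by the evaluation maps
  (on D(R) this coincides with the Borel sigma-algebra of the Skorokhod J1 topology).\<close>
abbreviation Mfun :: "(real \<Rightarrow> real) measure" where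
  "Mfun \<equiv> Pi\<^sub>M UNIV (\<lambda>_::real. (borel :: real measure))"

definition flow_filt :: "'a measure \<Rightarrow> (real \<Rightarrow> real \<Rightarrow> 'a \<Rightarrow> real \<Rightarrow> real) \<Rightarrow> real \<Rightarrow> real \<Rightarrow> 'a measure" where
  "flow_filt M X s t = sigma (space M)
     (\<Union>u\<in>{s..t}. \<Union>v\<in>{u..t}. \<Union>x. {(\<lambda>\<omega>. X u v \<omega> x) -` B \<inter> space M | B. B \<in> sets borel})"

definition martingale_from :: "'a measure \<Rightarrow> (real \<Rightarrow> 'a measure) \<Rightarrow> real \<Rightarrow> (real \<Rightarrow> 'a \<Rightarrow> real) \<Rightarrow> bool" where
  "martingale_from M F s Z \<longleftrightarrow>
     (\<forall>t\<ge>s. integrable M (Z t) \<and> Z t \<in> borel_measurable (F t)) \<and>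
     (\<forall>u v. s \<le> u \<longrightarrow> u \<le> v \<longrightarrow> (AE \<omega> in M. real_cond_exp M (F u) (Z v) \<omega> = Z u \<omega>))"

definition wiener_from :: "'a measure \<Rightarrow> (real \<Rightarrow> 'a measure) \<Rightarrow> real \<Rightarrow> (real \<Rightarrow> 'a \<Rightarrow> real) \<Rightarrow> bool" where
  "wiener_from M F s W \<longleftrightarrow>
     (AE \<omega> in M. W s \<omega> = 0) \<and>
     (AE \<omega> in M. continuous_on {s..} (\<lambda>t. W t \<omega>)) \<and>
     (\<forall>t\<ge>s. W t \<in> borel_measurable (F t)) \<and>
     (\<forall>u v. s \<le> u \<longrightarrow> u < v \<longrightarrow>
        distributed M lborel (\<lambda>\<omega>. W v \<omega> - W u \<omega>) (\<lambda>y. ennreal (normal_density 0 (sqrt (v - u)) y)) \<and>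
        prob_space.indep_set M (sets (F u)) (sets (vimage_algebra (space M) (\<lambda>\<omega>. W v \<omega> - W u \<omega>) borel)))"

definition flow_noise :: "(real \<Rightarrow> real) \<Rightarrow> (real \<Rightarrow> real \<Rightarrow> 'a \<Rightarrow> real \<Rightarrow> real) \<Rightarrow> real \<Rightarrow> real \<Rightarrow> real \<Rightarrow> 'a \<Rightarrow> real" where
  "flow_noise a X x s t \<omega> = X s t \<omega> x - x - (LINT r:{s..t}|lborel. a (X s r \<omega> x))"

definition harris_flow :: "'a measure \<Rightarrow> (real \<Rightarrow> real) \<Rightarrow> (real \<Rightarrow> real) \<Rightarrow> (real \<Rightarrow> real \<Rightarrow> 'a \<Rightarrow> real \<Rightarrow> real) \<Rightarrow> bool" where
  "harris_flow M \<phi> a X \<longleftrightarrow>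
     \<comment> \<open>D-up-valued random elements\<close>
     (\<forall>s t. 0 \<le> s \<longrightarrow> s \<le> t \<longrightarrow> X s t \<in> measurable M Mfun \<and> (\<forall>\<omega>\<in>space M. X s t \<omega> \<in> D_up)) \<and>
     \<comment> \<open>(i) cocycle property\<close>
     (\<forall>s t r. 0 \<le> s \<longrightarrow> s \<le> t \<longrightarrow> t \<le> r \<longrightarrow> (AE \<omega> in M. X s r \<omega> = X t r \<omega> \<circ> X s t \<omega>)) \<and>
     (\<forall>s\<ge>0. AE \<omega> in M. X s s \<omega> = id) \<and>
     \<comment> \<open>(ii) independent increments\<close>
     (\<forall>(n::nat) (\<tau>::nat \<Rightarrow> real). 0 \<le> \<tau> 0 \<longrightarrow> (\<forall>i<n. \<tau> i \<le> \<tau> (Suc i)) \<longrightarrow>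
        prob_space.indep_vars M (\<lambda>_. Mfun) (\<lambda>i. X (\<tau> i) (\<tau> (Suc i))) {..<n}) \<and>
     \<comment> \<open>(iii) stationarity\<close>
     (\<forall>s t h. 0 \<le> s \<longrightarrow> s \<le> t \<longrightarrow> 0 \<le> h \<longrightarrow> distr M Mfun (X s t) = distr M Mfun (X (s + h) (t + h))) \<and>
     \<comment> \<open>(iv) X_{0,h} \<rightarrow> Id in probability in J1 (limit is continuous: locally uniform convergence)\<close>
     (\<forall>K>0. \<forall>\<epsilon>>0. ((\<lambda>h. prob_space.prob M {\<omega>\<in>space M. \<exists>x\<in>{-K..K}. \<bar>X 0 h \<omega> x - x\<bar> > \<epsilon>})
          \<longlongrightarrow> 0) (at_right 0)) \<and>
     \<comment> \<open>(v) martingale part is a Wiener process\<close>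
     (\<forall>x s. 0 \<le> s \<longrightarrow>
        (\<forall>t\<ge>s. AE \<omega> in M. set_integrable lborel {s..t} (\<lambda>r. a (X s r \<omega> x))) \<and>
        wiener_from M (flow_filt M X s) s (flow_noise a X x s)) \<and>
     \<comment> \<open>(vi) joint quadratic characteristic\<close>
     (\<forall>x y s. 0 \<le> s \<longrightarrow>
        martingale_from M (flow_filt M X s) s
          (\<lambda>t \<omega>. flow_noise a X x s t \<omega> * flow_noise a X y s t \<omega>
                 - (LINT r:{s..t}|lborel. \<phi> (X s r \<omega> x - X s r \<omega> y))))"

end

theory Submission
  imports Defs
begin

text \<open>
  For \<open>x < y\<close> the gap \<open>Z\<^sub>r = X\<^sub>0\<^sub>,\<^sub>r(y) - X\<^sub>0\<^sub>,\<^sub>r(x)\<close> is a nonnegative semimartingale with drift bounded by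
  \<open>Z\<^sup>\<beta>\<close> and quadratic variation rate \<open>2(1 - \<phi>(Z)) \<ge> c Z\<^sup>\<alpha>\<close> near \<open>0\<close>.  Counting the jumps of \<open>X\<^sub>0\<^sub>,\<^sub>t\<close> on finer and
  finer grids reduces the claim to \<open>P(Z\<^sub>t > 0) \<le> K (y - x)\<close>, uniformly in \<open>x\<close> and \<open>y\<close>.
  Because \<open>\<beta> - \<alpha> > -1\<close>, concave functions with slope
  \<open>z\<^sup>p\<^sup>-\<^sup>1 exp(-L z\<^sup>\<gamma>) (\<epsilon> - z)\<^sub>+\<^sup>2\<close>, for \<open>0 < \<gamma> \<le> 1 + \<beta> - \<alpha>\<close>, absorb the drift: applied to \<open>Z\<close> they are
  supermartingales, and the amount they lose bounds the time integral of
  \<open>E min(Z, \<epsilon>)\<^sup>q\<close> with \<open>q = p - (2 - \<alpha> - \<gamma>)\<close>.  So a bound of order \<open>y - x\<close> for \<open>E min(Z\<^sub>t, \<epsilon>)\<^sup>p\<close> at all positive times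
  passes from the exponent \<open>p\<close> to \<open>max 0 q\<close>; starting at \<open>p = 1\<close>, finitely many steps
  reach the exponent \<open>0\<close>, that is \<open>P(Z\<^sub>t > 0)\<close>.
\<close>

section \<open>Images of monotone functions and grids\<close>

text \<open>The exponential factor beats the drift for this reason: differentiating it produces
  \<open>L * \<gamma> * z powr (\<gamma> - 1)\<close> times the slope, and multiplication by
  \<open>1 - \<phi> z\<close>, at least of order \<open>z powr \<alpha>\<close>, gives exactly the
  power \<open>\<alpha> + \<gamma> - 1\<close> that bounds the drift difference. \<open>L\<close>
  makes this second order term twice the drift term, and the surviving half is the gain. That power
  may be negative and the slope may be unbounded at 0, so everything is first proved with shifted
  arguments, and the shifts are removed by monotone convergence. The gain controls only a time
  integral. It becomes a bound at a fixed time because truncated moments of the gap decrease in time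
  up to a constant factor. This factor contains \<open>1 / p\<close>; for the exponent 0 the
  monotonicity comes from coalescence instead. The flow is known only through Wiener noises and
  their covariations, so Ito's formula is proved in expectation, from partition sums and moments of
  increments, without stochastic integrals. The values of the flow are counted through finite sets
  of values and Fatou's lemma.\<close>

lemma card_image_le_changes:
  fixes h :: "nat \<Rightarrow> real"
  shows "card (h ` {..k}) \<le> 1 + (\<Sum>i<k. if h (Suc i) = h i then 0 else 1)"
proof (induction k)
  case (Suc k)
  have e: "h ` {..Suc k} = insert (h (Suc k)) (h ` {..k})" by (simp add: atMost_Suc)
  have "card (h ` {..Suc k}) \<le> card (h ` {..k}) + (if h (Suc k) = h k then 0 else 1)"
    unfolding e by (auto simp: card_insert_if insert_absorb)
  then show ?case using Suc by simp
qed simp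

definition grid :: "real \<Rightarrow> nat \<Rightarrow> nat \<Rightarrow> real" where
  "grid C m i = - C + 2 * C * real i / real (Suc m)"

lemma grid_Suc: "grid C m (Suc i) - grid C m i = 2 * C / real (Suc m)"
  by (simp add: grid_def add_divide_distrib distrib_left del: of_nat_Suc) (simp add: distrib_left add_divide_distrib)

text \<open>The fractional index \<open>u m\<close> of \<open>x\<close> is rounded up, so the grid
  points approach \<open>x\<close> from the right, the side on which a cadlag function is
  continuous.\<close>

lemma grid_approximation:
  assumes C: "0 < C" and x: "x \<in> {-C..C}"
  obtains i where "\<And>m. i m \<le> Suc m" "\<And>m. x \<le> grid C m (i m)" "(\<lambda>m. grid C m (i m)) \<longlonglongrightarrow> x"
proof -
  define u where "u m = (x + C) * real (Suc m) / (2 * C)" for m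
  define i where "i m = nat \<lceil>u m\<rceil>" for m
  have u0: "0 \<le> u m" for m using C x by (simp add: u_def)
  have u1: "u m \<le> real (Suc m)" for m
  proof -
    have "(x + C) * real (Suc m) \<le> (2 * C) * real (Suc m)" using x by (intro mult_right_mono) auto
    then show ?thesis using C by (simp add: u_def field_simps del: of_nat_Suc)
  qed
  have ui: "u m \<le> real (i m)" "real (i m) \<le> u m + 1" for m
    using u0[of m] by (simp_all add: i_def of_nat_nat)
  have xu: "x = - C + 2 * C * u m / real (Suc m)" for m using C by (simp add: u_def del: of_nat_Suc)
  have le: "x \<le> grid C m (i m)" for m
  proof -
    have "2 * C * u m / real (Suc m) \<le> 2 * C * real (i m) / real (Suc m)"
      using ui(1)[of m] C by (intro divide_right_mono mult_left_mono) auto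
    then show ?thesis using xu[of m] by (simp add: grid_def)
  qed
  have ge: "grid C m (i m) \<le> x + 2 * C * inverse (real (Suc m))" for m
  proof -
    have "2 * C * real (i m) / real (Suc m) \<le> 2 * C * (u m + 1) / real (Suc m)"
      using ui(2)[of m] C by (intro divide_right_mono mult_left_mono) auto
    also have "\<dots> = 2 * C * u m / real (Suc m) + 2 * C * inverse (real (Suc m))"
      by (simp add: distrib_left distrib_right divide_inverse del: of_nat_Suc)
    finally show ?thesis using xu[of m] by (simp add: grid_def)
  qed
  show ?thesis
  proof (rule that[of i])
    show "i m \<le> Suc m" for m
    proof -
      have "\<lceil>u m\<rceil> \<le> int (Suc m)" using u1[of m] by (simp add: ceiling_le_iff)
      then show ?thesis unfolding i_def by linarith
    qed
    show "x \<le> grid C m (i m)" for m by (rule le)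
    have "(\<lambda>m. x + 2 * C * inverse (real (Suc m))) \<longlonglongrightarrow> x + 2 * C * 0"
      by (rule tendsto_add[OF tendsto_const tendsto_mult[OF tendsto_const LIMSEQ_inverse_real_of_nat]])
    then have lim: "(\<lambda>m. x + 2 * C * inverse (real (Suc m))) \<longlonglongrightarrow> x" by simp
    show "(\<lambda>m. grid C m (i m)) \<longlonglongrightarrow> x"
      by (rule tendsto_sandwich[OF always_eventually always_eventually tendsto_const lim]) (rule allI, rule le ge)+
  qed
qed

text \<open>The sequence may hit \<open>x\<close> itself, so the one-sided limit is first turned
  into continuity within \<open>{x..}\<close>.\<close>

lemma right_continuous_sequence:
  fixes f :: "real \<Rightarrow> real"
  assumes f: "(f \<longlongrightarrow> f x) (at_right x)" and q: "q \<longlonglongrightarrow> x" "\<And>m. x \<le> q m"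
  shows "(\<lambda>m. f (q m)) \<longlonglongrightarrow> f x"
proof -
  have "(f \<longlongrightarrow> f x) (at x within {x..})"
  proof -
    have "(at x within {x..}) = at_right x" by (rule at_within_nhd[where S=UNIV]) auto
    then show ?thesis using f by simp
  qed
  then have "continuous (at x within {x..}) f" by (simp add: continuous_within)
  then show ?thesis using q by (auto simp: continuous_within_sequentially comp_def)
qed

text \<open>Each value in \<open>T\<close> is the limit of values at grid points. Distinct limits
  force distinct grid values for all large \<open>m\<close>, and a sequence takes at most one value
  more than it has changes. The finite set \<open>T\<close> makes "for all large \<open>m\<close>"
  uniform over pairs, and the \<open>liminf\<close> prepares for Fatou's lemma.\<close>

lemma finite_image_le_grid_changes:
  assumes f: "f \<in> D_up" and C: "0 < C" and T: "finite T" "T \<subseteq> f ` {-C..C}"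
  shows "of_nat (card T) \<le> liminf (\<lambda>m. 1 + (\<Sum>i<Suc m. if f (grid C m (Suc i)) = f (grid C m i) then 0 else 1 :: ennreal))"
proof -
  have "\<forall>y\<in>T. \<exists>j. (\<forall>m. j m \<le> Suc m) \<and> (\<lambda>m. f (grid C m (j m))) \<longlonglongrightarrow> y"
  proof
    fix y assume "y \<in> T"
    then obtain x where x: "x \<in> {-C..C}" "y = f x" using T by auto
    obtain i where i: "\<And>m. i m \<le> Suc m" "\<And>m. x \<le> grid C m (i m)" "(\<lambda>m. grid C m (i m)) \<longlonglongrightarrow> x"
      using grid_approximation[OF C x(1)] by metis
    have "(f \<longlongrightarrow> f x) (at_right x)" using f by (simp add: D_up_def cadlag_def)
    from right_continuous_sequence[OF this i(3,2)]
    show "\<exists>j. (\<forall>m. j m \<le> Suc m) \<and> (\<lambda>m. f (grid C m (j m))) \<longlonglongrightarrow> y" using i(1) x(2) by blast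
  qed
  then obtain j where j: "\<And>y m. y \<in> T \<Longrightarrow> j y m \<le> Suc m" "\<And>y. y \<in> T \<Longrightarrow> (\<lambda>m. f (grid C m (j y m))) \<longlonglongrightarrow> y"
    by metis
  have "\<forall>\<^sub>F m in sequentially. \<forall>y\<in>T. \<forall>y'\<in>T. y \<noteq> y' \<longrightarrow> f (grid C m (j y m)) \<noteq> f (grid C m (j y' m))"
  proof (intro eventually_ball_finite[OF T(1)] ballI)
    fix y y' assume y: "y \<in> T" "y' \<in> T"
    show "\<forall>\<^sub>F m in sequentially. y \<noteq> y' \<longrightarrow> f (grid C m (j y m)) \<noteq> f (grid C m (j y' m))"
    proof (cases "y = y'")
      case False
      have "(\<lambda>m. f (grid C m (j y m)) - f (grid C m (j y' m))) \<longlonglongrightarrow> y - y'"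
        by (intro tendsto_diff j y)
      then have "\<forall>\<^sub>F m in sequentially. f (grid C m (j y m)) - f (grid C m (j y' m)) \<noteq> 0"
        by (rule tendsto_imp_eventually_ne) (use False in simp)
      then show ?thesis by eventually_elim auto
    qed simp
  qed
  then have "\<forall>\<^sub>F m in sequentially. of_nat (card T) \<le> 1 + (\<Sum>i<Suc m. if f (grid C m (Suc i)) = f (grid C m i) then 0 else 1 :: ennreal)"
  proof eventually_elim
    case (elim m)
    let ?h = "\<lambda>i. f (grid C m i)"
    have "card T = card ((\<lambda>y. ?h (j y m)) ` T)"
      using elim by (intro card_image[symmetric]) (auto simp: inj_on_def)
    also have "\<dots> \<le> card (?h ` {..Suc m})" using j(1) by (intro card_mono) auto
    also have "\<dots> \<le> 1 + (\<Sum>i<Suc m. if ?h (Suc i) = ?h i then 0 else 1)" by (rule card_image_le_changes)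
    finally have "(of_nat (card T) :: ennreal) \<le> of_nat (1 + (\<Sum>i<Suc m. if ?h (Suc i) = ?h i then 0 else 1))"
      by (simp only: of_nat_mono)
    then show ?case by (simp add: if_distrib[of of_nat] cong: if_cong del: sum.lessThan_Suc)
  qed
  then show ?thesis by (rule Liminf_bounded)
qed

text \<open>An infinite set has finite subsets of every cardinality, which forces \<open>B\<close>
  to be infinite.\<close>

lemma emeasure_count_space_le:
  assumes "\<And>T. finite T \<Longrightarrow> T \<subseteq> S \<Longrightarrow> of_nat (card T) \<le> (B :: ennreal)"
  shows "emeasure (count_space UNIV) S \<le> B"
proof (cases "finite S")
  case False
  have "of_nat n \<le> B" for n
    using infinite_arbitrarily_large[OF False, of n] assms by metis
  then have "\<not> B < top" using ennreal_Ex_less_of_nat[of B] by (meson leD)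
  then have "B = top" by (simp only: less_top[symmetric]) simp
  then show ?thesis by (simp only: top_greatest)
next
  case True
  have "emeasure (count_space UNIV) S = of_nat (card S)"
    by (rule emeasure_count_space_finite[OF subset_UNIV True])
  then show ?thesis using assms[OF True order_refl] by (simp only:)
qed

text \<open>Positive definiteness at the two points \<open>x\<close> and 0 with coefficients 1 and
  \<open>d\<close> reads \<open>2 + 2 * d * \<phi> x > 0\<close>; the signs \<open>d = 1\<close> and
  \<open>d = -1\<close> give the two bounds.\<close>

lemma strictly_pos_def_fun_bound:
  assumes pd: "strictly_pos_def_fun \<phi>" and sym: "\<And>x. \<phi> (- x) = \<phi> x" and 0: "\<phi> 0 = 1"
  shows "\<bar>\<phi> x\<bar> \<le> 1"
proof (cases "x = 0")
  case False
  have "0 < 2 + 2 * d * \<phi> x" if "d * d = 1" for d :: real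
  proof -
    let ?x = "\<lambda>i::nat. if i = 0 then x else 0" and ?c = "\<lambda>i::nat. if i = 0 then 1 else d"
    have "(\<forall>i<2. \<forall>j<2. i \<noteq> j \<longrightarrow> ?x i \<noteq> ?x j) \<longrightarrow> (\<exists>i<2. ?c i \<noteq> 0) \<longrightarrow>
        (\<Sum>i<2. \<Sum>j<2. ?c i * ?c j * \<phi> (?x i - ?x j)) > 0"
      by (rule pd[unfolded strictly_pos_def_fun_def, THEN spec, THEN spec, THEN spec])
    moreover have "\<forall>i<2. \<forall>j<2. i \<noteq> j \<longrightarrow> ?x i \<noteq> ?x j" using False by (auto simp: less_2_cases_iff)
    moreover have "\<exists>i<2. ?c i \<noteq> 0" by (intro exI[of _ 0]) simp
    ultimately have "(\<Sum>i<2. \<Sum>j<2. ?c i * ?c j * \<phi> (?x i - ?x j)) > 0" by blast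
    then show ?thesis using that by (simp add: numeral_2_eq_2 0 sym)
  qed
  from this[of 1] this[of "-1"] show ?thesis by simp
qed (simp add: 0)

section \<open>The Ito formula in expectation\<close>

lemma set_lebesgue_integral_split:
  fixes f :: "real \<Rightarrow> real"
  assumes "set_integrable lborel {a..c} f" "a \<le> b" "b \<le> c"
  shows "(LINT r:{a..c}|lborel. f r) = (LINT r:{a..b}|lborel. f r) + (LINT r:{b..c}|lborel. f r)"
proof -
  have 1: "set_integrable lborel {a..b} f" "set_integrable lborel {b..c} f"
    using assms by (auto intro: set_integrable_subset)
  show ?thesis
    using assms Henstock_Kurzweil_Integration.integral_combine[of a b c f]
      set_borel_integral_eq_integral[OF assms(1)] set_borel_integral_eq_integral[OF 1(1)]
      set_borel_integral_eq_integral[OF 1(2)] by simp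
qed

lemma set_lebesgue_integral_sum_partition:
  fixes f :: "real \<Rightarrow> real" and p :: "nat \<Rightarrow> real"
  assumes "set_integrable lborel {p 0..p n} f" "\<And>i. i < n \<Longrightarrow> p i \<le> p (Suc i)"
  shows "(LINT r:{p 0..p n}|lborel. f r) = (\<Sum>i<n. LINT r:{p i..p (Suc i)}|lborel. f r)"
  using assms
proof (induction n)
  case 0
  have "set_lebesgue_integral lborel {p 0..p 0} f = 0"
    using set_borel_integral_eq_integral[OF 0(1)] by simp
  then show ?case by simp
next
  case (Suc n)
  have le: "p 0 \<le> p k" if "k \<le> Suc n" for k
    using that
  proof (induction k)
    case (Suc k)
    then show ?case using Suc.prems \<open>\<And>i. i < Suc n \<Longrightarrow> p i \<le> p (Suc i)\<close>[of k] by simp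
  qed simp
  have "p 0 \<le> p n" "p n \<le> p (Suc n)" using le Suc.prems by auto
  moreover have "set_integrable lborel {p 0..p n} f"
    by (rule set_integrable_subset[OF Suc.prems(1)]) (use Suc.prems in auto)
  ultimately show ?case
    using set_lebesgue_integral_split[OF Suc.prems(1)] Suc.IH Suc.prems(2) by simp
qed

text \<open>Used with \<open>f\<close> the drift and with \<open>f\<close> the rate of quadratic
  variation, both merely integrable in time. The weights need only be close to \<open>g\<close> on
  their cell, because in the drift sum they are taken at mean value points that lie off the
  path.\<close>

lemma weighted_partition_sum_error:
  fixes f g :: "real \<Rightarrow> real" and p c :: "nat \<Rightarrow> real"
  assumes f: "set_integrable lborel {p 0..p n} f" and p: "\<And>i. i < n \<Longrightarrow> p i \<le> p (Suc i)"
    and g: "continuous_on {p 0..p n} g"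
    and close: "\<And>i r. i < n \<Longrightarrow> p i \<le> r \<Longrightarrow> r \<le> p (Suc i) \<Longrightarrow> \<bar>c i - g r\<bar> \<le> e"
  shows "\<bar>(\<Sum>i<n. c i * (LINT r:{p i..p (Suc i)}|lborel. f r)) - (LINT r:{p 0..p n}|lborel. g r * f r)\<bar>
         \<le> e * (LINT r:{p 0..p n}|lborel. \<bar>f r\<bar>)"
proof -
  have mono: "p i \<le> p j" if "i \<le> j" "j \<le> n" for i j
    using that
  proof (induction j)
    case (Suc j)
    then show ?case using p[of j] by (cases "i = Suc j") auto
  qed simp
  have gb: "set_borel_measurable lborel {p 0..p n} g"
    using borel_measurable_continuous_on_indicator[OF _ g] by (simp add: set_borel_measurable_def)
  obtain B where B: "\<And>r. r \<in> {p 0..p n} \<Longrightarrow> \<bar>g r\<bar> \<le> B"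
    using compact_imp_bounded[OF compact_continuous_image[OF g compact_Icc]] by (force simp: bounded_iff)
  have gf: "set_integrable lborel {p 0..p n} (\<lambda>r. g r * f r)"
  proof -
    have "set_integrable lborel {p 0..p n} (\<lambda>r. B * f r)" using f by simp
    moreover have "set_borel_measurable lborel {p 0..p n} (\<lambda>r. g r * f r)"
    proof -
      have "(\<lambda>r. (indicator {p 0..p n} r *\<^sub>R g r) * (indicator {p 0..p n} r *\<^sub>R f r)) \<in> borel_measurable lborel"
        using gb f by (intro borel_measurable_times) (auto simp: set_borel_measurable_def set_integrable_def)
      also have "(\<lambda>r. (indicator {p 0..p n} r *\<^sub>R g r) * (indicator {p 0..p n} r *\<^sub>R f r)) = (\<lambda>r. indicator {p 0..p n} r *\<^sub>R (g r * f r))"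
        by (auto simp: indicator_def)
      finally show ?thesis by (simp add: set_borel_measurable_def)
    qed
    ultimately show ?thesis
      by (rule set_integrable_bound) (use B in \<open>auto simp: abs_mult intro!: mult_right_mono AE_I2 order_trans[OF B]\<close>)
  qed
  have sub: "{p i..p (Suc i)} \<subseteq> {p 0..p n}" if "i < n" for i
    using mono[of 0 i] mono[of "Suc i" n] that by auto
  have "(\<Sum>i<n. c i * (LINT r:{p i..p (Suc i)}|lborel. f r)) - (LINT r:{p 0..p n}|lborel. g r * f r)
      = (\<Sum>i<n. c i * (LINT r:{p i..p (Suc i)}|lborel. f r) - (LINT r:{p i..p (Suc i)}|lborel. g r * f r))"
    using set_lebesgue_integral_sum_partition[OF gf p] by (simp add: sum_subtractf)
  also have "\<bar>\<dots>\<bar> \<le> (\<Sum>i<n. e * (LINT r:{p i..p (Suc i)}|lborel. \<bar>f r\<bar>))"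
  proof (rule order_trans[OF sum_abs], rule sum_mono)
    fix i assume "i \<in> {..<n}"
    then have i: "i < n" by simp
    let ?I = "{p i..p (Suc i)}"
    have fi: "set_integrable lborel ?I f" "set_integrable lborel ?I (\<lambda>r. g r * f r)"
      using set_integrable_subset[OF f _ sub[OF i]] set_integrable_subset[OF gf _ sub[OF i]] by auto
    have "c i * (LINT r:?I|lborel. f r) - (LINT r:?I|lborel. g r * f r) = (LINT r:?I|lborel. c i * f r - g r * f r)"
      using fi by (subst set_integral_diff) auto
    also have "\<bar>\<dots>\<bar> \<le> (LINT r:?I|lborel. \<bar>c i * f r - g r * f r\<bar>)"
      using set_integral_norm_bound[of lborel ?I "\<lambda>r. c i * f r - g r * f r"] fi by (auto intro: set_integral_diff)
    also have "\<dots> \<le> (LINT r:?I|lborel. e * \<bar>f r\<bar>)"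
    proof (rule set_integral_mono)
      show "set_integrable lborel ?I (\<lambda>r. \<bar>c i * f r - g r * f r\<bar>)"
        using fi by (intro set_integrable_abs set_integral_diff) auto
      show "set_integrable lborel ?I (\<lambda>r. e * \<bar>f r\<bar>)" using fi by (intro set_integrable_mult_right set_integrable_abs) auto
      fix r assume "r \<in> ?I"
      then show "\<bar>c i * f r - g r * f r\<bar> \<le> e * \<bar>f r\<bar>"
        using close[OF i, of r] by (auto simp: left_diff_distrib[symmetric] abs_mult intro!: mult_right_mono)
    qed
    finally show "\<bar>c i * (LINT r:?I|lborel. f r) - (LINT r:?I|lborel. g r * f r)\<bar> \<le> e * (LINT r:?I|lborel. \<bar>f r\<bar>)"
      by simp
  qed
  also have "\<dots> = e * (LINT r:{p 0..p n}|lborel. \<bar>f r\<bar>)"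
    using set_lebesgue_integral_sum_partition[of p n "\<lambda>r. \<bar>f r\<bar>", OF set_integrable_abs[OF f] p] by (simp add: sum_distrib_left)
  finally show ?thesis .
qed

text \<open>The Lagrange remainder is \<open>(h z - h t) * d^2 / 2\<close>. A modulus of the form
  \<open>\<eta> + C * d^2\<close> makes the error depend on \<open>d\<close> only through its second
  and fourth powers, whose expectations are available.\<close>

lemma taylor_second_order:
  fixes F G h :: "real \<Rightarrow> real"
  assumes F: "\<And>x. (F has_real_derivative G x) (at x)" and G: "\<And>x. (G has_real_derivative - h x) (at x)"
    and h: "\<And>x d. \<bar>h (x + d) - h x\<bar> \<le> \<eta> + C * d\<^sup>2" and "C \<ge> 0"
  shows "\<bar>F (z + d) - F z - G z * d + h z * d\<^sup>2 / 2\<bar> \<le> (\<eta> * d\<^sup>2 + C * d^4) / 2"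
proof (cases "d = 0")
  case False
  define df where "df = (\<lambda>m::nat. if m = 0 then F else if m = 1 then G else (\<lambda>x. - h x))"
  have "\<exists>t. (if z + d < z then z + d < t \<and> t < z else z < t \<and> t < z + d) \<and>
      F (z + d) = (\<Sum>m<2. df m z / fact m * (z + d - z)^m) + df 2 t / fact 2 * (z + d - z)^2"
  proof (rule Taylor[where a="z - \<bar>d\<bar>" and b="z + \<bar>d\<bar>"])
    show "\<forall>m t. m < 2 \<and> z - \<bar>d\<bar> \<le> t \<and> t \<le> z + \<bar>d\<bar> \<longrightarrow> (df m has_real_derivative df (Suc m) t) (at t)"
      using F G by (auto simp: df_def less_2_cases_iff)
  qed (use False in \<open>auto simp: df_def\<close>)
  then obtain t where "if z + d < z then z + d < t \<and> t < z else z < t \<and> t < z + d"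
    and t2: "F (z + d) = (\<Sum>m<2. df m z / fact m * d^m) + df 2 t / fact 2 * d^2"
    by auto
  then have t: "\<bar>t - z\<bar> \<le> \<bar>d\<bar>" by (auto split: if_splits)
  note t = t t2
  have "(t - z)\<^sup>2 \<le> d\<^sup>2" using t(1) by (simp add: abs_le_square_iff)
  have "F (z + d) - F z - G z * d + h z * d\<^sup>2 / 2 = (h z - h t) * d\<^sup>2 / 2"
    using t(2) by (simp add: df_def numeral_2_eq_2 field_simps)
  also have "\<bar>\<dots>\<bar> = \<bar>h (z + (t - z)) - h z\<bar> * d\<^sup>2 / 2" by (simp add: abs_mult abs_minus_commute)
  also have "\<dots> \<le> (\<eta> + C * (t - z)\<^sup>2) * d\<^sup>2 / 2"
    using h[of z "t - z"] by (intro divide_right_mono mult_right_mono) auto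
  also have "\<dots> \<le> (\<eta> + C * d\<^sup>2) * d\<^sup>2 / 2"
    using \<open>(t - z)\<^sup>2 \<le> d\<^sup>2\<close> \<open>C \<ge> 0\<close> by (intro divide_right_mono mult_right_mono add_left_mono mult_left_mono) auto
  also have "\<dots> = (\<eta> * d\<^sup>2 + C * d^4) / 2" by (simp add: field_simps power2_eq_square power4_eq_xxxx)
  finally show ?thesis .
qed simp

text \<open>Small \<open>d\<close> is covered by uniform continuity; for \<open>d\<close> at least
  \<open>\<delta>\<close> the trivial bound \<open>2 * B\<close> is at most
  \<open>2 * B * d^2 / \<delta>^2\<close>.\<close>

lemma uniformly_continuous_bounded_modulus:
  fixes h :: "real \<Rightarrow> real"
  assumes uc: "uniformly_continuous_on UNIV h" and B: "\<And>x. \<bar>h x\<bar> \<le> B" and "\<eta> > 0"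
  obtains C where "C \<ge> 0" "\<And>x d. \<bar>h (x + d) - h x\<bar> \<le> \<eta> + C * d\<^sup>2"
proof -
  obtain \<delta> where \<delta>: "\<delta> > 0" "\<And>x y. \<bar>x - y\<bar> < \<delta> \<Longrightarrow> \<bar>h x - h y\<bar> < \<eta>"
    using uc \<open>\<eta> > 0\<close> unfolding uniformly_continuous_on_def dist_real_def by (metis UNIV_I)
  have "B \<ge> 0" using B[of 0] by linarith
  show ?thesis
  proof
    show "2 * B / \<delta>\<^sup>2 \<ge> 0" using \<open>B \<ge> 0\<close> by simp
    fix x d
    show "\<bar>h (x + d) - h x\<bar> \<le> \<eta> + 2 * B / \<delta>\<^sup>2 * d\<^sup>2"
    proof (cases "\<bar>d\<bar> < \<delta>")
      case True
      then have "\<bar>h (x + d) - h x\<bar> < \<eta>" by (intro \<delta>) auto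
      moreover have "0 \<le> 2 * B / \<delta>\<^sup>2 * d\<^sup>2" using \<open>B \<ge> 0\<close> by simp
      ultimately show ?thesis by linarith
    next
      case False
      then have "\<delta>\<^sup>2 \<le> d\<^sup>2" using \<delta>(1) by (metis abs_le_square_iff abs_of_pos linorder_not_le)
      then have "2 * B * 1 \<le> 2 * B * (d\<^sup>2 / \<delta>\<^sup>2)" using \<delta>(1) \<open>B \<ge> 0\<close> by (intro mult_left_mono) auto
      then show ?thesis using B[of "x + d"] B[of x] \<open>\<eta> > 0\<close> by (simp add: field_simps)
    qed
  qed
qed

text \<open>A semimartingale \<open>Z\<close> with martingale part \<open>N\<close>, drift rate
  \<open>b\<close> and bracket rate \<open>v\<close>. The martingale and bracket properties are
  encoded as identities tested against bounded continuous functions of \<open>Z s\<close>, the form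
  in which an expansion over a partition uses them.\<close>

locale ito_process = prob_space M for M :: "'a measure" +
  fixes Z N b v :: "real \<Rightarrow> 'a \<Rightarrow> real" and K :: real
  assumes Z_meas: "\<And>r. 0 \<le> r \<Longrightarrow> Z r \<in> borel_measurable M"
    and N_meas: "\<And>r. 0 \<le> r \<Longrightarrow> N r \<in> borel_measurable M"
    and Z_cont: "\<And>w. w \<in> space M \<Longrightarrow> continuous_on {0..} (\<lambda>r. Z r w)"
    and N_cont: "\<And>w. w \<in> space M \<Longrightarrow> continuous_on {0..} (\<lambda>r. N r w)"
    and b_int: "\<And>w s t. w \<in> space M \<Longrightarrow> 0 \<le> s \<Longrightarrow> s \<le> t \<Longrightarrow> set_integrable lborel {s..t} (\<lambda>r. b r w)"
    and v_int: "\<And>w s t. w \<in> space M \<Longrightarrow> 0 \<le> s \<Longrightarrow> s \<le> t \<Longrightarrow> set_integrable lborel {s..t} (\<lambda>r. v r w)"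
    and decomp: "\<And>w s t. w \<in> space M \<Longrightarrow> 0 \<le> s \<Longrightarrow> s \<le> t \<Longrightarrow>
        Z t w - Z s w = N t w - N s w + (LINT r:{s..t}|lborel. b r w)"
    and V_meas: "\<And>s t. 0 \<le> s \<Longrightarrow> s \<le> t \<Longrightarrow> (\<lambda>w. LINT r:{s..t}|lborel. v r w) \<in> borel_measurable M"
    and b_dom: "\<And>s t. 0 \<le> s \<Longrightarrow> s \<le> t \<Longrightarrow> integrable M (\<lambda>w. LINT r:{s..t}|lborel. \<bar>b r w\<bar>)"
    and v_bound: "\<And>r w. \<bar>v r w\<bar> \<le> K"
    and N_int1: "\<And>s t. 0 \<le> s \<Longrightarrow> s \<le> t \<Longrightarrow> integrable M (\<lambda>w. N t w - N s w)"
    and N_int2: "\<And>s t. 0 \<le> s \<Longrightarrow> s \<le> t \<Longrightarrow> integrable M (\<lambda>w. (N t w - N s w)\<^sup>2)"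
    and N_int4: "\<And>s t. 0 \<le> s \<Longrightarrow> s \<le> t \<Longrightarrow> integrable M (\<lambda>w. (N t w - N s w)^4)"
    and N_moment4: "\<And>s t. 0 \<le> s \<Longrightarrow> s \<le> t \<Longrightarrow> (\<integral>w. (N t w - N s w)^4 \<partial>M) \<le> K * (t - s)\<^sup>2"
    and N_mart: "\<And>g s t. 0 \<le> s \<Longrightarrow> s \<le> t \<Longrightarrow> continuous_on UNIV g \<Longrightarrow> bounded (range g) \<Longrightarrow>
        (\<integral>w. g (Z s w) * (N t w - N s w) \<partial>M) = 0"
    and N_qv: "\<And>g s t. 0 \<le> s \<Longrightarrow> s \<le> t \<Longrightarrow> continuous_on UNIV g \<Longrightarrow> bounded (range g) \<Longrightarrow>
        (\<integral>w. g (Z s w) * (N t w - N s w)\<^sup>2 \<partial>M) = (\<integral>w. g (Z s w) * (LINT r:{s..t}|lborel. v r w) \<partial>M)"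
begin

lemma K_nonneg: "0 \<le> K"
  using v_bound[of 0 undefined] by linarith

lemma V_bound:
  assumes "w \<in> space M" "0 \<le> s" "s \<le> t"
  shows "\<bar>LINT r:{s..t}|lborel. v r w\<bar> \<le> K * (t - s)"
proof -
  have "\<bar>LINT r:{s..t}|lborel. v r w\<bar> \<le> (LINT r:{s..t}|lborel. \<bar>v r w\<bar>)"
    using set_integral_norm_bound[OF v_int[OF assms]] by simp
  also have "\<dots> \<le> (LINT r:{s..t}|lborel. K)"
    using assms v_int[OF assms] v_bound
    by (intro set_integral_mono set_integrable_abs) (auto simp: set_integrable_def)
  also have "\<dots> = K * (t - s)" using assms by (simp add: set_lebesgue_integral_def)
  finally show ?thesis .
qed

lemma N_moment2:
  assumes "0 \<le> s" "s \<le> t"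
  shows "(\<integral>w. (N t w - N s w)\<^sup>2 \<partial>M) \<le> K * (t - s)"
proof -
  have "(\<integral>w. (N t w - N s w)\<^sup>2 \<partial>M) = (\<integral>w. (LINT r:{s..t}|lborel. v r w) \<partial>M)"
    using N_qv[OF assms, of "\<lambda>_. 1"] by simp
  also have "\<dots> \<le> (\<integral>w. K * (t - s) \<partial>M)"
  proof (rule integral_mono)
    show "integrable M (\<lambda>w. LINT r:{s..t}|lborel. v r w)"
      using assms V_bound[OF _ assms] V_meas by (intro integrable_const_bound[where B="K * (t - s)"]) auto
    show "(LINT r:{s..t}|lborel. v r w) \<le> K * (t - s)" if "w \<in> space M" for w
      using V_bound[OF that assms] by linarith
  qed auto
  finally show ?thesis by (simp add: prob_space)
qed

end

text \<open>The second derivative is written \<open>- h\<close>, so that \<open>h\<close> is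
  nonnegative wherever \<open>F\<close> is concave.\<close>

locale ito_test = ito_process M Z N b v K for M :: "'a measure" and Z N b v K +
  fixes F G h :: "real \<Rightarrow> real" and B :: real and s t :: real
  assumes st: "0 \<le> s" "s < t"
    and F_der: "\<And>x. (F has_real_derivative G x) (at x)" and G_der: "\<And>x. (G has_real_derivative - h x) (at x)"
    and G_bound: "\<And>x. \<bar>G x\<bar> \<le> B" and h_bound: "\<And>x. \<bar>h x\<bar> \<le> B"
    and h_uc: "uniformly_continuous_on UNIV h"
begin

definition p :: "nat \<Rightarrow> nat \<Rightarrow> real" where "p n i = s + real i * (t - s) / real n"

abbreviation dN where "dN n i w \<equiv> N (p n (Suc i)) w - N (p n i) w"

lemma p_0 [simp]: "p n 0 = s" by (simp add: p_def)
lemma p_n: "n > 0 \<Longrightarrow> p n n = t" by (simp add: p_def)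
lemma p_Suc: "p n (Suc i) = p n i + (t - s) / real n" by (simp add: p_def distrib_right add_divide_distrib)
lemma p_mono: "p n i \<le> p n (Suc i)" using st by (simp add: p_Suc)
lemma p_ge: "s \<le> p n i" using st by (simp add: p_def)
lemma p_nonneg [simp]: "0 \<le> p n i" using st p_ge[of n i] by linarith
lemma p_le: assumes "i \<le> n" shows "p n i \<le> t"
proof (cases "n = 0")
  case False
  have "real i * (t - s) \<le> real n * (t - s)" using assms st by (intro mult_right_mono) auto
  then show ?thesis using False by (simp add: p_def field_simps)
qed (use st in \<open>auto simp: p_def\<close>)

lemma cont_F: "continuous_on UNIV F" and cont_G: "continuous_on UNIV G" and cont_h: "continuous_on UNIV h"
  using DERIV_isCont[OF F_der] DERIV_isCont[OF G_der] uniformly_continuous_imp_continuous[OF h_uc]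
  by (auto intro!: continuous_at_imp_continuous_on)

lemma meas_FGh [measurable]: "F \<in> borel_measurable borel" "G \<in> borel_measurable borel" "h \<in> borel_measurable borel"
  using cont_F cont_G cont_h by (auto intro: borel_measurable_continuous_onI)

lemma B_nonneg: "0 \<le> B" using G_bound[of 0] by linarith

lemma F_lipschitz: "\<bar>F x - F y\<bar> \<le> B * \<bar>x - y\<bar>"
  using field_differentiable_bound[of UNIV F G B x y] F_der G_bound by (auto simp: has_field_derivative_at_within)

lemma G_lipschitz: "\<bar>G x - G y\<bar> \<le> B * \<bar>x - y\<bar>"
  using field_differentiable_bound[of UNIV G "\<lambda>x. - h x" B x y] G_der h_bound by (auto simp: has_field_derivative_at_within)

text \<open>The increment of \<open>F(Z)\<close> is split at the intermediate point \<open>Z + dN\<close>: then the drift enters only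
  through \<open>|G| \<le> B\<close>, and a first moment of its integral suffices.  The intermediate point may be negative
  even if \<open>Z \<ge> 0\<close>, so \<open>F\<close> must be smooth on all of \<open>\<real>\<close>.\<close>

definition D where "D n i w = F (Z (p n (Suc i)) w) - F (Z (p n i) w + (dN n i w))"
text \<open>By \<open>N_qv\<close> its expectation is that of
  \<open>h (Z (p n i)) * (dN n i)^2\<close>; unlike sums of the latter, sums of \<open>H\<close>
  converge path by path.\<close>

definition H where "H n i w = h (Z (p n i) w) * (LINT r:{p n i..p n (Suc i)}|lborel. v r w)"
definition R where "R n i w = F (Z (p n i) w + (dN n i w)) - F (Z (p n i) w)
   - G (Z (p n i) w) * (dN n i w) + h (Z (p n i) w) * (dN n i w)\<^sup>2 / 2"

lemma D_meas [measurable]: "D n i \<in> borel_measurable M" and H_meas [measurable]: "H n i \<in> borel_measurable M"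
  and R_meas [measurable]: "R n i \<in> borel_measurable M"
proof -
  note [measurable] = Z_meas[OF p_nonneg] N_meas[OF p_nonneg] V_meas[OF p_nonneg p_mono]
  show "D n i \<in> borel_measurable M" unfolding D_def[abs_def] by measurable
  show "H n i \<in> borel_measurable M" unfolding H_def[abs_def] by measurable
  show "R n i \<in> borel_measurable M" unfolding R_def[abs_def] by measurable
qed

lemma small_mesh:
  assumes "\<delta> > 0" shows "\<exists>n0>0. \<forall>n\<ge>n0. (t - s) / real n < \<delta>"
proof -
  obtain n0 :: nat where "(t - s) / \<delta> < real n0" using reals_Archimedean2 by blast
  have "(t - s) / real n < \<delta>" if "n \<ge> Suc n0" for n
  proof -
    have "(t - s) / \<delta> < real n" using \<open>_ < real n0\<close> that by linarith
    then show ?thesis using assms that by (simp add: field_simps)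
  qed
  then show ?thesis by blast
qed

lemma path_uniform:
  assumes "continuous_on {s..t} (f :: real \<Rightarrow> real)" "e > 0"
  obtains n0 where "n0 > 0" "\<And>n i q r. n \<ge> n0 \<Longrightarrow> i < n \<Longrightarrow> q\<in>{p n i..p n (Suc i)} \<Longrightarrow> r\<in>{p n i..p n (Suc i)} \<Longrightarrow> \<bar>f q - f r\<bar> \<le> e"
proof -
  have "uniformly_continuous_on {s..t} f" by (rule compact_uniformly_continuous[OF assms(1) compact_Icc])
  then obtain \<delta> where \<delta>: "\<delta> > 0" "\<And>x y. x \<in> {s..t} \<Longrightarrow> y \<in> {s..t} \<Longrightarrow> \<bar>x - y\<bar> < \<delta> \<Longrightarrow> \<bar>f x - f y\<bar> < e"
    using \<open>e > 0\<close> unfolding uniformly_continuous_on_def dist_real_def by metis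
  obtain n0 where n0: "n0 > 0" "\<And>n. n \<ge> n0 \<Longrightarrow> (t - s) / real n < \<delta>" using small_mesh[OF \<delta>(1)] by blast
  have "\<bar>f q - f r\<bar> \<le> e" if "n \<ge> n0" "i < n" "q\<in>{p n i..p n (Suc i)}" "r\<in>{p n i..p n (Suc i)}" for n i q r
  proof -
    have "q \<in> {s..t}" "r \<in> {s..t}" using that p_ge[of n i] p_le[of "Suc i" n] by auto
    moreover have "\<bar>q - r\<bar> < \<delta>" using that n0(2)[of n] by (auto simp: p_Suc)
    ultimately show ?thesis using \<delta>(2) by force
  qed
  then show ?thesis using that n0(1) by blast
qed

lemma path_cont: 
  assumes "w \<in> space M"
  shows "continuous_on {s..t} (\<lambda>r. Z r w)" "continuous_on {s..t} (\<lambda>r. N r w)"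
    "continuous_on {s..t} (\<lambda>r. G (Z r w))" "continuous_on {s..t} (\<lambda>r. h (Z r w))"
proof -
  show Z: "continuous_on {s..t} (\<lambda>r. Z r w)" "continuous_on {s..t} (\<lambda>r. N r w)"
    using assms st by (auto intro: continuous_on_subset[OF Z_cont] continuous_on_subset[OF N_cont])
  show "continuous_on {s..t} (\<lambda>r. G (Z r w))" "continuous_on {s..t} (\<lambda>r. h (Z r w))"
    using continuous_on_compose2[OF cont_G Z(1)] continuous_on_compose2[OF cont_h Z(1)] by auto
qed

lemma LIMSEQ_scaled:
  assumes "\<And>e. e > 0 \<Longrightarrow> \<exists>n0::nat. \<forall>n\<ge>n0. \<bar>x n - L\<bar> \<le> e * A"
  shows "x \<longlonglongrightarrow> (L::real)"
proof (rule LIMSEQ_I)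
  fix r :: real assume "0 < r"
  define e where "e = r / (2 * (\<bar>A\<bar> + 1))"
  have e: "e > 0" using \<open>0 < r\<close> by (simp add: e_def)
  have "e * A \<le> e * (\<bar>A\<bar> + 1)" using e by (intro mult_left_mono) auto
  also have "\<dots> = r / 2" unfolding e_def by (simp add: divide_simps)
  also have "\<dots> < r" using \<open>0 < r\<close> by simp
  finally have "e * A < r" .
  then show "\<exists>no. \<forall>n\<ge>no. norm (x n - L) < r"
    using assms[OF e] by (metis order_le_less_trans real_norm_def)
qed

text \<open>The mean value theorem turns \<open>D\<close> into \<open>G \<xi>\<close> times the
  integral of the drift over the cell, so the sum is a weighted partition sum.\<close>

lemma D_limit:
  assumes w: "w \<in> space M"
  shows "(\<lambda>n. \<Sum>i<n. D n i w) \<longlonglongrightarrow> (LINT r:{s..t}|lborel. G (Z r w) * b r w)"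
proof (rule LIMSEQ_scaled)
  fix e :: real assume "e > 0"
  obtain n1 where n1: "n1 > 0" "\<And>n i q r. n \<ge> n1 \<Longrightarrow> i < n \<Longrightarrow> q\<in>{p n i..p n (Suc i)} \<Longrightarrow> r\<in>{p n i..p n (Suc i)} \<Longrightarrow> \<bar>Z q w - Z r w\<bar> \<le> e"
    by (rule path_uniform[OF path_cont(1)[OF w] \<open>e > 0\<close>], rule that) auto
  obtain n2 where n2: "n2 > 0" "\<And>n i q r. n \<ge> n2 \<Longrightarrow> i < n \<Longrightarrow> q\<in>{p n i..p n (Suc i)} \<Longrightarrow> r\<in>{p n i..p n (Suc i)} \<Longrightarrow> \<bar>N q w - N r w\<bar> \<le> e"
    by (rule path_uniform[OF path_cont(2)[OF w] \<open>e > 0\<close>], rule that) auto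
  show "\<exists>n0. \<forall>n\<ge>n0. \<bar>(\<Sum>i<n. D n i w) - (LINT r:{s..t}|lborel. G (Z r w) * b r w)\<bar>
      \<le> e * (2 * B * (LINT r:{s..t}|lborel. \<bar>b r w\<bar>))"
  proof (intro exI[of _ "max n1 n2"] allI impI)
    fix n assume "max n1 n2 \<le> n"
    then have n: "n \<ge> n1" "n \<ge> n2" "n > 0" using n1(1) by auto
    define y where "y i = Z (p n i) w + (dN n i w)" for i
    define z where "z i = Z (p n (Suc i)) w" for i
    have zy: "z i - y i = (LINT r:{p n i..p n (Suc i)}|lborel. b r w)" if "i < n" for i
      using decomp[OF w _ p_mono[of n i]] by (simp add: z_def y_def)
    \<comment> \<open>\<open>y i\<close> is the start of the cell moved by the martingale increment
      only. For a fine mesh \<open>y i\<close> and \<open>z i\<close>, hence also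
      \<open>\<xi>\<close>, are within \<open>2 * e\<close> of the path on that cell.\<close>
    have "\<exists>\<xi>. D n i w = G \<xi> * (z i - y i) \<and> min (y i) (z i) \<le> \<xi> \<and> \<xi> \<le> max (y i) (z i)" for i
    proof -
      consider "y i < z i" | "z i < y i" | "z i = y i" by linarith
      then show ?thesis
      proof cases
        case 1
        obtain \<xi> where "y i < \<xi>" "\<xi> < z i" "F (z i) - F (y i) = (z i - y i) * G \<xi>"
          using MVT2[OF 1, of F G] F_der by blast
        then show ?thesis by (intro exI[of _ \<xi>]) (auto simp: D_def y_def[symmetric] z_def[symmetric])
      next
        case 2
        obtain \<xi> where "z i < \<xi>" "\<xi> < y i" "F (y i) - F (z i) = (y i - z i) * G \<xi>"
          using MVT2[OF 2, of F G] F_der by blast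
        moreover have "D n i w = F (z i) - F (y i)" by (simp add: D_def y_def z_def)
        ultimately show ?thesis by (intro exI[of _ \<xi>]) (auto simp: algebra_simps)
      next
        case 3
        then show ?thesis by (intro exI[of _ "y i"]) (auto simp: D_def y_def[symmetric] z_def[symmetric])
      qed
    qed
    then obtain \<xi> where \<xi>: "\<And>i. D n i w = G (\<xi> i) * (z i - y i)" "\<And>i. min (y i) (z i) \<le> \<xi> i" "\<And>i. \<xi> i \<le> max (y i) (z i)"
      by metis
    have "\<bar>(\<Sum>i<n. G (\<xi> i) * (LINT r:{p n i..p n (Suc i)}|lborel. b r w)) - (LINT r:{p n 0..p n n}|lborel. G (Z r w) * b r w)\<bar>
         \<le> (2 * B * e) * (LINT r:{p n 0..p n n}|lborel. \<bar>b r w\<bar>)"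
    proof (rule weighted_partition_sum_error)
      show "set_integrable lborel {p n 0..p n n} (\<lambda>r. b r w)" using b_int[OF w, of s t] st n by (simp add: p_n)
      show "continuous_on {p n 0..p n n} (\<lambda>r. G (Z r w))" using path_cont(3)[OF w] n by (simp add: p_n)
      show "p n i \<le> p n (Suc i)" for i by (rule p_mono)
      fix i r assume i: "i < n" and r: "p n i \<le> r" "r \<le> p n (Suc i)"
      have "\<bar>z i - Z r w\<bar> \<le> e" unfolding z_def using i r n p_mono[of n i] by (intro n1(2)[of n i]) auto
      moreover have "\<bar>Z (p n i) w - Z r w\<bar> \<le> e" using i r n p_mono[of n i] by (intro n1(2)[of n i]) auto
      moreover have "\<bar>dN n i w\<bar> \<le> e" using i r n p_mono[of n i] by (intro n2(2)[of n i]) auto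
      ultimately have "\<bar>\<xi> i - Z r w\<bar> \<le> 2 * e" using \<xi>(2,3)[of i] unfolding y_def by linarith
      then have "B * \<bar>\<xi> i - Z r w\<bar> \<le> B * (2 * e)" using B_nonneg by (intro mult_left_mono)
      then show "\<bar>G (\<xi> i) - G (Z r w)\<bar> \<le> 2 * B * e" using G_lipschitz[of "\<xi> i" "Z r w"] by simp
    qed
    then show "\<bar>(\<Sum>i<n. D n i w) - (LINT r:{s..t}|lborel. G (Z r w) * b r w)\<bar>
      \<le> e * (2 * B * (LINT r:{s..t}|lborel. \<bar>b r w\<bar>))"
      using n by (simp add: p_n \<xi>(1) zy mult_ac)
  qed
qed

lemma H_limit:
  assumes w: "w \<in> space M"
  shows "(\<lambda>n. \<Sum>i<n. H n i w) \<longlonglongrightarrow> (LINT r:{s..t}|lborel. h (Z r w) * v r w)"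
proof (rule LIMSEQ_scaled)
  fix e :: real assume "e > 0"
  obtain n1 where n1: "n1 > 0" "\<And>n i q r. n \<ge> n1 \<Longrightarrow> i < n \<Longrightarrow> q\<in>{p n i..p n (Suc i)} \<Longrightarrow> r\<in>{p n i..p n (Suc i)} \<Longrightarrow> \<bar>h (Z q w) - h (Z r w)\<bar> \<le> e"
    by (rule path_uniform[OF path_cont(4)[OF w] \<open>e > 0\<close>], rule that) auto
  show "\<exists>n0. \<forall>n\<ge>n0. \<bar>(\<Sum>i<n. H n i w) - (LINT r:{s..t}|lborel. h (Z r w) * v r w)\<bar>
      \<le> e * (LINT r:{s..t}|lborel. \<bar>v r w\<bar>)"
  proof (intro exI[of _ "n1"] allI impI)
    fix n assume n: "n1 \<le> n"
    then have n0: "n > 0" using n1(1) by auto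
    have "\<bar>(\<Sum>i<n. h (Z (p n i) w) * (LINT r:{p n i..p n (Suc i)}|lborel. v r w)) - (LINT r:{p n 0..p n n}|lborel. h (Z r w) * v r w)\<bar>
         \<le> e * (LINT r:{p n 0..p n n}|lborel. \<bar>v r w\<bar>)"
    proof (rule weighted_partition_sum_error)
      show "set_integrable lborel {p n 0..p n n} (\<lambda>r. v r w)" using v_int[OF w, of s t] st n0 by (simp add: p_n)
      show "continuous_on {p n 0..p n n} (\<lambda>r. h (Z r w))" using path_cont(4)[OF w] n0 by (simp add: p_n)
      show "p n i \<le> p n (Suc i)" for i by (rule p_mono)
      show "\<bar>h (Z (p n i) w) - h (Z r w)\<bar> \<le> e" if "i < n" "p n i \<le> r" "r \<le> p n (Suc i)" for i r
        using that n p_mono[of n i] by (intro n1(2)[of n i]) auto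
    qed
    then show "\<bar>(\<Sum>i<n. H n i w) - (LINT r:{s..t}|lborel. h (Z r w) * v r w)\<bar> \<le> e * (LINT r:{s..t}|lborel. \<bar>v r w\<bar>)"
      using n0 by (simp add: p_n H_def)
  qed
qed

lemma D_bound:
  assumes "w \<in> space M"
  shows "\<bar>D n i w\<bar> \<le> B * (LINT r:{p n i..p n (Suc i)}|lborel. \<bar>b r w\<bar>)"
proof -
  let ?I = "LINT r:{p n i..p n (Suc i)}|lborel. b r w"
  have bi: "set_integrable lborel {p n i..p n (Suc i)} (\<lambda>r. b r w)" by (rule b_int[OF assms p_nonneg p_mono])
  have "\<bar>D n i w\<bar> \<le> B * \<bar>Z (p n (Suc i)) w - (Z (p n i) w + (dN n i w))\<bar>"
    unfolding D_def by (rule F_lipschitz)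
  also have "\<dots> = B * \<bar>?I\<bar>" using decomp[OF assms p_nonneg p_mono[of n i]] by (simp add: algebra_simps)
  also have "\<dots> \<le> B * (LINT r:{p n i..p n (Suc i)}|lborel. \<bar>b r w\<bar>)"
    using B_nonneg set_integral_norm_bound[OF bi] by (intro mult_left_mono) auto
  finally show ?thesis .
qed

lemma D_int: "integrable M (D n i)"
  by (rule Bochner_Integration.integrable_bound[where f="\<lambda>w. B * (LINT r:{p n i..p n (Suc i)}|lborel. \<bar>b r w\<bar>)"])
     (auto intro!: AE_I2 integrable_mult_right b_dom p_mono order_trans[OF D_bound])

lemma D_sum_bound:
  assumes "w \<in> space M"
  shows "\<bar>\<Sum>i<n. D n i w\<bar> \<le> B * (LINT r:{s..t}|lborel. \<bar>b r w\<bar>)"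
proof (cases "n = 0")
  case True
  have "0 \<le> (LINT r:{s..t}|lborel. \<bar>b r w\<bar>)" unfolding set_lebesgue_integral_def by (rule Bochner_Integration.integral_nonneg) auto
  then show ?thesis using True B_nonneg by simp
next
  case False
  then have n: "p n n = t" by (simp add: p_n)
  have "\<bar>\<Sum>i<n. D n i w\<bar> \<le> (\<Sum>i<n. B * (LINT r:{p n i..p n (Suc i)}|lborel. \<bar>b r w\<bar>))"
    by (rule order_trans[OF sum_abs sum_mono]) (rule D_bound[OF assms])
  also have "\<dots> = B * (LINT r:{p n 0..p n n}|lborel. \<bar>b r w\<bar>)"
    using set_lebesgue_integral_sum_partition[of "p n" n "\<lambda>r. \<bar>b r w\<bar>"] p_mono b_int[OF assms, of s t] st
    by (simp add: n sum_distrib_left set_integrable_abs)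
  finally show ?thesis by (simp add: n)
qed

lemma H_bound:
  assumes "w \<in> space M"
  shows "\<bar>H n i w\<bar> \<le> B * (K * ((t - s) / real n))"
proof -
  have "\<bar>H n i w\<bar> \<le> B * (K * (p n (Suc i) - p n i))"
    unfolding H_def abs_mult using h_bound V_bound[OF assms p_nonneg p_mono[of n i]] B_nonneg
    by (intro mult_mono) auto
  then show ?thesis by (simp add: p_Suc)
qed

lemma H_int: "integrable M (H n i)"
  using H_bound by (intro integrable_const_bound[where B="B * (K * ((t - s) / real n))"]) auto

lemma H_sum_bound:
  assumes "w \<in> space M"
  shows "\<bar>\<Sum>i<n. H n i w\<bar> \<le> B * (K * (t - s))"
proof (cases "n = 0")
  case False
  have "\<bar>\<Sum>i<n. H n i w\<bar> \<le> (\<Sum>i<n. B * (K * ((t - s) / real n)))"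
    by (rule order_trans[OF sum_abs sum_mono]) (rule H_bound[OF assms])
  then show ?thesis using False by simp
qed (use B_nonneg K_nonneg st in simp)

text \<open>Dominated convergence, with dominating functions that do not depend on the partition;
  the limits inherit measurability from the sums.\<close>

lemma DH_limits:
  shows "integrable M (\<lambda>w. LINT r:{s..t}|lborel. G (Z r w) * b r w)"
    and "(\<lambda>n. \<integral>w. (\<Sum>i<n. D n i w) \<partial>M) \<longlonglongrightarrow> (\<integral>w. (LINT r:{s..t}|lborel. G (Z r w) * b r w) \<partial>M)"
    and "integrable M (\<lambda>w. LINT r:{s..t}|lborel. h (Z r w) * v r w)"
    and "(\<lambda>n. \<integral>w. (\<Sum>i<n. H n i w) \<partial>M) \<longlonglongrightarrow> (\<integral>w. (LINT r:{s..t}|lborel. h (Z r w) * v r w) \<partial>M)"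
proof -
  have mD: "(\<lambda>w. LINT r:{s..t}|lborel. G (Z r w) * b r w) \<in> borel_measurable M"
    by (rule borel_measurable_LIMSEQ_real[OF D_limit]) auto
  have mH: "(\<lambda>w. LINT r:{s..t}|lborel. h (Z r w) * v r w) \<in> borel_measurable M"
    by (rule borel_measurable_LIMSEQ_real[OF H_limit]) auto
  have dom: "integrable M (\<lambda>w. B * (LINT r:{s..t}|lborel. \<bar>b r w\<bar>))"
    using b_dom[of s t] st by simp
  show "integrable M (\<lambda>w. LINT r:{s..t}|lborel. G (Z r w) * b r w)"
    by (rule integrable_dominated_convergence[OF mD _ dom, of "\<lambda>n w. \<Sum>i<n. D n i w"])
       (auto intro!: AE_I2 D_limit D_sum_bound)
  show "(\<lambda>n. \<integral>w. (\<Sum>i<n. D n i w) \<partial>M) \<longlonglongrightarrow> (\<integral>w. (LINT r:{s..t}|lborel. G (Z r w) * b r w) \<partial>M)"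
    by (rule integral_dominated_convergence[OF mD _ dom])
       (auto intro!: AE_I2 D_limit D_sum_bound)
  show "integrable M (\<lambda>w. LINT r:{s..t}|lborel. h (Z r w) * v r w)"
    by (rule integrable_dominated_convergence[OF mH, of "\<lambda>n w. \<Sum>i<n. H n i w" "\<lambda>_. B * (K * (t - s))"])
       (auto intro!: AE_I2 H_limit H_sum_bound)
  show "(\<lambda>n. \<integral>w. (\<Sum>i<n. H n i w) \<partial>M) \<longlonglongrightarrow> (\<integral>w. (LINT r:{s..t}|lborel. h (Z r w) * v r w) \<partial>M)"
    by (rule integral_dominated_convergence[OF mH, where w="\<lambda>_. B * (K * (t - s))"])
       (auto intro!: AE_I2 H_limit H_sum_bound)
qed

lemma GN_int: "integrable M (\<lambda>w. G (Z (p n i) w) * (dN n i w))"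
  and hN_int: "integrable M (\<lambda>w. h (Z (p n i) w) * (dN n i w)\<^sup>2)"
  and FN_int: "integrable M (\<lambda>w. F (Z (p n i) w + (dN n i w)) - F (Z (p n i) w))"
proof -
  note [measurable] = Z_meas[OF p_nonneg] N_meas[OF p_nonneg]
  have N1: "integrable M (\<lambda>w. B * \<bar>dN n i w\<bar>)"
    and N2: "integrable M (\<lambda>w. B * (dN n i w)\<^sup>2)"
    using N_int1[OF p_nonneg p_mono[of n i]] N_int2[OF p_nonneg p_mono[of n i]] by auto
  show "integrable M (\<lambda>w. G (Z (p n i) w) * (dN n i w))"
    by (rule Bochner_Integration.integrable_bound[OF N1])
       (use G_bound B_nonneg in \<open>auto simp: abs_mult intro!: AE_I2 mult_right_mono\<close>)
  show "integrable M (\<lambda>w. h (Z (p n i) w) * (dN n i w)\<^sup>2)"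
    by (rule Bochner_Integration.integrable_bound[OF N2])
       (use h_bound B_nonneg in \<open>auto simp: abs_mult intro!: AE_I2 mult_right_mono\<close>)
  show "integrable M (\<lambda>w. F (Z (p n i) w + (dN n i w)) - F (Z (p n i) w))"
    by (rule Bochner_Integration.integrable_bound[OF N1])
       (use B_nonneg in \<open>auto intro!: AE_I2 order_trans[OF F_lipschitz]\<close>)
qed

lemma R_int: "integrable M (R n i)"
  unfolding R_def[abs_def] using GN_int[of n i] hN_int[of n i] FN_int[of n i] by auto

text \<open>Summed over \<open>n\<close> cells of length \<open>(t - s) / n\<close>, second moments
  contribute a bounded amount times \<open>\<eta>\<close>, and fourth moments a multiple of
  \<open>1 / n\<close>. Hence \<open>\<eta>\<close> is fixed before \<open>n\<close> is sent to
  infinity.\<close>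

lemma R_expectation_bound:
  assumes "\<eta> > 0" and C: "C \<ge> 0" "\<And>x d. \<bar>h (x + d) - h x\<bar> \<le> \<eta> + C * d\<^sup>2" and "n > 0"
  shows "\<bar>\<Sum>i<n. \<integral>w. R n i w \<partial>M\<bar> \<le> (\<eta> * K * (t - s) + C * K * (t - s)\<^sup>2 / real n) / 2"
proof -
  let ?d = "(t - s) / real n"
  have "\<bar>\<integral>w. R n i w \<partial>M\<bar> \<le> (\<eta> * (K * ?d) + C * (K * ?d\<^sup>2)) / 2" for i
  proof -
    let ?N = "\<lambda>w. dN n i w"
    have i2: "integrable M (\<lambda>w. (?N w)\<^sup>2)" "integrable M (\<lambda>w. (?N w)^4)"
      using N_int2[OF p_nonneg p_mono[of n i]] N_int4[OF p_nonneg p_mono[of n i]] by auto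
    have "\<bar>\<integral>w. R n i w \<partial>M\<bar> \<le> (\<integral>w. \<bar>R n i w\<bar> \<partial>M)" by (rule integral_abs_bound)
    also have "\<dots> \<le> (\<integral>w. (\<eta> * (?N w)\<^sup>2 + C * (?N w)^4) / 2 \<partial>M)"
      using i2 R_int unfolding R_def
      by (intro integral_mono taylor_second_order[OF F_der G_der C(2,1)]) (auto simp: R_def[abs_def])
    also have "\<dots> = (\<eta> * (\<integral>w. (?N w)\<^sup>2 \<partial>M) + C * (\<integral>w. (?N w)^4 \<partial>M)) / 2"
      using i2 by simp
    also have "\<dots> \<le> (\<eta> * (K * ?d) + C * (K * ?d\<^sup>2)) / 2"
      using N_moment2[OF p_nonneg p_mono[of n i]] N_moment4[OF p_nonneg p_mono[of n i]] \<open>\<eta> > 0\<close> \<open>C \<ge> 0\<close>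
      by (intro divide_right_mono add_mono mult_left_mono) (auto simp: p_Suc)
    finally show ?thesis .
  qed
  then have "\<bar>\<Sum>i<n. \<integral>w. R n i w \<partial>M\<bar> \<le> (\<Sum>i<n. (\<eta> * (K * ?d) + C * (K * ?d\<^sup>2)) / 2)"
    by (intro order_trans[OF sum_abs sum_mono])
  also have "\<dots> = (\<eta> * K * (t - s) + C * K * (t - s)\<^sup>2 / real n) / 2"
    using \<open>n > 0\<close> by (simp add: field_simps power2_eq_square)
  finally show ?thesis .
qed

lemma R_limit: "(\<lambda>n. \<Sum>i<n. \<integral>w. R n i w \<partial>M) \<longlonglongrightarrow> 0"
proof (rule LIMSEQ_scaled)
  fix e :: real assume e: "e > 0"
  obtain C where C: "C \<ge> 0" "\<And>x d. \<bar>h (x + d) - h x\<bar> \<le> e + C * d\<^sup>2"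
    using uniformly_continuous_bounded_modulus[OF h_uc h_bound e] by blast
  obtain n0 :: nat where n0: "C * (t - s) / e < real n0" using reals_Archimedean2 by blast
  show "\<exists>n0. \<forall>n\<ge>n0. \<bar>(\<Sum>i<n. \<integral>w. R n i w \<partial>M) - 0\<bar> \<le> e * (K * (t - s))"
  proof (intro exI[of _ "Suc n0"] allI impI)
    fix n assume n: "Suc n0 \<le> n"
    have "C * (t - s) / e < real n" using n0 n by linarith
    then have "C * (t - s) / real n \<le> e" using n e by (simp add: field_simps)
    then have "K * (t - s) * (C * (t - s) / real n) \<le> K * (t - s) * e"
      using K_nonneg st by (intro mult_left_mono) auto
    moreover have "K * (t - s) * (C * (t - s) / real n) = C * K * (t - s)\<^sup>2 / real n"
      by (simp add: power2_eq_square mult.assoc mult.left_commute mult.commute)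
    moreover have "e * K * (t - s) = e * (K * (t - s))" "K * (t - s) * e = e * (K * (t - s))" by simp_all
    moreover have "(x + y) / 2 \<le> z" if "y \<le> z" "x = z" for x y z :: real using that by (simp add: field_simps)
    ultimately have "(e * K * (t - s) + C * K * (t - s)\<^sup>2 / real n) / 2 \<le> e * (K * (t - s))" by metis
    then show "\<bar>(\<Sum>i<n. \<integral>w. R n i w \<partial>M) - 0\<bar> \<le> e * (K * (t - s))"
      using order_trans[OF R_expectation_bound[OF e C, of n]] n by simp
  qed
qed

text \<open>On each cell the increment of \<open>F (Z r)\<close> is
  \<open>D + R + G * dN - h * dN^2 / 2\<close>. The term with \<open>G\<close> has mean 0, the term
  with \<open>h\<close> has the mean of \<open>H\<close>, and \<open>R\<close> vanishes in the
  limit. \<open>F\<close> may be unbounded, so the increment is integrated as a whole.\<close>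

theorem ito_expectation:
  shows "integrable M (\<lambda>w. F (Z t w) - F (Z s w))"
    and "(\<integral>w. F (Z t w) - F (Z s w) \<partial>M) =
      (\<integral>w. (LINT r:{s..t}|lborel. G (Z r w) * b r w) \<partial>M) - (\<integral>w. (LINT r:{s..t}|lborel. h (Z r w) * v r w) \<partial>M) / 2"
proof -
  have step: "F (Z (p n (Suc i)) w) - F (Z (p n i) w) = D n i w + (F (Z (p n i) w + (dN n i w)) - F (Z (p n i) w))"
    for n i w by (simp add: D_def)
  have tele: "F (Z t w) - F (Z s w) = (\<Sum>i<n. F (Z (p n (Suc i)) w) - F (Z (p n i) w))" if "n > 0" for n w
    using sum_lessThan_telescope[of "\<lambda>i. F (Z (p n i) w)" n] that by (simp add: p_n)
  have int: "integrable M (\<lambda>w. F (Z (p n (Suc i)) w) - F (Z (p n i) w))" for n i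
    unfolding step using D_int FN_int by auto
  show "integrable M (\<lambda>w. F (Z t w) - F (Z s w))"
    unfolding tele[of 1, OF zero_less_one] using int[of 1 0] by (simp del: p_0 add: lessThan_Suc)
  have one: "(\<integral>w. F (Z (p n (Suc i)) w) - F (Z (p n i) w) \<partial>M) = (\<integral>w. D n i w \<partial>M) - (\<integral>w. H n i w \<partial>M) / 2 + (\<integral>w. R n i w \<partial>M)" for n i
  proof -
    let ?N = "\<lambda>w. dN n i w"
    have "F (Z (p n (Suc i)) w) - F (Z (p n i) w) = D n i w + R n i w + G (Z (p n i) w) * ?N w - (h (Z (p n i) w) * (?N w)\<^sup>2) / 2" for w
      by (simp add: D_def R_def)
    then have "(\<integral>w. F (Z (p n (Suc i)) w) - F (Z (p n i) w) \<partial>M) =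
       (\<integral>w. D n i w \<partial>M) + (\<integral>w. R n i w \<partial>M) + (\<integral>w. G (Z (p n i) w) * ?N w \<partial>M) - (\<integral>w. h (Z (p n i) w) * (?N w)\<^sup>2 \<partial>M) / 2"
      using D_int R_int GN_int hN_int by simp
    moreover have "(\<integral>w. G (Z (p n i) w) * ?N w \<partial>M) = 0"
      using N_mart[OF p_nonneg p_mono cont_G] G_bound by (auto simp: bounded_iff)
    moreover have "(\<integral>w. h (Z (p n i) w) * (?N w)\<^sup>2 \<partial>M) = (\<integral>w. H n i w \<partial>M)"
      unfolding H_def using N_qv[OF p_nonneg p_mono cont_h] h_bound by (auto simp: bounded_iff)
    ultimately show ?thesis by simp
  qed
  \<comment> \<open>The left side does not depend on \<open>n\<close>, so the limit of the right
    side is its value.\<close>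
  have eq: "(\<integral>w. F (Z t w) - F (Z s w) \<partial>M) =
     (\<integral>w. (\<Sum>i<n. D n i w) \<partial>M) - (\<integral>w. (\<Sum>i<n. H n i w) \<partial>M) / 2 + (\<Sum>i<n. \<integral>w. R n i w \<partial>M)" if "n > 0" for n
  proof -
    have "(\<integral>w. F (Z t w) - F (Z s w) \<partial>M) = (\<Sum>i<n. (\<integral>w. D n i w \<partial>M) - (\<integral>w. H n i w \<partial>M) / 2 + (\<integral>w. R n i w \<partial>M))"
      unfolding tele[OF that] one[symmetric] by (rule Bochner_Integration.integral_sum) (rule int)
    moreover have "(\<integral>w. (\<Sum>i<n. D n i w) \<partial>M) = (\<Sum>i<n. \<integral>w. D n i w \<partial>M)"
      by (rule Bochner_Integration.integral_sum) (rule D_int)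
    moreover have "(\<integral>w. (\<Sum>i<n. H n i w) \<partial>M) = (\<Sum>i<n. \<integral>w. H n i w \<partial>M)"
      by (rule Bochner_Integration.integral_sum) (rule H_int)
    ultimately show ?thesis by (simp only: sum.distrib sum_subtractf sum_divide_distrib)
  qed
  have "(\<lambda>n. (\<integral>w. (\<Sum>i<n. D n i w) \<partial>M) - (\<integral>w. (\<Sum>i<n. H n i w) \<partial>M) / 2 + (\<Sum>i<n. \<integral>w. R n i w \<partial>M)) \<longlonglongrightarrow>
     (\<integral>w. (LINT r:{s..t}|lborel. G (Z r w) * b r w) \<partial>M) - (\<integral>w. (LINT r:{s..t}|lborel. h (Z r w) * v r w) \<partial>M) / 2 + 0"
    by (intro tendsto_intros DH_limits R_limit) simp
  moreover have "(\<lambda>n. (\<integral>w. (\<Sum>i<n. D n i w) \<partial>M) - (\<integral>w. (\<Sum>i<n. H n i w) \<partial>M) / 2 + (\<Sum>i<n. \<integral>w. R n i w \<partial>M)) \<longlonglongrightarrow>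
     (\<integral>w. F (Z t w) - F (Z s w) \<partial>M)"
    by (rule tendsto_eventually, rule eventually_sequentiallyI[of 1]) (rule eq[symmetric], simp)
  ultimately show "(\<integral>w. F (Z t w) - F (Z s w) \<partial>M) =
      (\<integral>w. (LINT r:{s..t}|lborel. G (Z r w) * b r w) \<partial>M) - (\<integral>w. (LINT r:{s..t}|lborel. h (Z r w) * v r w) \<partial>M) / 2"
    using LIMSEQ_unique by force
qed

end

section \<open>Concave test functions\<close>

text \<open>The square makes the cut-off continuously differentiable at \<open>e\<close>, so the
  curvature of the test function stays continuous there.\<close>

lemma has_derivative_positive_part_square:
  "((\<lambda>z. (max 0 (e - z))\<^sup>2) has_real_derivative - 2 * max 0 (e - z)) (at z)" for e z :: real
proof -
  consider "z < e" | "z > e" | "z = e" by linarith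
  then show ?thesis
  proof cases
    case 1
    have "((\<lambda>z. (e - z)\<^sup>2) has_real_derivative - 2 * (e - z)) (at z)"
      by (auto intro!: derivative_eq_intros)
    then have "((\<lambda>z. (max 0 (e - z))\<^sup>2) has_real_derivative - 2 * (e - z)) (at z)"
      by (rule DERIV_cong_ev[THEN iffD1, rotated -1, OF _ refl _ refl])
         (use 1 in \<open>auto intro!: eventually_mono[OF eventually_nhds_in_open[of "{..<e}"]]\<close>)
    then show ?thesis using 1 by simp
  next
    case 2
    have "((\<lambda>z. 0) has_real_derivative 0) (at z)" by simp
    then have "((\<lambda>z. (max 0 (e - z))\<^sup>2) has_real_derivative 0) (at z)"
      by (rule DERIV_cong_ev[THEN iffD1, rotated -1, OF _ refl _ refl])
         (use 2 in \<open>auto intro!: eventually_mono[OF eventually_nhds_in_open[of "{e<..}"]]\<close>)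
    then show ?thesis using 2 by simp
  next
    case 3
    have "(\<lambda>h. ((max 0 (e - (e + h)))\<^sup>2 - (max 0 (e - e))\<^sup>2) / h) \<midarrow>0\<rightarrow> 0"
    proof (rule Lim_null_comparison[where g="\<lambda>h. \<bar>h\<bar>"])
      show "\<forall>\<^sub>F h in at 0. norm (((max 0 (e - (e + h)))\<^sup>2 - (max 0 (e - e))\<^sup>2) / h) \<le> \<bar>h\<bar>"
        by (auto simp: max_def power2_eq_square abs_mult divide_simps)
      show "(\<lambda>h::real. \<bar>h\<bar>) \<midarrow>0\<rightarrow> 0" by (auto intro!: tendsto_eq_intros)
    qed
    then show ?thesis using 3 by (simp add: DERIV_def)
  qed
qed

lemma antiderivative_on_reals:
  fixes f :: "real \<Rightarrow> real"
  assumes "continuous_on UNIV f"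
  obtains F where "\<And>x. (F has_real_derivative f x) (at x)" "F 0 = c"
proof -
  have "\<exists>F. \<forall>x. -\<infinity> < ereal x \<longrightarrow> ereal x < \<infinity> \<longrightarrow> (F has_vector_derivative f x) (at x)"
    by (rule einterval_antiderivative) (use assms in \<open>auto simp: continuous_on_eq_continuous_at\<close>)
  then obtain F where F: "\<And>x. (F has_real_derivative f x) (at x)"
    by (auto simp: has_real_derivative_iff_has_vector_derivative)
  show ?thesis
    by (rule that[of "\<lambda>x. F x + (c - F 0)"]) (auto intro!: derivative_eq_intros F)
qed

text \<open>Clamping to \<open>{-e..e}\<close> does not increase distances and does not change the
  value of \<open>h\<close>, so the properties of \<open>h\<close> on the compact interval extend to
  the whole line.\<close>

lemma uniformly_continuous_vanishing_outside:
  fixes h :: "real \<Rightarrow> real"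
  assumes c: "continuous_on UNIV h" and z: "\<And>x. e \<le> \<bar>x\<bar> \<Longrightarrow> h x = 0" and "e > 0"
  shows "uniformly_continuous_on UNIV h" and "\<exists>B. \<forall>x. \<bar>h x\<bar> \<le> B"
proof -
  define k where "k x = max (- e) (min e x)" for x :: real
  have hk: "h x = h (k x)" for x
  proof (cases "\<bar>x\<bar> \<le> e")
    case False
    then have "e \<le> \<bar>k x\<bar>" "e \<le> \<bar>x\<bar>" using \<open>e > 0\<close> by (auto simp: k_def)
    then show ?thesis using z by simp
  qed (auto simp: k_def min_def max_def)
  have kr: "k x \<in> {-e..e}" for x using \<open>e > 0\<close> by (auto simp: k_def)
  have ch: "continuous_on {-e..e} h" by (rule continuous_on_subset[OF c]) auto
  have "uniformly_continuous_on {-e..e} h" by (rule compact_uniformly_continuous[OF ch compact_Icc])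
  moreover have "dist (k x) (k y) \<le> dist x y" for x y by (auto simp: k_def dist_real_def max_def min_def)
  ultimately show "uniformly_continuous_on UNIV h"
    unfolding uniformly_continuous_on_def by (metis UNIV_I hk kr order_le_less_trans)
  have "bounded (h ` {-e..e})" by (rule compact_imp_bounded[OF compact_continuous_image[OF ch compact_Icc]])
  then obtain B where "\<And>x. x \<in> {-e..e} \<Longrightarrow> \<bar>h x\<bar> \<le> B" by (force simp: bounded_iff)
  then show "\<exists>B. \<forall>x. \<bar>h x\<bar> \<le> B" using hk kr by (intro exI[of _ B]) metis
qed

text \<open>The shift \<kappa> keeps the power finite at 0, and \<kappa>' does the same for the
  derivative of the exponent. They are separate parameters because they are sent to 0 one after the
  other.\<close>

definition damped_slope :: "real \<Rightarrow> real \<Rightarrow> real \<Rightarrow> real \<Rightarrow> real \<Rightarrow> real \<Rightarrow> real \<Rightarrow> real" where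
  "damped_slope p L \<gamma> \<epsilon> \<kappa> \<kappa>' z = (z + \<kappa>) powr (p - 1) * exp (- L * (z + \<kappa>') powr \<gamma>) * (max 0 (\<epsilon> - z))\<^sup>2"

lemma damped_slope_nonneg: "0 \<le> damped_slope p L \<gamma> \<epsilon> \<kappa> \<kappa>' z"
  by (simp add: damped_slope_def)

lemma damped_slope_eq_0: "\<epsilon> \<le> z \<Longrightarrow> damped_slope p L \<gamma> \<epsilon> \<kappa> \<kappa>' z = 0"
  by (simp add: damped_slope_def)

text \<open>Monotonicity in \<open>z\<close> is the concavity of the test function; monotonicity in
  the shifts lets monotone convergence remove them.\<close>

lemma damped_slope_antimono:
  assumes "p \<le> 1" "0 \<le> L" "0 \<le> \<gamma>" "0 < z + \<kappa>" "0 \<le> z + \<kappa>'" "z \<le> z'" "\<kappa> \<le> \<mu>" "\<kappa>' \<le> \<mu>'"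
  shows "damped_slope p L \<gamma> \<epsilon> \<mu> \<mu>' z' \<le> damped_slope p L \<gamma> \<epsilon> \<kappa> \<kappa>' z"
proof -
  have "(z' + \<mu>) powr (p - 1) \<le> (z + \<kappa>) powr (p - 1)"
    using assms by (intro powr_mono2') auto
  moreover have "(z + \<kappa>') powr \<gamma> \<le> (z' + \<mu>') powr \<gamma>" using assms by (intro powr_mono2) auto
  then have "exp (- L * (z' + \<mu>') powr \<gamma>) \<le> exp (- L * (z + \<kappa>') powr \<gamma>)"
    using assms by (auto intro: mult_left_mono)
  moreover have "(max 0 (\<epsilon> - z'))\<^sup>2 \<le> (max 0 (\<epsilon> - z))\<^sup>2" using assms by (intro power_mono) auto
  ultimately show ?thesis unfolding damped_slope_def by (intro mult_mono) auto
qed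

lemma damped_slope_le_powr:
  assumes "p \<le> 1" "0 \<le> L" "\<epsilon> \<le> 1" "0 \<le> z" "0 \<le> \<kappa>" "0 < z + \<kappa>" 
  shows "damped_slope p L \<gamma> \<epsilon> \<kappa> \<kappa>' z \<le> (z + \<kappa>) powr (p - 1)"
proof -
  have "exp (- L * (z + \<kappa>') powr \<gamma>) \<le> 1" using assms by simp
  moreover have "(max 0 (\<epsilon> - z))\<^sup>2 \<le> 1" using assms by (simp add: power_le_one)
  ultimately have "exp (- L * (z + \<kappa>') powr \<gamma>) * (max 0 (\<epsilon> - z))\<^sup>2 \<le> 1 * 1"
    by (intro mult_mono) auto
  then have "(z + \<kappa>) powr (p - 1) * (exp (- L * (z + \<kappa>') powr \<gamma>) * (max 0 (\<epsilon> - z))\<^sup>2) \<le> (z + \<kappa>) powr (p - 1) * 1"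
    by (intro mult_left_mono) auto
  then show ?thesis by (simp add: damped_slope_def mult.assoc)
qed

text \<open>The curvature is defined first, on all of the line, and is integrated twice. On the
  nonnegative half line the first antiderivative is the damped slope; the upper bound for
  \<open>F\<close> comes from slope at most \<open>z powr (p - 1)\<close> and slope 0 beyond
  \<epsilon>, the lower bound from concavity.\<close>

lemma concave_test_function:
  fixes p L \<gamma> \<epsilon> \<kappa> \<kappa>' :: real
  assumes p: "0 < p" "p \<le> 1" and L: "0 < L" and \<gamma>: "0 < \<gamma>" "\<gamma> \<le> 1" and \<epsilon>: "0 < \<epsilon>" "\<epsilon> \<le> 1" and \<kappa>: "0 < \<kappa>" "0 < \<kappa>'"
  obtains F G h :: "real \<Rightarrow> real" and B :: real where
    "\<And>x. (F has_real_derivative G x) (at x)" "\<And>x. (G has_real_derivative - h x) (at x)"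
    "\<And>x. \<bar>G x\<bar> \<le> B" "\<And>x. \<bar>h x\<bar> \<le> B" "uniformly_continuous_on UNIV h"
    "\<And>z. 0 \<le> z \<Longrightarrow> G z = damped_slope p L \<gamma> \<epsilon> \<kappa> \<kappa>' z"
    "\<And>z. 0 \<le> z \<Longrightarrow> L * \<gamma> * (z + \<kappa>') powr (\<gamma> - 1) * damped_slope p L \<gamma> \<epsilon> \<kappa> \<kappa>' z \<le> h z"
    "\<And>z. \<epsilon> \<le> z \<Longrightarrow> h z = 0"
    "\<And>z. 0 \<le> z \<Longrightarrow> F z \<le> min z \<epsilon> powr p / p"
    "\<And>z m. 0 \<le> m \<Longrightarrow> m \<le> z \<Longrightarrow> m * damped_slope p L \<gamma> \<epsilon> \<kappa> \<kappa>' m \<le> F z"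
proof -
  let ?g = "damped_slope p L \<gamma> \<epsilon> \<kappa> \<kappa>'"
  define w where "w z = (z + \<kappa>) powr (p - 1) * exp (- L * (z + \<kappa>') powr \<gamma>)" for z
  define q where "q z = max 0 (\<epsilon> - z)" for z
  \<comment> \<open>Minus the derivative of the slope by the product rule: the three summands come
    from the power, the exponential and the cut-off.\<close>
  define h0 where "h0 z = w z * (((1 - p) / (z + \<kappa>) + L * \<gamma> * (z + \<kappa>') powr (\<gamma> - 1)) * (q z)\<^sup>2 + 2 * q z)" for z
  \<comment> \<open>The even reflection extends the curvature continuously to the negative reals,
    where the shifted powers could be singular.\<close>
  define h where "h z = h0 \<bar>z\<bar>" for z
  have g_eq: "?g = (\<lambda>z. w z * (q z)\<^sup>2)" by (auto simp: damped_slope_def w_def q_def fun_eq_iff)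
  have g_der: "(?g has_real_derivative - h0 z) (at z)" if "0 \<le> z" for z
  proof -
    have pos: "z + \<kappa> > 0" "z + \<kappa>' > 0" using that \<kappa> by auto
    have "(w has_real_derivative - w z * ((1 - p) / (z + \<kappa>) + L * \<gamma> * (z + \<kappa>') powr (\<gamma> - 1))) (at z)"
    proof -
      have a: "((\<lambda>z. (z + \<kappa>) powr (p - 1)) has_real_derivative (p - 1) * (z + \<kappa>) powr (p - 1) / (z + \<kappa>)) (at z)"
        by (rule DERIV_cong[OF DERIV_fun_powr[OF DERIV_add[OF DERIV_ident DERIV_const] pos(1)]])
           (use pos powr_diff[of "z + \<kappa>" "p - 1" 1] in \<open>simp add: diff_diff_eq\<close>)
      have b: "((\<lambda>z. (z + \<kappa>') powr \<gamma>) has_real_derivative \<gamma> * (z + \<kappa>') powr (\<gamma> - 1)) (at z)"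
        by (rule DERIV_cong[OF DERIV_fun_powr[OF DERIV_add[OF DERIV_ident DERIV_const] pos(2)]]) simp
      have c: "((\<lambda>z. exp (- L * (z + \<kappa>') powr \<gamma>)) has_real_derivative
          exp (- L * (z + \<kappa>') powr \<gamma>) * (- L * (\<gamma> * (z + \<kappa>') powr (\<gamma> - 1)))) (at z)"
        by (rule DERIV_chain2[OF DERIV_exp DERIV_cmult[OF b]])
      have "d / y * e + e * (- L * (\<gamma> * r)) * u = - (u * e) * ((1 - p) / y + L * \<gamma> * r)"
        if "d = (p - 1) * u" for d y e r u :: real
        unfolding that by (simp add: algebra_simps diff_divide_distrib)
      from this[OF refl] show ?thesis unfolding w_def by (rule DERIV_cong[OF DERIV_mult[OF a c]])
    qed
    moreover have "((\<lambda>z. (q z)\<^sup>2) has_real_derivative - 2 * q z) (at z)"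
      unfolding q_def by (rule has_derivative_positive_part_square)
    ultimately show ?thesis unfolding g_eq h0_def
      by (rule DERIV_cong[OF DERIV_mult]) (simp add: algebra_simps diff_divide_distrib)
  qed
  have "continuous_on UNIV h"
  proof -
    have "\<bar>z\<bar> + \<kappa> \<noteq> 0" "\<bar>z\<bar> + \<kappa>' \<noteq> 0" for z :: real using \<kappa> by (smt (verit))+
    then show ?thesis unfolding h_def h0_def w_def q_def by (intro continuous_intros ballI) auto
  qed
  moreover have h_out: "h z = 0" if "\<epsilon> \<le> \<bar>z\<bar>" for z using that by (simp add: h_def h0_def q_def)
  ultimately have h_uc: "uniformly_continuous_on UNIV h" and "\<exists>B. \<forall>x. \<bar>h x\<bar> \<le> B"
    using uniformly_continuous_vanishing_outside[of h \<epsilon>] \<epsilon> by blast+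
  then obtain B where B: "\<And>x. \<bar>h x\<bar> \<le> B" by blast
  have "continuous_on UNIV (\<lambda>x. - h x)" by (intro continuous_intros \<open>continuous_on UNIV h\<close>)
  then obtain G where G: "\<And>x. (G has_real_derivative - h x) (at x)" "G 0 = ?g 0"
    using antiderivative_on_reals[of "\<lambda>x. - h x" "?g 0"] by metis
  have "continuous_on UNIV G" using DERIV_isCont[OF G(1)] by (simp add: continuous_at_imp_continuous_on)
  then obtain F where F: "\<And>x. (F has_real_derivative G x) (at x)" "F 0 = 0"
    using antiderivative_on_reals[of G 0] by metis
  have Gg: "G z = ?g z" if "0 \<le> z" for z
  proof -
    have "\<exists>c. \<forall>x\<in>{0..}. G x - ?g x = c"
    proof (rule has_field_derivative_zero_constant)
      fix x :: real assume "x \<in> {0..}"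
      then have "((\<lambda>x. G x - ?g x) has_real_derivative (- h x - - h0 x)) (at x)"
        by (intro DERIV_diff G g_der) auto
      then show "((\<lambda>x. G x - ?g x) has_real_derivative 0) (at x within {0..})"
        using \<open>x \<in> {0..}\<close> by (simp add: h_def has_field_derivative_at_within)
    qed auto
    then obtain c where c: "\<And>x. x \<ge> 0 \<Longrightarrow> G x - ?g x = c" by auto
    show ?thesis using c[of 0] c[of z] G(2) that by simp
  qed
  have g_bound: "\<bar>?g z\<bar> \<le> \<kappa> powr (p - 1)" if "0 \<le> z" for z
  proof -
    have "?g z \<le> (z + \<kappa>) powr (p - 1)" using that p L \<epsilon> \<kappa> by (intro damped_slope_le_powr) auto
    also have "\<dots> \<le> \<kappa> powr (p - 1)" using that p \<kappa> by (intro powr_mono2') auto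
    finally show ?thesis by (simp add: damped_slope_nonneg)
  qed
  \<comment> \<open>As \<open>h\<close> is even, \<open>G - G 0\<close> is odd. This carries the
    bound for \<open>G\<close> over to the negative reals at the cost of a factor 3.\<close>
  have G_refl: "G (- z) = 2 * G 0 - G z" for z
  proof -
    have "\<exists>c. \<forall>x\<in>UNIV. G (- x) + G x = c"
    proof (rule has_field_derivative_zero_constant)
      fix x :: real
      have "((\<lambda>x. G (- x)) has_real_derivative h x) (at x)"
        by (rule DERIV_cong[OF DERIV_chain2[where g="\<lambda>x. - x", OF G(1) DERIV_minus[OF DERIV_ident]]]) (simp add: h_def)
      from DERIV_add[OF this G(1)[of x]] show "((\<lambda>x. G (- x) + G x) has_real_derivative 0) (at x within UNIV)" by simp
    qed auto
    then show ?thesis by (metis UNIV_I add.commute add_diff_cancel minus_zero mult_2)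
  qed
  have G_bound: "\<bar>G z\<bar> \<le> 3 * \<kappa> powr (p - 1)" for z
    using G_refl[of "- z"] g_bound[of 0] g_bound[of z] g_bound[of "- z"] Gg[of z] Gg[of "- z"] Gg[of 0]
    by (cases "0 \<le> z") auto
  have F_mono: "F x \<le> F y" if "0 \<le> x" "x \<le> y" for x y
    using that F(1) Gg damped_slope_nonneg by (intro DERIV_nonneg_imp_nondecreasing[of x y F]) (metis order.trans that(1))+
  have F_upper: "F z \<le> z powr p / p" if "0 \<le> z" for z
  proof -
    have "(\<lambda>x. x powr p / p - F x) 0 \<le> (\<lambda>x. x powr p / p - F x) z"
    proof (rule DERIV_nonneg_imp_increasing_open[OF that])
      fix x assume x: "0 < x" "x < z"
      have "((\<lambda>x. x powr p / p - F x) has_real_derivative x powr (p - 1) - G x) (at x)"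
        using x p by (auto intro!: derivative_eq_intros F(1))
      moreover have "?g x \<le> (x + \<kappa>) powr (p - 1)" using x p L \<epsilon> \<kappa> by (intro damped_slope_le_powr) auto
      moreover have "(x + \<kappa>) powr (p - 1) \<le> x powr (p - 1)" using x p \<kappa> by (intro powr_mono2') auto
      ultimately show "\<exists>y. ((\<lambda>x. x powr p / p - F x) has_real_derivative y) (at x) \<and> 0 \<le> y"
        using Gg[of x] x by fastforce
    next
      have "continuous_on {0..z} F" using DERIV_isCont[OF F(1)] by (simp add: continuous_at_imp_continuous_on)
      then show "continuous_on {0..z} (\<lambda>x. x powr p / p - F x)"
        using p by (intro continuous_intros continuous_on_powr') auto
    qed
    then show ?thesis using F(2) p by simp
  qed
  \<comment> \<open>Only the summand created by the exponential is kept; those of the power and the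
    cut-off are nonnegative.\<close>
  have low: "L * \<gamma> * (z + \<kappa>') powr (\<gamma> - 1) * ?g z \<le> h z" if z: "0 \<le> z" for z
  proof -
    have "0 \<le> w z * ((1 - p) / (z + \<kappa>) * (q z)\<^sup>2 + 2 * q z)"
      using z p \<kappa> by (intro mult_nonneg_nonneg add_nonneg_nonneg) (auto simp: w_def q_def)
    then show ?thesis using z by (simp add: h_def h0_def g_eq algebra_simps)
  qed
  have up: "F z \<le> min z \<epsilon> powr p / p" if z: "0 \<le> z" for z
    proof (cases "z \<le> \<epsilon>")
      case False
      have "F z \<le> F \<epsilon>"
      proof (rule DERIV_nonpos_imp_nonincreasing[of \<epsilon> z F])
        show "\<exists>y. (F has_real_derivative y) (at x) \<and> y \<le> 0" if "\<epsilon> \<le> x" "x \<le> z" for x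
          using F(1)[of x] Gg[of x] damped_slope_eq_0[OF that(1)] \<epsilon> that by (intro exI[of _ "G x"]) auto
      qed (use False in auto)
      then show ?thesis using F_upper[of \<epsilon>] False \<epsilon> by (simp add: min_def)
    qed (use F_upper z in \<open>simp add: min_def\<close>)
  have lowF: "m * ?g m \<le> F z" if m: "0 \<le> m" "m \<le> z" for z m
  proof -
    \<comment> \<open>The mean slope of \<open>F\<close> on \<open>{0..m}\<close> is attained at an
      inner point, where the decreasing slope is at least its value at \<open>m\<close>.\<close>
    have "m * ?g m \<le> F m"
    proof (cases "m = 0")
      case False
      then have "0 < m" using m by simp
      then obtain \<xi> where \<xi>: "0 < \<xi>" "\<xi> < m" "F m - F 0 = (m - 0) * G \<xi>"
        using MVT2[of 0 m F G] F(1) by blast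
      have "?g m \<le> ?g \<xi>" using \<xi> p L \<gamma> \<kappa> by (intro damped_slope_antimono) auto
      then show ?thesis using \<xi> F(2) Gg[of \<xi>] m by (simp add: mult_left_mono)
    qed (simp add: F)
    then show ?thesis using F_mono[OF m] by simp
  qed
  have Bs: "\<bar>G x\<bar> \<le> max B (3 * \<kappa> powr (p - 1))" "\<bar>h x\<bar> \<le> max B (3 * \<kappa> powr (p - 1))" for x
    using G_bound[of x] B[of x] by linarith+
  have h_out': "h z = 0" if "\<epsilon> \<le> z" for z using h_out[of z] that by linarith
  show ?thesis
    by (rule that[OF F(1) G(1) Bs h_uc Gg low h_out' up lowF])
qed

section \<open>The two-point motion of a Harris flow\<close>

text \<open>Time is rounded down to multiples of \<open>1 / Suc n\<close>. Each approximation uses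
  countably many times, hence is jointly measurable, and continuity of the paths gives the
  limit.\<close>

lemma measurable_continuous_process:
  fixes Y :: "real \<Rightarrow> 'a \<Rightarrow> real"
  assumes m: "\<And>r. Y r \<in> borel_measurable M"
    and c: "\<And>\<omega>. \<omega> \<in> space M \<Longrightarrow> continuous_on UNIV (\<lambda>r. Y r \<omega>)"
  shows "(\<lambda>x. Y (fst x) (snd x)) \<in> borel_measurable (lborel \<Otimes>\<^sub>M M)"
proof (rule borel_measurable_LIMSEQ_real)
  let ?A = "\<lambda>n (x :: real \<times> 'a). Y (of_int \<lfloor>real (Suc n) * fst x\<rfloor> / real (Suc n)) (snd x)"
  show "?A n \<in> borel_measurable (lborel \<Otimes>\<^sub>M M)" for n
  proof (rule measurable_compose_countable[where f="\<lambda>k x. Y (of_int k / real (Suc n)) (snd x)" and g="\<lambda>x. \<lfloor>real (Suc n) * (fst x :: real)\<rfloor>"])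
    show "(\<lambda>x. Y (of_int k / real (Suc n)) (snd x)) \<in> borel_measurable (lborel \<Otimes>\<^sub>M M)" for k :: int
      using m by measurable
  qed measurable
  fix x :: "real \<times> 'a" assume "x \<in> space (lborel \<Otimes>\<^sub>M M)"
  then have \<omega>: "snd x \<in> space M" by (auto simp: space_pair_measure)
  have "(\<lambda>n. of_int \<lfloor>real (Suc n) * fst x\<rfloor> / real (Suc n)) \<longlonglongrightarrow> fst x"
  proof (rule LIMSEQ_I)
    fix e :: real assume "e > 0"
    obtain n0 :: nat where n0: "1 / e < real n0" using reals_Archimedean2 by blast
    have "norm (of_int \<lfloor>real (Suc n) * fst x\<rfloor> / real (Suc n) - fst x) < e" if "n \<ge> n0" for n
    proof -
      have "1 / e < real (Suc n)" using n0 that by linarith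
      then have "1 / real (Suc n) < e" using \<open>e > 0\<close> by (simp add: field_simps del: of_nat_Suc)
      moreover have "\<bar>of_int \<lfloor>real (Suc n) * fst x\<rfloor> - real (Suc n) * fst x\<bar> \<le> 1" by linarith
      then have "\<bar>of_int \<lfloor>real (Suc n) * fst x\<rfloor> - real (Suc n) * fst x\<bar> / real (Suc n) \<le> 1 / real (Suc n)"
        by (intro divide_right_mono) auto
      moreover have "\<bar>k - m * y\<bar> / m = norm (k / m - y)" if "0 < m" for k m y :: real
      proof -
        have "k / m - y = (k - m * y) / m" using that by (simp add: field_simps)
        then show ?thesis using that by (simp add: abs_divide)
      qed
      from this[of "real (Suc n)" "of_int \<lfloor>real (Suc n) * fst x\<rfloor>" "fst x"]
      have "\<bar>of_int \<lfloor>real (Suc n) * fst x\<rfloor> - real (Suc n) * fst x\<bar> / real (Suc n)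
        = norm (of_int \<lfloor>real (Suc n) * fst x\<rfloor> / real (Suc n) - fst x)" by simp
      ultimately show ?thesis by linarith
    qed
    then show "\<exists>no. \<forall>n\<ge>no. norm (of_int \<lfloor>real (Suc n) * fst x\<rfloor> / real (Suc n) - fst x) < e" by blast
  qed
  moreover have "isCont (\<lambda>r. Y r (snd x)) (fst x)" using c[OF \<omega>] by (simp add: continuous_on_eq_continuous_at)
  ultimately show "(\<lambda>n. ?A n x) \<longlonglongrightarrow> Y (fst x) (snd x)" by (rule isCont_tendsto_compose[rotated])
qed

lemma continuous_on_half_line:
  fixes f :: "real \<Rightarrow> real"
  assumes "\<And>T. continuous_on {0..T} f"
  shows "continuous_on {0..} f"
  unfolding continuous_on_eq_continuous_within
proof
  fix x :: real assume "x \<in> {0..}"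
  have "at x within {0..} = at x within {0..x+1}"
    by (rule at_within_nhd[where S="{..<x+1}"]) auto
  then show "continuous (at x within {0..}) f"
    using assms[of "x+1"] \<open>x \<in> {0..}\<close> by (auto simp: continuous_on_eq_continuous_within)
qed

text \<open>Gronwall's inequality for the integral of \<open>f\<close>, the quantity needed for the
  drift: the function \<open>P\<close> has nonnegative derivative by the hypothesis on
  \<open>f\<close> and vanishes at 0.\<close>

lemma integral_gronwall:
  fixes f g :: "real \<Rightarrow> real"
  assumes f: "continuous_on {0..t} f" and g: "continuous_on {0..t} g" and "0 \<le> t" "0 \<le> K"
    and g0: "\<And>r. r \<in> {0..t} \<Longrightarrow> 0 \<le> g r"
    and le: "\<And>r. r \<in> {0..t} \<Longrightarrow> f r \<le> g r + K * integral {0..r} f"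
  shows "integral {0..t} f \<le> exp (K * t) * integral {0..t} g"
proof -
  define P where "P r = integral {0..r} g - exp (- K * r) * integral {0..r} f" for r
  have der: "((\<lambda>r. integral {0..r} k) has_real_derivative k r) (at r)" if "continuous_on {0..t} k" "0 < r" "r < t" for k r
    using integral_has_real_derivative[OF that(1), of r] that by (simp add: at_within_Icc_at)
  have "P 0 \<le> P t"
  proof (rule DERIV_nonneg_imp_increasing_open[OF \<open>0 \<le> t\<close>])
    fix r assume r: "0 < r" "r < t"
    have "(P has_real_derivative g r - exp (- K * r) * (f r - K * integral {0..r} f)) (at r)"
      unfolding P_def using r
      by (auto intro!: derivative_eq_intros der f g simp: algebra_simps)
    moreover have "exp (- K * r) * (f r - K * integral {0..r} f) \<le> exp (- K * r) * g r"
      using le[of r] r by (intro mult_left_mono) auto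
    moreover have "exp (- K * r) * g r \<le> 1 * g r" using r g0[of r] \<open>0 \<le> K\<close> by (intro mult_right_mono) auto
    ultimately show "\<exists>y. (P has_real_derivative y) (at r) \<and> 0 \<le> y" by (smt (verit))
  next
    show "continuous_on {0..t} P" unfolding P_def
      using f g by (intro continuous_intros indefinite_integral_continuous_1 integrable_continuous_real)
  qed
  then have "exp (- K * t) * integral {0..t} f \<le> integral {0..t} g" by (simp add: P_def)
  then have "exp (K * t) * (exp (- K * t) * integral {0..t} f) \<le> exp (K * t) * integral {0..t} g"
    by (intro mult_left_mono) auto
  then show ?thesis by (simp add: mult.assoc[symmetric] exp_add[symmetric])
qed

section \<open>Moments and covariations of the Wiener noises of the flow\<close>

locale harris = prob_space M for M :: "'a measure" +
  fixes \<phi> a :: "real \<Rightarrow> real" and X :: "real \<Rightarrow> real \<Rightarrow> 'a \<Rightarrow> real \<Rightarrow> real" and K :: real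
  assumes flow: "harris_flow M \<phi> a X"
    and \<phi>_cont: "continuous_on UNIV \<phi>" and \<phi>_0: "\<phi> 0 = 1" and \<phi>_bound: "\<And>x. \<bar>\<phi> x\<bar> \<le> 1"
    and a_meas [measurable]: "a \<in> borel_measurable borel"
    and growth: "\<And>x. \<bar>a x\<bar> \<le> K * (1 + \<bar>x\<bar>)"
begin

lemma K_nonneg: "0 \<le> K" using growth[of 0] by simp

lemma \<phi>_meas [measurable]: "\<phi> \<in> borel_measurable borel"
  using \<phi>_cont by (rule borel_measurable_continuous_onI)

lemmas flow_props = flow[unfolded harris_flow_def]
lemmas flow_random_elements = flow_props[THEN conjunct1, rule_format]
lemmas flow_cocycle = flow_props[THEN conjunct2, THEN conjunct1, rule_format]
lemmas flow_id = flow_props[THEN conjunct2, THEN conjunct2, THEN conjunct1, rule_format]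
lemmas flow_wiener = flow_props[THEN conjunct2, THEN conjunct2, THEN conjunct2, THEN conjunct2, THEN conjunct2, THEN conjunct2, THEN conjunct1, rule_format]
lemmas flow_covariation = flow_props[THEN conjunct2, THEN conjunct2, THEN conjunct2, THEN conjunct2, THEN conjunct2, THEN conjunct2, THEN conjunct2, rule_format]

lemma X_measurable: "0 \<le> s \<Longrightarrow> s \<le> t \<Longrightarrow> X s t \<in> measurable M Mfun"
  and X_D_up: "0 \<le> s \<Longrightarrow> s \<le> t \<Longrightarrow> \<omega> \<in> space M \<Longrightarrow> X s t \<omega> \<in> D_up"
  using flow_random_elements by auto

lemma drift_integrable: "0 \<le> t \<Longrightarrow> AE \<omega> in M. set_integrable lborel {0..t} (\<lambda>r. a (X 0 r \<omega> x))"
  and noise_wiener: "wiener_from M (flow_filt M X 0) 0 (flow_noise a X x 0)"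
  using flow_wiener[of 0 x] by auto

lemma noise_covariation: "martingale_from M (flow_filt M X 0) 0
          (\<lambda>t \<omega>. flow_noise a X x 0 t \<omega> * flow_noise a X y 0 t \<omega>
                 - (LINT r:{0..t}|lborel. \<phi> (X 0 r \<omega> x - X 0 r \<omega> y)))"
  using flow_covariation[of 0 x y] by simp

lemma X_meas: "0 \<le> s \<Longrightarrow> s \<le> t \<Longrightarrow> (\<lambda>\<omega>. X s t \<omega> x) \<in> borel_measurable M"
  using measurable_compose[OF X_measurable measurable_component_singleton[of x UNIV]] by simp

abbreviation Ft where "Ft \<equiv> flow_filt M X 0"
abbreviation W where "W x \<equiv> flow_noise a X x 0"

lemma space_Ft: "space (Ft u) = space M"
  unfolding flow_filt_def by (simp add: space_measure_of_conv)

lemma subalg: "subalgebra M (Ft u)"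
proof -
  have "(\<Union>p\<in>{0..u}. \<Union>v\<in>{p..u}. \<Union>x. {(\<lambda>\<omega>. X p v \<omega> x) -` B \<inter> space M | B. B \<in> sets borel}) \<subseteq> sets M"
    using measurable_sets[OF X_meas] by auto
  then show ?thesis
    unfolding subalgebra_def flow_filt_def
    by (subst sets_measure_of) (auto simp: space_measure_of_conv intro!: sets.sigma_sets_subset)
qed

sublocale Ft: finite_measure_subalgebra M "Ft u" for u
  by unfold_locales (rule subalg)

lemma X_Ft: 
  assumes "0 \<le> u" shows "(\<lambda>\<omega>. X 0 u \<omega> x) \<in> borel_measurable (Ft u)"
proof (rule measurableI)
  fix B :: "real set" assume B: "B \<in> sets borel"
  have "(\<lambda>\<omega>. X 0 u \<omega> x) -` B \<inter> space M \<in> (\<Union>p\<in>{0..u}. \<Union>v\<in>{p..u}. \<Union>x. {(\<lambda>\<omega>. X p v \<omega> x) -` B \<inter> space M | B. B \<in> sets borel})"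
    using assms B by force
  then have "(\<lambda>\<omega>. X 0 u \<omega> x) -` B \<inter> space M \<in> sets (Ft u)"
    unfolding flow_filt_def by (subst sets_measure_of) auto
  then show "(\<lambda>\<omega>. X 0 u \<omega> x) -` B \<inter> space (Ft u) \<in> sets (Ft u)" by (simp add: space_Ft)
qed simp

lemma W_Ft: "0 \<le> u \<Longrightarrow> W x u \<in> borel_measurable (Ft u)"
  using noise_wiener[of x] unfolding wiener_from_def by blast

lemma Ft_M: "f \<in> borel_measurable (Ft u) \<Longrightarrow> f \<in> borel_measurable M"
  by (rule measurable_from_subalg[OF subalg])

lemma martingale_test:
  assumes mg: "martingale_from M Ft 0 Q" and uv: "0 \<le> u" "u \<le> v"
    and g: "g \<in> borel_measurable (Ft u)" "\<And>\<omega>. \<bar>g \<omega>\<bar> \<le> (B::real)"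
  shows "(\<integral>\<omega>. g \<omega> * Q v \<omega> \<partial>M) = (\<integral>\<omega>. g \<omega> * Q u \<omega> \<partial>M)"
proof -
  note gM = Ft_M[OF g(1)]
  have Q: "integrable M (Q v)" "integrable M (Q u)" and c: "AE \<omega> in M. real_cond_exp M (Ft u) (Q v) \<omega> = Q u \<omega>"
    using mg uv unfolding martingale_from_def by auto
  have "integrable M (\<lambda>\<omega>. B * Q v \<omega>)" using Q by simp
  then have "integrable M (\<lambda>\<omega>. g \<omega> * Q v \<omega>)"
    by (rule Bochner_Integration.integrable_bound)
       (use g gM Q in \<open>auto simp: abs_mult intro!: AE_I2 mult_right_mono order_trans[OF g(2)]\<close>)
  from Ft.real_cond_exp_intg(2)[OF this g(1)] Q
  have "(\<integral>\<omega>. g \<omega> * Q v \<omega> \<partial>M) = (\<integral>\<omega>. g \<omega> * real_cond_exp M (Ft u) (Q v) \<omega> \<partial>M)" by simp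
  also have "\<dots> = (\<integral>\<omega>. g \<omega> * Q u \<omega> \<partial>M)"
    using c gM Q by (intro integral_cong_AE) auto
  finally show ?thesis .
qed

text \<open>Gaussian moments; the case \<open>u = v\<close> is separate because the normal law is
  given only for \<open>u < v\<close>.\<close>

lemma W_moments:
  assumes uv: "0 \<le> u" "u \<le> v"
  shows "integrable M (\<lambda>\<omega>. W x v \<omega> - W x u \<omega>)" "integrable M (\<lambda>\<omega>. (W x v \<omega> - W x u \<omega>)\<^sup>2)"
    "integrable M (\<lambda>\<omega>. (W x v \<omega> - W x u \<omega>)^4)" "(\<integral>\<omega>. (W x v \<omega> - W x u \<omega>) \<partial>M) = 0"
    "(\<integral>\<omega>. (W x v \<omega> - W x u \<omega>)\<^sup>2 \<partial>M) = v - u" "(\<integral>\<omega>. (W x v \<omega> - W x u \<omega>)^4 \<partial>M) = 3 * (v - u)\<^sup>2"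
proof -
  have "integrable M (\<lambda>\<omega>. W x v \<omega> - W x u \<omega>) \<and> integrable M (\<lambda>\<omega>. (W x v \<omega> - W x u \<omega>)\<^sup>2) \<and>
    integrable M (\<lambda>\<omega>. (W x v \<omega> - W x u \<omega>)^4) \<and> (\<integral>\<omega>. (W x v \<omega> - W x u \<omega>) \<partial>M) = 0 \<and>
    (\<integral>\<omega>. (W x v \<omega> - W x u \<omega>)\<^sup>2 \<partial>M) = v - u \<and> (\<integral>\<omega>. (W x v \<omega> - W x u \<omega>)^4 \<partial>M) = 3 * (v - u)\<^sup>2"
  proof (cases "u = v")
    case False
    then have "u < v" using uv by simp
    let ?D = "\<lambda>\<omega>. W x v \<omega> - W x u \<omega>" and ?n = "normal_density 0 (sqrt (v - u))"
    have s: "0 < sqrt (v - u)" using \<open>u < v\<close> by simp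
    have d: "distributed M lborel ?D (\<lambda>y. ennreal (?n y))"
      using noise_wiener[of x] uv \<open>u < v\<close> unfolding wiener_from_def by blast
    have i: "integrable M (\<lambda>\<omega>. ?D \<omega> ^ k)" for k
      using integrable_normal_moment[OF s, of 0 k] distributed_integrable[OF d, of "\<lambda>y. y ^ k"] by simp
    have e: "(\<integral>\<omega>. ?D \<omega> ^ k \<partial>M) = (\<integral>y. ?n y * y ^ k \<partial>lborel)" for k
      using distributed_integral[OF d, of "\<lambda>y. y ^ k"] by simp
    have "(\<integral>\<omega>. ?D \<omega> ^ 1 \<partial>M) = 0" unfolding e using integral_normal_moment_nz_1[OF s, of 0] by simp
    moreover have "(\<integral>\<omega>. ?D \<omega> ^ 2 \<partial>M) = v - u"
      unfolding e using integral_normal_moment_even[OF s, of 0 1] s by (simp add: fact_numeral)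
    moreover have "(\<integral>\<omega>. ?D \<omega> ^ 4 \<partial>M) = 3 * (v - u)\<^sup>2"
    proof -
      have "(sqrt (v - u))^4 = (v - u)\<^sup>2" using \<open>u < v\<close> by (simp add: power4_eq_xxxx power2_eq_square mult.assoc)
      then show ?thesis unfolding e using integral_normal_moment_even[OF s, of 0 2] s 
        by (simp add: fact_numeral power2_eq_square field_simps)
    qed
    ultimately show ?thesis using i[of 1] i[of 2] i[of 4] by simp
  qed simp
  then show "integrable M (\<lambda>\<omega>. W x v \<omega> - W x u \<omega>)" "integrable M (\<lambda>\<omega>. (W x v \<omega> - W x u \<omega>)\<^sup>2)"
    "integrable M (\<lambda>\<omega>. (W x v \<omega> - W x u \<omega>)^4)" "(\<integral>\<omega>. (W x v \<omega> - W x u \<omega>) \<partial>M) = 0"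
    "(\<integral>\<omega>. (W x v \<omega> - W x u \<omega>)\<^sup>2 \<partial>M) = v - u" "(\<integral>\<omega>. (W x v \<omega> - W x u \<omega>)^4 \<partial>M) = 3 * (v - u)\<^sup>2"
    by blast+
qed

text \<open>Here \<open>g\<close> is merely integrable: the covariation formula uses it with a
  bounded function times the noise at time \<open>u\<close>, which is unbounded.\<close>

lemma W_independent:
  assumes uv: "0 \<le> u" "u \<le> v" and g: "g \<in> borel_measurable (Ft u)" "integrable M g"
  shows "integrable M (\<lambda>\<omega>. g \<omega> * (W x v \<omega> - W x u \<omega>))"
    and "(\<integral>\<omega>. g \<omega> * (W x v \<omega> - W x u \<omega>) \<partial>M) = 0"
proof -
  let ?D = "\<lambda>\<omega>. W x v \<omega> - W x u \<omega>"
  have "integrable M (\<lambda>\<omega>. g \<omega> * ?D \<omega>) \<and> (\<integral>\<omega>. g \<omega> * ?D \<omega> \<partial>M) = 0"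
  proof (cases "u = v")
    case False
    then have "u < v" using uv by simp
    have ind: "indep_set (sets (Ft u)) (sets (vimage_algebra (space M) ?D borel))"
      using noise_wiener[of x] uv \<open>u < v\<close> unfolding wiener_from_def by blast
    have "indep_var borel g borel ?D"
      unfolding indep_var_eq
    proof (intro conjI)
      show "random_variable borel g" "random_variable borel ?D" using g W_moments(1)[OF uv] by auto
      have 1: "sigma_sets (space M) {g -` A \<inter> space M |A. A \<in> sets borel} \<subseteq> sets (Ft u)"
        by (rule sets.sigma_sets_subset[of _ "Ft u", unfolded space_Ft])
             (use measurable_sets[OF g(1)] in \<open>auto simp: space_Ft\<close>)
      have 2: "sigma_sets (space M) {?D -` A \<inter> space M |A. A \<in> sets borel} \<subseteq> sets (vimage_algebra (space M) ?D borel)"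
        by (simp add: sets_vimage_algebra)
      show "indep_set (sigma_sets (space M) {g -` A \<inter> space M |A. A \<in> sets borel})
          (sigma_sets (space M) {?D -` A \<inter> space M |A. A \<in> sets borel})"
        unfolding indep_set_def
        by (rule indep_sets_mono_sets[OF ind[unfolded indep_set_def]]) (use 1 2 in \<open>auto split: bool.split\<close>)
    qed
    from indep_var_integrable[OF this g(2) W_moments(1)[OF uv]] indep_var_lebesgue_integral[OF this g(2) W_moments(1)[OF uv]]
    show ?thesis using W_moments(4)[OF uv] by simp
  qed simp
  then show "integrable M (\<lambda>\<omega>. g \<omega> * ?D \<omega>)" "(\<integral>\<omega>. g \<omega> * ?D \<omega> \<partial>M) = 0" by auto
qed


text \<open>The set of all well-behaved paths may fail to be measurable, so a measurable subset of
  full measure is taken instead.\<close>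

definition good :: "real \<Rightarrow> 'a set \<Rightarrow> bool" where
  "good x S \<longleftrightarrow> S \<in> sets M \<and> (AE \<omega> in M. \<omega> \<in> S) \<and>
     (\<forall>\<omega>\<in>S. continuous_on {0..} (\<lambda>t. W x t \<omega>) \<and> (\<forall>T\<ge>0. set_integrable lborel {0..T} (\<lambda>r. a (X 0 r \<omega> x))) \<and> X 0 0 \<omega> x = x)"

text \<open>Integrability on every \<open>{0..T}\<close> follows from integer \<open>T\<close>, so
  that only countably many null sets are united.\<close>

lemma ex_good: "\<exists>S. good x S"
proof -
  have c: "AE \<omega> in M. continuous_on {0..} (\<lambda>t. W x t \<omega>)"
    using noise_wiener[of x] unfolding wiener_from_def by blast
  have i: "AE \<omega> in M. \<forall>n::nat. set_integrable lborel {0..real n} (\<lambda>r. a (X 0 r \<omega> x))"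
    unfolding AE_all_countable using drift_integrable by simp
  have "AE \<omega> in M. continuous_on {0..} (\<lambda>t. W x t \<omega>) \<and> (\<forall>T\<ge>0. set_integrable lborel {0..T} (\<lambda>r. a (X 0 r \<omega> x))) \<and> X 0 0 \<omega> x = x"
    using c i flow_id[of 0, OF order_refl]
  proof eventually_elim
    case (elim \<omega>)
    have "set_integrable lborel {0..T} (\<lambda>r. a (X 0 r \<omega> x))" for T
    proof -
      obtain n :: nat where "T \<le> real n" using real_arch_simple by blast
      then show ?thesis using set_integrable_subset[OF elim(2)[rule_format, of n], of "{0..T}"] by auto
    qed
    then show ?case using elim by simp
  qed
  then obtain N where N: "{\<omega>\<in>space M. \<not> (continuous_on {0..} (\<lambda>t. W x t \<omega>) \<and> (\<forall>T\<ge>0. set_integrable lborel {0..T} (\<lambda>r. a (X 0 r \<omega> x))) \<and> X 0 0 \<omega> x = x)} \<subseteq> N"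
    "N \<in> null_sets M" unfolding eventually_ae_filter by blast
  have "good x (space M - N)"
    unfolding good_def
  proof (intro conjI ballI)
    show "AE \<omega> in M. \<omega> \<in> space M - N" using AE_not_in[OF N(2)] by (auto elim: AE_mp)
  qed (use N in auto)
  then show ?thesis by blast
qed

definition G :: "real \<Rightarrow> 'a set" where "G x = (SOME S. good x S)"

lemma good_G: "good x (G x)"
  unfolding G_def by (rule someI_ex[OF ex_good])

lemma G_sets [measurable]: "G x \<in> sets M"
  and AE_G: "AE \<omega> in M. \<omega> \<in> G x"
  and G_space: "\<omega> \<in> G x \<Longrightarrow> \<omega> \<in> space M"
  and G_W: "\<omega> \<in> G x \<Longrightarrow> continuous_on {0..} (\<lambda>t. W x t \<omega>)"
  and G_int: "\<omega> \<in> G x \<Longrightarrow> 0 \<le> T \<Longrightarrow> set_integrable lborel {0..T} (\<lambda>r. a (X 0 r \<omega> x))"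
  and G_0: "\<omega> \<in> G x \<Longrightarrow> X 0 0 \<omega> x = x"
  using good_G[of x] sets.sets_into_space[of "G x" M] unfolding good_def by auto

text \<open>Almost surely \<open>X\<^sub>0\<^sub>,\<^sub>r(x)\<close> is continuous in \<open>r\<close>; off the good event the modification \<open>Y\<close> rests at \<open>x\<close> with
  zero drift, so that the decomposition and joint measurability hold for every \<open>\<omega>\<close>.\<close>

definition Y where "Y x r \<omega> = (if \<omega> \<in> G x then X 0 (max 0 r) \<omega> x else x)"
definition drift where "drift x r \<omega> = (if \<omega> \<in> G x then a (Y x r \<omega>) else 0)"
definition N where "N x r \<omega> = Y x r \<omega> - x - (LINT q:{0..r}|lborel. drift x q \<omega>)"

lemma Y_eq_X: "\<omega> \<in> G x \<Longrightarrow> 0 \<le> r \<Longrightarrow> Y x r \<omega> = X 0 r \<omega> x"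
  by (simp add: Y_def)

lemma drift_int:
  assumes "0 \<le> s" shows "set_integrable lborel {s..t} (\<lambda>r. drift x r \<omega>)"
proof (cases "\<omega> \<in> G x \<and> s \<le> t")
  case True
  then have "set_integrable lborel {s..t} (\<lambda>r. a (X 0 r \<omega> x))"
    using set_integrable_subset[OF G_int[of \<omega> x t], of "{s..t}"] assms by auto
  then show ?thesis
    by (rule set_integrable_cong[THEN iffD1, rotated -1]) (use True assms in \<open>auto simp: drift_def Y_def max_def\<close>)
next
  case False
  then consider "\<omega> \<notin> G x" | "{s..t} = {}" by auto
  then show ?thesis by cases (auto simp: drift_def set_integrable_def)
qed

lemma N_eq_W:
  assumes "\<omega> \<in> G x" "0 \<le> r" shows "N x r \<omega> = W x r \<omega>"
proof -
  have "(LINT q:{0..r}|lborel. drift x q \<omega>) = (LINT q:{0..r}|lborel. a (X 0 q \<omega> x))"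
    by (rule set_lebesgue_integral_cong) (use assms in \<open>auto simp: drift_def Y_def max_def\<close>)
  then show ?thesis using assms by (simp add: N_def flow_noise_def Y_eq_X)
qed

lemma drift_integral_cont: "continuous_on {0..T} (\<lambda>t. LINT q:{0..t}|lborel. drift x q \<omega>)"
proof -
  have "continuous_on {0..T} (\<lambda>t. integral {0..t} (\<lambda>q. drift x q \<omega>))"
    using set_borel_integral_eq_integral(1)[OF drift_int[of 0 T]] by (intro indefinite_integral_continuous_1) auto
  then show ?thesis
    by (rule continuous_on_eq) (use set_borel_integral_eq_integral(2)[OF drift_int[of 0]] in auto)
qed

lemma Y_cont: "continuous_on UNIV (\<lambda>r. Y x r \<omega>)"
proof (cases "\<omega> \<in> G x")
  case True
  have "continuous_on {0..T} (\<lambda>t. X 0 t \<omega> x)" for T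
  proof -
    have "continuous_on {0..T} (\<lambda>t. x + W x t \<omega> + (LINT q:{0..t}|lborel. drift x q \<omega>))"
      by (intro continuous_intros drift_integral_cont continuous_on_subset[OF G_W[OF True]]) auto
    then show ?thesis
      by (rule continuous_on_eq) (use True in \<open>auto simp: N_eq_W[symmetric] N_def Y_eq_X\<close>)
  qed
  then have "continuous_on {0..} (\<lambda>t. X 0 t \<omega> x)" by (rule continuous_on_half_line)
  moreover have "continuous_on UNIV (\<lambda>r::real. max 0 r)" by (intro continuous_intros)
  ultimately have "continuous_on UNIV (\<lambda>r. X 0 (max 0 r) \<omega> x)" by (rule continuous_on_compose2) auto
  then show ?thesis using True by (simp add: Y_def)
qed (simp add: Y_def)

lemma N_cont: "continuous_on {0..} (\<lambda>r. N x r \<omega>)"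
  unfolding N_def by (intro continuous_on_half_line continuous_intros drift_integral_cont continuous_on_subset[OF Y_cont]) auto

lemma Y_meas [measurable]: "Y x r \<in> borel_measurable M"
proof -
  have [measurable]: "(\<lambda>\<omega>. X 0 (max 0 r) \<omega> x) \<in> borel_measurable M" by (rule X_meas) auto
  show ?thesis unfolding Y_def[abs_def] by measurable
qed

lemma Y_joint [measurable]: "(\<lambda>p. Y x (fst p) (snd p)) \<in> borel_measurable (lborel \<Otimes>\<^sub>M M)"
  by (rule measurable_continuous_process[OF Y_meas Y_cont])

lemma drift_joint [measurable]: "(\<lambda>p. drift x (fst p) (snd p)) \<in> borel_measurable (lborel \<Otimes>\<^sub>M M)"
  unfolding drift_def by measurable

lemma path_integral_measurable:
  fixes f :: "real \<Rightarrow> 'a \<Rightarrow> real"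
  assumes "(\<lambda>p. f (fst p) (snd p)) \<in> borel_measurable (lborel \<Otimes>\<^sub>M M)"
  shows "(\<lambda>\<omega>. LINT r:{s..t}|lborel. f r \<omega>) \<in> borel_measurable M"
proof -
  have "(\<lambda>p. f (snd p) (fst p)) \<in> borel_measurable (M \<Otimes>\<^sub>M lborel)"
    using measurable_compose[OF measurable_pair_swap' assms] by (simp add: case_prod_beta)
  then have "(\<lambda>p. indicator {s..t} (snd p) *\<^sub>R f (snd p) (fst p)) \<in> borel_measurable (M \<Otimes>\<^sub>M lborel)"
    by measurable
  then show ?thesis unfolding set_lebesgue_integral_def
    by (intro lborel.borel_measurable_lebesgue_integral) (simp add: case_prod_beta)
qed

lemma N_meas [measurable]: "N x r \<in> borel_measurable M"
  unfolding N_def[abs_def] using path_integral_measurable[OF drift_joint] by measurable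

lemma AE_N_W: "0 \<le> r \<Longrightarrow> AE \<omega> in M. N x r \<omega> = W x r \<omega>"
  using AE_G[of x] by eventually_elim (rule N_eq_W)

lemma AE_Y_X: "0 \<le> r \<Longrightarrow> AE \<omega> in M. Y x r \<omega> = X 0 r \<omega> x"
  using AE_G[of x] by eventually_elim (rule Y_eq_X)

lemma W_meas [measurable]: "0 \<le> r \<Longrightarrow> W x r \<in> borel_measurable M"
  using Ft_M[OF W_Ft] .

lemma N_moments:
  assumes uv: "0 \<le> u" "u \<le> v"
  shows "integrable M (\<lambda>\<omega>. N x v \<omega> - N x u \<omega>)" "integrable M (\<lambda>\<omega>. (N x v \<omega> - N x u \<omega>)\<^sup>2)"
    "integrable M (\<lambda>\<omega>. (N x v \<omega> - N x u \<omega>)^4)"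
    "(\<integral>\<omega>. (N x v \<omega> - N x u \<omega>)\<^sup>2 \<partial>M) = v - u" "(\<integral>\<omega>. (N x v \<omega> - N x u \<omega>)^4 \<partial>M) = 3 * (v - u)\<^sup>2"
proof -
  have [measurable]: "W x v \<in> borel_measurable M" "W x u \<in> borel_measurable M" using uv by auto
  have e: "AE \<omega> in M. N x v \<omega> - N x u \<omega> = W x v \<omega> - W x u \<omega>"
    using AE_N_W[of v x] AE_N_W[of u x] uv by auto
  have e2: "AE \<omega> in M. (N x v \<omega> - N x u \<omega>)^k = (W x v \<omega> - W x u \<omega>)^k" for k
    using e by eventually_elim simp
  show "integrable M (\<lambda>\<omega>. N x v \<omega> - N x u \<omega>)"
    using integrable_cong_AE[OF _ _ e] W_moments(1)[OF uv] by simp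
  show "integrable M (\<lambda>\<omega>. (N x v \<omega> - N x u \<omega>)\<^sup>2)"
    using integrable_cong_AE[OF _ _ e2[of 2]] W_moments(2)[OF uv] by simp
  show "integrable M (\<lambda>\<omega>. (N x v \<omega> - N x u \<omega>)^4)"
    using integrable_cong_AE[OF _ _ e2[of 4]] W_moments(3)[OF uv] by simp
  show "(\<integral>\<omega>. (N x v \<omega> - N x u \<omega>)\<^sup>2 \<partial>M) = v - u"
    using integral_cong_AE[OF _ _ e2[of 2]] W_moments(5)[OF uv] by simp
  show "(\<integral>\<omega>. (N x v \<omega> - N x u \<omega>)^4 \<partial>M) = 3 * (v - u)\<^sup>2"
    using integral_cong_AE[OF _ _ e2[of 4]] W_moments(6)[OF uv] by simp
qed

lemma W_0: "AE \<omega> in M. W x 0 \<omega> = 0"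
  using noise_wiener[of x] unfolding wiener_from_def by blast

lemma W_integrable:
  assumes "0 \<le> u" shows "integrable M (W x u)" "integrable M (\<lambda>\<omega>. (W x u \<omega>)\<^sup>2)"
proof -
  have [measurable]: "W x u \<in> borel_measurable M" "W x 0 \<in> borel_measurable M" using assms by auto
  have e: "AE \<omega> in M. W x u \<omega> - W x 0 \<omega> = W x u \<omega>" using W_0[of x] by eventually_elim simp
  have e2: "AE \<omega> in M. (W x u \<omega> - W x 0 \<omega>)\<^sup>2 = (W x u \<omega>)\<^sup>2" using W_0[of x] by eventually_elim simp
  show "integrable M (W x u)"
    using integrable_cong_AE[OF _ _ e] W_moments(1)[of 0 u x] assms by simp
  show "integrable M (\<lambda>\<omega>. (W x u \<omega>)\<^sup>2)"
    using integrable_cong_AE[OF _ _ e2] W_moments(2)[of 0 u x] assms by simp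
qed

lemma integrable_product:
  assumes [measurable]: "f \<in> borel_measurable M" "g \<in> borel_measurable M" "k \<in> borel_measurable M"
    and f: "integrable M (\<lambda>\<omega>. (f \<omega>)\<^sup>2)" and g: "integrable M (\<lambda>\<omega>. (g \<omega>)\<^sup>2)" and k: "\<And>\<omega>. \<bar>k \<omega>\<bar> \<le> (B::real)"
  shows "integrable M (\<lambda>\<omega>. k \<omega> * (f \<omega> * g \<omega>))"
proof (rule Bochner_Integration.integrable_bound)
  show "integrable M (\<lambda>\<omega>. B * ((f \<omega>)\<^sup>2 + (g \<omega>)\<^sup>2))" using f g by simp
  have "\<bar>k \<omega> * (f \<omega> * g \<omega>)\<bar> \<le> B * ((f \<omega>)\<^sup>2 + (g \<omega>)\<^sup>2)" for \<omega>
  proof -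
    have "0 \<le> (\<bar>f \<omega>\<bar> - \<bar>g \<omega>\<bar>)\<^sup>2" by simp
    then have "2 * (\<bar>f \<omega>\<bar> * \<bar>g \<omega>\<bar>) \<le> (f \<omega>)\<^sup>2 + (g \<omega>)\<^sup>2" by (simp add: power2_diff algebra_simps)
    moreover have "0 \<le> \<bar>f \<omega>\<bar> * \<bar>g \<omega>\<bar>" by simp
    ultimately have "\<bar>f \<omega>\<bar> * \<bar>g \<omega>\<bar> \<le> (f \<omega>)\<^sup>2 + (g \<omega>)\<^sup>2" by linarith
    then show ?thesis unfolding abs_mult using k[of \<omega>] by (intro mult_mono) auto
  qed
  then show "AE \<omega> in M. norm (k \<omega> * (f \<omega> * g \<omega>)) \<le> norm (B * ((f \<omega>)\<^sup>2 + (g \<omega>)\<^sup>2))"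
    by (auto intro!: AE_I2 order_trans[OF _ abs_ge_self])
qed simp

lemma covariation_int: "set_integrable lborel {u..v} (\<lambda>r. \<phi> (Y x r \<omega> - Y y r \<omega>))"
  by (intro borel_integrable_atLeastAtMost' continuous_on_subset[OF continuous_on_compose2[OF \<phi>_cont]]
      continuous_intros continuous_on_subset[OF Y_cont]) auto

lemma covariation_meas [measurable]: "(\<lambda>\<omega>. LINT r:{u..v}|lborel. \<phi> (Y x r \<omega> - Y y r \<omega>)) \<in> borel_measurable M"
  by (rule path_integral_measurable) measurable

lemma covariation_bound: 
  assumes "u \<le> v" shows "\<bar>LINT r:{u..v}|lborel. \<phi> (Y x r \<omega> - Y y r \<omega>)\<bar> \<le> v - u"
proof -
  have "\<bar>LINT r:{u..v}|lborel. \<phi> (Y x r \<omega> - Y y r \<omega>)\<bar> \<le> (LINT r:{u..v}|lborel. \<bar>\<phi> (Y x r \<omega> - Y y r \<omega>)\<bar>)"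
    using set_integral_norm_bound[OF covariation_int] by simp
  also have "\<dots> \<le> (LINT r:{u..v}|lborel. 1)"
    using covariation_int \<phi>_bound borel_integrable_atLeastAtMost'[of u v "\<lambda>_. 1 :: real"]
    by (intro set_integral_mono set_integrable_abs) auto
  also have "\<dots> = v - u" using assms by (simp add: set_lebesgue_integral_def)
  finally show ?thesis .
qed

text \<open>The product of the increments is the increment of the product minus two terms, each a
  quantity known at time \<open>u\<close> times an increment. These have mean 0 by independence, and
  the increment of the product is evaluated by the martingale in the definition of the flow.\<close>

lemma W_covariation:
  assumes uv: "0 \<le> u" "u \<le> v" and g: "g \<in> borel_measurable (Ft u)" "\<And>\<omega>. \<bar>g \<omega>\<bar> \<le> (B::real)"
  shows "(\<integral>\<omega>. g \<omega> * ((W x v \<omega> - W x u \<omega>) * (W y v \<omega> - W y u \<omega>)) \<partial>M) =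
     (\<integral>\<omega>. g \<omega> * (LINT r:{u..v}|lborel. \<phi> (Y x r \<omega> - Y y r \<omega>)) \<partial>M)"
proof -
  note gM [measurable] = Ft_M[OF g(1)]
  have v: "0 \<le> v" using uv by simp
  note [measurable] = W_meas[OF uv(1)] W_meas[OF v] W_Ft[OF uv(1)] g(1)
  let ?Q = "\<lambda>t \<omega>. W x t \<omega> * W y t \<omega> - (LINT r:{0..t}|lborel. \<phi> (X 0 r \<omega> x - X 0 r \<omega> y))"
  let ?C = "\<lambda>t \<omega>. LINT r:{0..t}|lborel. \<phi> (Y x r \<omega> - Y y r \<omega>)"
  have QC: "AE \<omega> in M. W x t \<omega> * W y t \<omega> - ?C t \<omega> = ?Q t \<omega>" for t
    using AE_G[of x] AE_G[of y]
  proof eventually_elim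
    case (elim \<omega>)
    have "?C t \<omega> = (LINT r:{0..t}|lborel. \<phi> (X 0 r \<omega> x - X 0 r \<omega> y))"
      by (rule set_lebesgue_integral_cong) (use elim in \<open>auto simp: Y_eq_X\<close>)
    then show ?case by simp
  qed
  have Qi: "integrable M (?Q v)" "integrable M (?Q u)"
    using noise_covariation[of x y] uv unfolding martingale_from_def by auto
  have gC: "integrable M (\<lambda>\<omega>. g \<omega> * ?C t \<omega>)" if "0 \<le> t" for t
  proof (rule integrable_const_bound[where B="B * t"])
    show "AE \<omega> in M. norm (g \<omega> * ?C t \<omega>) \<le> B * t"
    proof (rule AE_I2)
      fix \<omega>
      have "\<bar>g \<omega>\<bar> * \<bar>?C t \<omega>\<bar> \<le> B * t"
        using g(2)[of \<omega>] covariation_bound[OF that, of x \<omega> y] by (intro mult_mono) auto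
      then show "norm (g \<omega> * ?C t \<omega>) \<le> B * t" by (simp add: abs_mult)
    qed
  qed measurable
  have gWW: "integrable M (\<lambda>\<omega>. g \<omega> * (W x t \<omega> * W y t \<omega>))" if "0 \<le> t" for t
    using that g(2) W_integrable by (intro integrable_product[where B=B]) auto
  have "(\<integral>\<omega>. g \<omega> * (W x v \<omega> * W y v \<omega> - ?C v \<omega>) \<partial>M) = (\<integral>\<omega>. g \<omega> * ?Q v \<omega> \<partial>M)"
    using QC[of v] Qi(1) by (intro integral_cong_AE) (auto elim!: AE_mp)
  also have "\<dots> = (\<integral>\<omega>. g \<omega> * ?Q u \<omega> \<partial>M)"
    by (rule martingale_test[OF noise_covariation uv g])
  also have "\<dots> = (\<integral>\<omega>. g \<omega> * (W x u \<omega> * W y u \<omega> - ?C u \<omega>) \<partial>M)"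
    using QC[of u] Qi(2) by (intro integral_cong_AE) (auto elim!: AE_mp)
  finally have 1: "(\<integral>\<omega>. g \<omega> * (W x v \<omega> * W y v \<omega>) \<partial>M) - (\<integral>\<omega>. g \<omega> * (W x u \<omega> * W y u \<omega>) \<partial>M) =
      (\<integral>\<omega>. g \<omega> * ?C v \<omega> \<partial>M) - (\<integral>\<omega>. g \<omega> * ?C u \<omega> \<partial>M)"
    using gC[OF v] gC[OF uv(1)] gWW[OF v] gWW[OF uv(1)] by (simp add: right_diff_distrib)
  have ind: "integrable M (\<lambda>\<omega>. (g \<omega> * W z u \<omega>) * (W z' v \<omega> - W z' u \<omega>))"
    "(\<integral>\<omega>. (g \<omega> * W z u \<omega>) * (W z' v \<omega> - W z' u \<omega>) \<partial>M) = 0" for z z'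
  proof -
    have m: "(\<lambda>\<omega>. g \<omega> * W z u \<omega>) \<in> borel_measurable (Ft u)" by measurable
    have "integrable M (\<lambda>\<omega>. B * W z u \<omega>)" using W_integrable(1)[OF uv(1)] by simp
    then have i: "integrable M (\<lambda>\<omega>. g \<omega> * W z u \<omega>)"
      by (rule Bochner_Integration.integrable_bound)
         (auto simp: abs_mult intro!: AE_I2 mult_right_mono order_trans[OF g(2)])
    show "integrable M (\<lambda>\<omega>. (g \<omega> * W z u \<omega>) * (W z' v \<omega> - W z' u \<omega>))"
      "(\<integral>\<omega>. (g \<omega> * W z u \<omega>) * (W z' v \<omega> - W z' u \<omega>) \<partial>M) = 0"
      using W_independent[OF uv m i] by auto
  qed
  have "(\<integral>\<omega>. g \<omega> * ((W x v \<omega> - W x u \<omega>) * (W y v \<omega> - W y u \<omega>)) \<partial>M) =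
    (\<integral>\<omega>. g \<omega> * (W x v \<omega> * W y v \<omega>) - g \<omega> * (W x u \<omega> * W y u \<omega>) - (g \<omega> * W x u \<omega>) * (W y v \<omega> - W y u \<omega>)
        - (g \<omega> * W y u \<omega>) * (W x v \<omega> - W x u \<omega>) \<partial>M)"
    by (rule Bochner_Integration.integral_cong) (auto simp: algebra_simps)
  also have "\<dots> = (\<integral>\<omega>. g \<omega> * (W x v \<omega> * W y v \<omega>) \<partial>M) - (\<integral>\<omega>. g \<omega> * (W x u \<omega> * W y u \<omega>) \<partial>M)"
    using gWW[OF v] gWW[OF uv(1)] ind by simp
  also have "\<dots> = (\<integral>\<omega>. g \<omega> * ?C v \<omega> - g \<omega> * ?C u \<omega> \<partial>M)"
    unfolding 1 using gC[OF v] gC[OF uv(1)] by simp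
  also have "\<dots> = (\<integral>\<omega>. g \<omega> * (LINT r:{u..v}|lborel. \<phi> (Y x r \<omega> - Y y r \<omega>)) \<partial>M)"
    by (rule Bochner_Integration.integral_cong[OF refl])
       (simp add: set_lebesgue_integral_split[OF covariation_int uv] algebra_simps)
  finally show ?thesis .
qed


section \<open>Integrability of the drift along trajectories\<close>

lemma N_0 [simp]: "N x 0 \<omega> = 0"
proof -
  have "(LINT q:{0..0}|lborel. drift x q \<omega>) = 0"
    using set_borel_integral_eq_integral(2)[OF drift_int[of 0 0]] by simp
  then show ?thesis by (auto simp: N_def Y_def G_0)
qed

lemma N_joint: "(\<lambda>p. N x (max 0 (fst p)) (snd p)) \<in> borel_measurable (lborel \<Otimes>\<^sub>M M)"
proof (rule measurable_continuous_process)
  fix \<omega>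
  have "continuous_on UNIV (\<lambda>r::real. max 0 r)" by (intro continuous_intros)
  with N_cont show "continuous_on UNIV (\<lambda>r. N x (max 0 r) \<omega>)" by (rule continuous_on_compose2) auto
qed measurable

lemma N_abs_expectation:
  assumes "0 \<le> r" shows "integrable M (\<lambda>\<omega>. \<bar>N x r \<omega>\<bar>)" "(\<integral>\<omega>. \<bar>N x r \<omega>\<bar> \<partial>M) \<le> 1 + r"
proof -
  have i: "integrable M (N x r)" "integrable M (\<lambda>\<omega>. (N x r \<omega>)\<^sup>2)" "(\<integral>\<omega>. (N x r \<omega>)\<^sup>2 \<partial>M) = r"
    using N_moments(1,2,4)[of 0 r x] assms by simp_all
  then show "integrable M (\<lambda>\<omega>. \<bar>N x r \<omega>\<bar>)" by simp
  have "(\<integral>\<omega>. \<bar>N x r \<omega>\<bar> \<partial>M) \<le> (\<integral>\<omega>. 1 + (N x r \<omega>)\<^sup>2 \<partial>M)"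
  proof (rule integral_mono)
    fix \<omega>
    have "0 \<le> (\<bar>N x r \<omega>\<bar> - 1)\<^sup>2 + \<bar>N x r \<omega>\<bar>" by (intro add_nonneg_nonneg) auto
    moreover have "(\<bar>N x r \<omega>\<bar> - 1)\<^sup>2 = (N x r \<omega>)\<^sup>2 - 2 * \<bar>N x r \<omega>\<bar> + 1" by (simp add: power2_diff)
    ultimately show "\<bar>N x r \<omega>\<bar> \<le> 1 + (N x r \<omega>)\<^sup>2" by linarith
  qed (use i in auto)
  also have "\<dots> = 1 + r" using i by (simp add: prob_space)
  finally show "(\<integral>\<omega>. \<bar>N x r \<omega>\<bar> \<partial>M) \<le> 1 + r" .
qed

lemma N_abs_path_integrable:
  assumes "0 \<le> t" shows "integrable M (\<lambda>\<omega>. LINT r:{0..t}|lborel. \<bar>N x r \<omega>\<bar>)"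
proof -
  interpret P: pair_sigma_finite lborel M ..
  let ?f = "\<lambda>p. indicator {0..t} (fst p) *\<^sub>R \<bar>N x (max 0 (fst p)) (snd p)\<bar>"
  have fm [measurable]: "?f \<in> borel_measurable (lborel \<Otimes>\<^sub>M M)"
    using N_joint[of x] by measurable
  have "integrable (lborel \<Otimes>\<^sub>M M) ?f"
  proof (rule P.Fubini_integrable[OF fm])
    show "integrable lborel (\<lambda>r. \<integral>\<omega>. norm (?f (r, \<omega>)) \<partial>M)"
    proof (rule Bochner_Integration.integrable_bound)
      show "integrable lborel (\<lambda>r. (1 + t) * indicator {0..t} r)"
        using borel_integrable_atLeastAtMost'[of 0 t "\<lambda>_. 1 :: real"] by (simp add: set_integrable_def)
      show "(\<lambda>r. \<integral>\<omega>. norm (?f (r, \<omega>)) \<partial>M) \<in> borel_measurable lborel"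
        by (rule borel_measurable_lebesgue_integral) (use fm in \<open>simp add: case_prod_beta\<close>)
      show "AE r in lborel. norm (\<integral>\<omega>. norm (?f (r, \<omega>)) \<partial>M) \<le> norm ((1 + t) * indicator {0..t} r :: real)"
        using N_abs_expectation(2)[of _ x] assms
        by (intro AE_I2) (force simp: indicator_def Bochner_Integration.integral_nonneg intro: order_trans)
    qed
    show "AE r in lborel. integrable M (\<lambda>\<omega>. ?f (r, \<omega>))"
      using N_abs_expectation(1)[of _ x] by (intro AE_I2) (auto simp: indicator_def)
  qed
  then have "integrable M (\<lambda>\<omega>. \<integral>r. ?f (r, \<omega>) \<partial>lborel)"
    by (intro P.integrable_snd) (simp add: case_prod_unfold)
  also have "(\<lambda>\<omega>. \<integral>r. ?f (r, \<omega>) \<partial>lborel) = (\<lambda>\<omega>. LINT r:{0..t}|lborel. \<bar>N x r \<omega>\<bar>)"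
    unfolding set_lebesgue_integral_def
    by (intro ext Bochner_Integration.integral_cong) (auto simp: indicator_def max_def)
  finally show ?thesis .
qed

lemma Y_path_int: "set_integrable lborel {s..t} (\<lambda>r. \<bar>Y x r \<omega>\<bar>)"
  by (intro borel_integrable_atLeastAtMost' continuous_intros continuous_on_subset[OF Y_cont]) auto

lemma drift_growth: "\<bar>drift x r \<omega>\<bar> \<le> K * (1 + \<bar>Y x r \<omega>\<bar>)"
  using growth[of "Y x r \<omega>"] K_nonneg by (auto simp: drift_def)

text \<open>Linear growth of the drift gives \<open>\<bar>Y\<bar> \<le> \<bar>x\<bar> + K * t +
  \<bar>N\<bar> + K * (integral of \<bar>Y\<bar>)\<close> on each path. Gronwall then reduces
  integrability of \<open>Y\<close> to that of the noise, whose moments are Gaussian.\<close>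

lemma Y_abs_path_bound:
  assumes "0 \<le> t"
  shows "(LINT r:{0..t}|lborel. \<bar>Y x r \<omega>\<bar>) \<le> exp (K * t) * (t * (\<bar>x\<bar> + K * t) + (LINT r:{0..t}|lborel. \<bar>N x r \<omega>\<bar>))"
proof -
  have cY: "continuous_on {0..T} (\<lambda>r. \<bar>Y x r \<omega>\<bar>)" for T
    by (intro continuous_intros continuous_on_subset[OF Y_cont]) auto
  have cN: "continuous_on {0..T} (\<lambda>r. \<bar>N x r \<omega>\<bar>)" for T
    by (intro continuous_intros continuous_on_subset[OF N_cont]) auto
  have Yeq: "(LINT r:{0..T}|lborel. \<bar>Y x r \<omega>\<bar>) = integral {0..T} (\<lambda>r. \<bar>Y x r \<omega>\<bar>)" for T
    by (rule set_borel_integral_eq_integral(2)[OF Y_path_int])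
  have Neq: "(LINT r:{0..T}|lborel. \<bar>N x r \<omega>\<bar>) = integral {0..T} (\<lambda>r. \<bar>N x r \<omega>\<bar>)" for T
    by (rule set_borel_integral_eq_integral(2)[OF borel_integrable_atLeastAtMost'[OF cN]])
  have "integral {0..t} (\<lambda>r. \<bar>Y x r \<omega>\<bar>) \<le> exp (K * t) * integral {0..t} (\<lambda>r. (\<bar>x\<bar> + K * t) + \<bar>N x r \<omega>\<bar>)"
  proof (rule integral_gronwall[OF cY _ assms K_nonneg])
    show "continuous_on {0..t} (\<lambda>r. (\<bar>x\<bar> + K * t) + \<bar>N x r \<omega>\<bar>)" by (intro continuous_intros cN)
    fix r assume r: "r \<in> {0..t}"
    show "0 \<le> (\<bar>x\<bar> + K * t) + \<bar>N x r \<omega>\<bar>" using K_nonneg assms by simp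
    have "\<bar>LINT q:{0..r}|lborel. drift x q \<omega>\<bar> \<le> (LINT q:{0..r}|lborel. \<bar>drift x q \<omega>\<bar>)"
      using set_integral_norm_bound[OF drift_int[of 0]] by simp
    also have "\<dots> \<le> (LINT q:{0..r}|lborel. K * (1 + \<bar>Y x q \<omega>\<bar>))"
    proof (rule set_integral_mono)
      show "set_integrable lborel {0..r} (\<lambda>q. K * (1 + \<bar>Y x q \<omega>\<bar>))"
        by (intro borel_integrable_atLeastAtMost' continuous_intros continuous_on_subset[OF Y_cont]) auto
    qed (use drift_growth drift_int[of 0] in \<open>auto intro!: set_integrable_abs\<close>)
    also have "\<dots> = (LINT q:{0..r}|lborel. K + K * \<bar>Y x q \<omega>\<bar>)" by (simp add: distrib_left)
    also have "\<dots> = (LINT q:{0..r}|lborel. K) + (LINT q:{0..r}|lborel. K * \<bar>Y x q \<omega>\<bar>)"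
      using Y_path_int[of 0 r x \<omega>] borel_integrable_atLeastAtMost'[of 0 r "\<lambda>_. K"]
      by (intro set_integral_add) auto
    also have "\<dots> = K * r + K * (LINT q:{0..r}|lborel. \<bar>Y x q \<omega>\<bar>)" using r by (simp add: set_lebesgue_integral_def)
    also have "\<dots> \<le> K * t + K * (LINT q:{0..r}|lborel. \<bar>Y x q \<omega>\<bar>)" using r K_nonneg by (simp add: mult_left_mono)
    finally show "\<bar>Y x r \<omega>\<bar> \<le> (\<bar>x\<bar> + K * t) + \<bar>N x r \<omega>\<bar> + K * integral {0..r} (\<lambda>r. \<bar>Y x r \<omega>\<bar>)"
      unfolding Yeq N_def[of x r] by linarith
  qed
  also have "integral {0..t} (\<lambda>r. (\<bar>x\<bar> + K * t) + \<bar>N x r \<omega>\<bar>) = t * (\<bar>x\<bar> + K * t) + integral {0..t} (\<lambda>r. \<bar>N x r \<omega>\<bar>)"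
    using assms by (subst Henstock_Kurzweil_Integration.integral_add) (auto intro!: integrable_continuous_real cN)
  finally show ?thesis unfolding Yeq Neq .
qed

lemma Y_abs_path_integrable:
  assumes "0 \<le> t" shows "integrable M (\<lambda>\<omega>. LINT r:{0..t}|lborel. \<bar>Y x r \<omega>\<bar>)"
proof (rule Bochner_Integration.integrable_bound)
  show "integrable M (\<lambda>\<omega>. exp (K * t) * (t * (\<bar>x\<bar> + K * t) + (LINT r:{0..t}|lborel. \<bar>N x r \<omega>\<bar>)))"
    using N_abs_path_integrable[OF assms] by simp
  show "(\<lambda>\<omega>. LINT r:{0..t}|lborel. \<bar>Y x r \<omega>\<bar>) \<in> borel_measurable M"
    by (rule path_integral_measurable) measurable
  have "0 \<le> (LINT r:{0..t}|lborel. \<bar>Y x r \<omega>\<bar>)" for \<omega>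
    unfolding set_lebesgue_integral_def by (rule Bochner_Integration.integral_nonneg) simp
  then show "AE \<omega> in M. norm (LINT r:{0..t}|lborel. \<bar>Y x r \<omega>\<bar>) \<le> norm (exp (K * t) * (t * (\<bar>x\<bar> + K * t) + (LINT r:{0..t}|lborel. \<bar>N x r \<omega>\<bar>)))"
    using Y_abs_path_bound[OF assms] by (intro AE_I2) (auto intro: order_trans[OF _ abs_ge_self])
qed

section \<open>The gap of two trajectories as an Ito process\<close>

definition Z where "Z x y r \<omega> = Y y r \<omega> - Y x r \<omega>"

lemma Z_meas [measurable]: "Z x y r \<in> borel_measurable M"
  unfolding Z_def[abs_def] by measurable

lemma Z_joint [measurable]: "(\<lambda>p. Z x y (fst p) (snd p)) \<in> borel_measurable (lborel \<Otimes>\<^sub>M M)"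
  unfolding Z_def by measurable

lemma drift_diff_dominated:
  assumes "0 \<le> s" "s \<le> t"
  shows "integrable M (\<lambda>\<omega>. LINT r:{s..t}|lborel. \<bar>drift y r \<omega> - drift x r \<omega>\<bar>)"
proof (rule Bochner_Integration.integrable_bound)
  let ?b = "\<lambda>r \<omega>. K * (2 + \<bar>Y y r \<omega>\<bar> + \<bar>Y x r \<omega>\<bar>)"
  have 0: "0 \<le> t" using assms by simp
  show "integrable M (\<lambda>\<omega>. K * (2 * t + (LINT r:{0..t}|lborel. \<bar>Y y r \<omega>\<bar>) + (LINT r:{0..t}|lborel. \<bar>Y x r \<omega>\<bar>)))"
    using Y_abs_path_integrable[OF 0] by simp
  show "(\<lambda>\<omega>. LINT r:{s..t}|lborel. \<bar>drift y r \<omega> - drift x r \<omega>\<bar>) \<in> borel_measurable M"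
    by (rule path_integral_measurable) measurable
  have "\<bar>LINT r:{s..t}|lborel. \<bar>drift y r \<omega> - drift x r \<omega>\<bar>\<bar> \<le> K * (2 * t + (LINT r:{0..t}|lborel. \<bar>Y y r \<omega>\<bar>) + (LINT r:{0..t}|lborel. \<bar>Y x r \<omega>\<bar>))" for \<omega>
  proof -
    have di: "set_integrable lborel {u..v} (\<lambda>r. \<bar>drift y r \<omega> - drift x r \<omega>\<bar>)" if "0 \<le> u" for u v
      using drift_int[OF that] by (intro set_integrable_abs set_integral_diff) auto
    have nn: "0 \<le> (LINT r:{u..v}|lborel. \<bar>drift y r \<omega> - drift x r \<omega>\<bar>)" for u v
      unfolding set_lebesgue_integral_def by (rule Bochner_Integration.integral_nonneg) simp
    have "(LINT r:{0..t}|lborel. \<bar>drift y r \<omega> - drift x r \<omega>\<bar>) \<le> (LINT r:{0..t}|lborel. ?b r \<omega>)"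
    proof (rule set_integral_mono)
      show "set_integrable lborel {0..t} (\<lambda>r. ?b r \<omega>)"
        by (intro borel_integrable_atLeastAtMost' continuous_intros continuous_on_subset[OF Y_cont]) auto
      show "\<bar>drift y r \<omega> - drift x r \<omega>\<bar> \<le> ?b r \<omega>" for r
        using drift_growth[of y r \<omega>] drift_growth[of x r \<omega>] by (simp add: algebra_simps)
    qed (rule di, simp)
    also have "\<dots> = (LINT r:{0..t}|lborel. K * 2 + (K * \<bar>Y y r \<omega>\<bar> + K * \<bar>Y x r \<omega>\<bar>))"
      by (simp add: algebra_simps)
    also have "\<dots> = (LINT r:{0..t}|lborel. K * 2) + ((LINT r:{0..t}|lborel. K * \<bar>Y y r \<omega>\<bar>) + (LINT r:{0..t}|lborel. K * \<bar>Y x r \<omega>\<bar>))"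
      using Y_path_int[of 0 t x \<omega>] Y_path_int[of 0 t y \<omega>] borel_integrable_atLeastAtMost'[of 0 t "\<lambda>_. K * 2"]
      by (subst set_integral_add(2) | intro set_integral_add(1))+ auto
    also have "\<dots> = K * (2 * t + (LINT r:{0..t}|lborel. \<bar>Y y r \<omega>\<bar>) + (LINT r:{0..t}|lborel. \<bar>Y x r \<omega>\<bar>))"
      using 0 by (simp add: set_lebesgue_integral_def algebra_simps)
    finally show ?thesis
      using set_lebesgue_integral_split[OF di[of 0], of s t, OF order_refl assms] nn[of 0 s] nn[of s t] by linarith
  qed
  then show "AE \<omega> in M. norm (LINT r:{s..t}|lborel. \<bar>drift y r \<omega> - drift x r \<omega>\<bar>) \<le> norm (K * (2 * t + (LINT r:{0..t}|lborel. \<bar>Y y r \<omega>\<bar>) + (LINT r:{0..t}|lborel. \<bar>Y x r \<omega>\<bar>)))"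
    by (intro AE_I2) (auto intro: order_trans[OF _ abs_ge_self])
qed

text \<open>Membership in \<open>G x\<close> depends on the whole path, so \<open>Z x y s\<close>
  need not be measurable at time \<open>s\<close>. It agrees almost surely with a difference of flow
  values, which is, and the martingale tests are applied to that version.\<close>

lemma test_process:
  fixes g :: "real \<Rightarrow> real"
  assumes g: "continuous_on UNIV g" "bounded (range g)" and s: "0 \<le> s"
  obtains g0 B where "g0 \<in> borel_measurable (Ft s)" "\<And>\<omega>. \<bar>g0 \<omega>\<bar> \<le> (B::real)" "AE \<omega> in M. g (Z x y s \<omega>) = g0 \<omega>"
proof -
  obtain B where B: "\<And>z. \<bar>g z\<bar> \<le> B" using g(2) by (force simp: bounded_iff)
  have [measurable]: "g \<in> borel_measurable borel" using g(1) by (rule borel_measurable_continuous_onI)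
  note [measurable] = X_Ft[OF s]
  show ?thesis
  proof (rule that[of "\<lambda>\<omega>. g (X 0 s \<omega> y - X 0 s \<omega> x)" B])
    show "AE \<omega> in M. g (Z x y s \<omega>) = g (X 0 s \<omega> y - X 0 s \<omega> x)"
      using AE_Y_X[OF s, of x] AE_Y_X[OF s, of y] by eventually_elim (simp add: Z_def)
    show "(\<lambda>\<omega>. g (X 0 s \<omega> y - X 0 s \<omega> x)) \<in> borel_measurable (Ft s)" by measurable
  qed (rule B)
qed

lemma diff_power4_le: "(p - q)^4 \<le> 8 * (p^4 + q^4)" for p q :: real
proof -
  have "(p - q)\<^sup>2 \<le> 2 * (p\<^sup>2 + q\<^sup>2)" using zero_le_power2[of "p + q"] by (simp add: power2_eq_square algebra_simps)
  then have "((p - q)\<^sup>2)\<^sup>2 \<le> (2 * (p\<^sup>2 + q\<^sup>2))\<^sup>2" by (intro power_mono) auto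
  also have "\<dots> \<le> 8 * ((p\<^sup>2)\<^sup>2 + (q\<^sup>2)\<^sup>2)" using zero_le_power2[of "p\<^sup>2 - q\<^sup>2"] by (simp add: power2_eq_square algebra_simps)
  finally show ?thesis by (simp add: power_mult[symmetric])
qed

lemma increment_power4_le: "(c - d - (e - f))^4 \<le> 8 * ((c - e)^4 + (d - f)^4)" for c d e f :: real
  using diff_power4_le[of "c - e" "d - f"] by (simp add: algebra_simps)

text \<open>The constant 48 is \<open>8 * (3 + 3)\<close>: 3 from each Gaussian fourth moment, 8
  from the fourth power of a difference. It also exceeds the bound 4 for the bracket rate. The cases
  follow the order of the assumptions of \<open>ito_process\<close>.\<close>

lemma ito_process_pair:
  "ito_process M (Z x y) (\<lambda>r \<omega>. N y r \<omega> - N x r \<omega>) (\<lambda>r \<omega>. drift y r \<omega> - drift x r \<omega>) (\<lambda>r \<omega>. 2 * (1 - \<phi> (Z x y r \<omega>))) 48"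
proof (unfold_locales, goal_cases)
  case (3 \<omega>) show ?case unfolding Z_def by (intro continuous_intros continuous_on_subset[OF Y_cont]) auto
next
  case (4 \<omega>) show ?case by (intro continuous_intros N_cont)
next
  case (5 \<omega> s t) then show ?case using drift_int by (intro set_integral_diff) auto
next
  case (6 \<omega> s t) show ?case unfolding Z_def
    by (intro borel_integrable_atLeastAtMost' continuous_intros continuous_on_compose2[OF \<phi>_cont] continuous_on_subset[OF Y_cont]) auto
next
  case (7 \<omega> s t)
  have "(LINT r:{0..t}|lborel. drift z r \<omega>) = (LINT r:{0..s}|lborel. drift z r \<omega>) + (LINT r:{s..t}|lborel. drift z r \<omega>)" for z
    using 7 drift_int[of 0 t z \<omega>] by (intro set_lebesgue_integral_split) auto
  then show ?case using drift_int[OF 7(2)] by (simp add: Z_def N_def set_integral_diff)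
next
  case (8 s t) show ?case by (rule path_integral_measurable) measurable
next
  case (9 s t) then show ?case by (rule drift_diff_dominated)
next
  case (10 r \<omega>) show ?case using \<phi>_bound[of "Z x y r \<omega>"] by simp
next
  case (11 s t)
  have "integrable M (\<lambda>\<omega>. (N y t \<omega> - N y s \<omega>) - (N x t \<omega> - N x s \<omega>))"
    using N_moments(1)[OF 11] by simp
  then show ?case by (simp add: algebra_simps)
next
  case (12 s t)
  show ?case
  proof (rule Bochner_Integration.integrable_bound)
    show "integrable M (\<lambda>\<omega>. 2 * ((N y t \<omega> - N y s \<omega>)\<^sup>2 + (N x t \<omega> - N x s \<omega>)\<^sup>2))"
      using N_moments(2)[OF 12] by simp
    have "(c - d - (e - f))\<^sup>2 \<le> 2 * ((c - e)\<^sup>2 + (d - f)\<^sup>2)" for c d e f :: real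
      using zero_le_power2[of "(c - e) + (d - f)"] by (simp add: power2_eq_square algebra_simps)
    then show "AE \<omega> in M. norm ((N y t \<omega> - N x t \<omega> - (N y s \<omega> - N x s \<omega>))\<^sup>2) \<le> norm (2 * ((N y t \<omega> - N y s \<omega>)\<^sup>2 + (N x t \<omega> - N x s \<omega>)\<^sup>2))"
      by (intro AE_I2) simp
  qed measurable
next
  case (13 s t)
  show ?case
  proof (rule Bochner_Integration.integrable_bound)
    show "integrable M (\<lambda>\<omega>. 8 * ((N y t \<omega> - N y s \<omega>)^4 + (N x t \<omega> - N x s \<omega>)^4))"
      using N_moments(3)[OF 13] by simp
    show "AE \<omega> in M. norm ((N y t \<omega> - N x t \<omega> - (N y s \<omega> - N x s \<omega>))^4) \<le> norm (8 * ((N y t \<omega> - N y s \<omega>)^4 + (N x t \<omega> - N x s \<omega>)^4))"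
      using increment_power4_le by (intro AE_I2) simp
  qed measurable
next
  case (14 s t)
  have "(\<integral>\<omega>. (N y t \<omega> - N x t \<omega> - (N y s \<omega> - N x s \<omega>))^4 \<partial>M) \<le> (\<integral>\<omega>. 8 * ((N y t \<omega> - N y s \<omega>)^4 + (N x t \<omega> - N x s \<omega>)^4) \<partial>M)"
  proof (rule integral_mono')
    show "integrable M (\<lambda>\<omega>. 8 * ((N y t \<omega> - N y s \<omega>)^4 + (N x t \<omega> - N x s \<omega>)^4))"
      using N_moments(3)[OF 14] by simp
  qed (use increment_power4_le in auto)
  also have "\<dots> = 48 * (t - s)\<^sup>2" using N_moments(3,5)[OF 14] by simp
  finally show ?case .
next
  case (15 g s t)
  obtain g0 B where g0: "g0 \<in> borel_measurable (Ft s)" "\<And>\<omega>. \<bar>g0 \<omega>\<bar> \<le> (B::real)" "AE \<omega> in M. g (Z x y s \<omega>) = g0 \<omega>"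
    using test_process[OF 15(3,4,1), of x y] by metis
  have gi: "integrable M g0" using g0 Ft_M[OF g0(1)] by (intro integrable_const_bound[where B=B]) auto
  have t: "0 \<le> t" using 15 by simp
  have [measurable]: "g \<in> borel_measurable borel" using 15 by (intro borel_measurable_continuous_onI)
  note [measurable] = Ft_M[OF g0(1)] W_meas[OF 15(1)] W_meas[OF t]
  have "(\<integral>\<omega>. g (Z x y s \<omega>) * (N y t \<omega> - N x t \<omega> - (N y s \<omega> - N x s \<omega>)) \<partial>M) =
    (\<integral>\<omega>. g0 \<omega> * (W y t \<omega> - W y s \<omega>) - g0 \<omega> * (W x t \<omega> - W x s \<omega>) \<partial>M)"
  proof (rule integral_cong_AE)
    show "AE \<omega> in M. g (Z x y s \<omega>) * (N y t \<omega> - N x t \<omega> - (N y s \<omega> - N x s \<omega>)) = g0 \<omega> * (W y t \<omega> - W y s \<omega>) - g0 \<omega> * (W x t \<omega> - W x s \<omega>)"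
      using g0(3) AE_N_W[OF t, of x] AE_N_W[OF t, of y] AE_N_W[OF 15(1), of x] AE_N_W[OF 15(1), of y]
      by eventually_elim (simp add: algebra_simps)
  qed measurable
  also have "\<dots> = 0"
    using W_independent[OF 15(1,2) g0(1) gi] by simp
  finally show ?case .
next
  case (16 g s t)
  obtain g0 B where g0: "g0 \<in> borel_measurable (Ft s)" "\<And>\<omega>. \<bar>g0 \<omega>\<bar> \<le> (B::real)" "AE \<omega> in M. g (Z x y s \<omega>) = g0 \<omega>"
    using test_process[OF 16(3,4,1), of x y] by metis
  have t: "0 \<le> t" using 16 by simp
  have [measurable]: "g \<in> borel_measurable borel" using 16 by (intro borel_measurable_continuous_onI)
  note [measurable] = Ft_M[OF g0(1)] W_meas[OF 16(1)] W_meas[OF t]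
  let ?W = "\<lambda>z \<omega>. W z t \<omega> - W z s \<omega>" and ?C = "\<lambda>z z' \<omega>. LINT r:{s..t}|lborel. \<phi> (Y z r \<omega> - Y z' r \<omega>)"
  have C_same: "?C z z \<omega> = t - s" for z \<omega>
    using 16 by (simp add: \<phi>_0 set_lebesgue_integral_def)
  have gW: "integrable M (\<lambda>\<omega>. g0 \<omega> * (?W z \<omega> * ?W z' \<omega>))" for z z'
    using W_moments(2)[OF 16(1,2)] g0(2) by (intro integrable_product[where B=B]) auto
  have gC: "integrable M (\<lambda>\<omega>. g0 \<omega> * ?C z z' \<omega>)" for z z'
  proof (rule integrable_const_bound[where B="B * (t - s)"])
    show "AE \<omega> in M. norm (g0 \<omega> * ?C z z' \<omega>) \<le> B * (t - s)"
    proof (rule AE_I2)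
      fix \<omega>
      have "\<bar>g0 \<omega>\<bar> * \<bar>?C z z' \<omega>\<bar> \<le> B * (t - s)"
        using g0(2)[of \<omega>] covariation_bound[OF 16(2), of z \<omega> z'] by (intro mult_mono) auto
      then show "norm (g0 \<omega> * ?C z z' \<omega>) \<le> B * (t - s)" by (simp add: abs_mult)
    qed
  qed measurable
  \<comment> \<open>Polarization: the bracket of the difference of two noises combines three
    covariations, and the two diagonal ones equal \<open>t - s\<close> because
    \<open>\<phi> 0 = 1\<close>.\<close>
  have V: "(LINT r:{s..t}|lborel. 2 * (1 - \<phi> (Z x y r \<omega>))) = ?C y y \<omega> - 2 * ?C y x \<omega> + ?C x x \<omega>" for \<omega>
  proof -
    have "(LINT r:{s..t}|lborel. 2 * (1 - \<phi> (Z x y r \<omega>))) = (LINT r:{s..t}|lborel. 2 - 2 * \<phi> (Y y r \<omega> - Y x r \<omega>))"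
      by (simp add: Z_def)
    also have "\<dots> = (LINT r:{s..t}|lborel. 2) - (LINT r:{s..t}|lborel. 2 * \<phi> (Y y r \<omega> - Y x r \<omega>))"
      using covariation_int[of s t y \<omega> x] borel_integrable_atLeastAtMost'[of s t "\<lambda>_. 2 :: real"]
      by (intro set_integral_diff) auto
    also have "\<dots> = 2 * (t - s) - 2 * ?C y x \<omega>" using 16(2) by (simp add: set_lebesgue_integral_def)
    finally show ?thesis unfolding C_same by simp
  qed
  have "(\<integral>\<omega>. g (Z x y s \<omega>) * (N y t \<omega> - N x t \<omega> - (N y s \<omega> - N x s \<omega>))\<^sup>2 \<partial>M) =
    (\<integral>\<omega>. g0 \<omega> * (?W y \<omega> * ?W y \<omega>) - 2 * (g0 \<omega> * (?W y \<omega> * ?W x \<omega>)) + g0 \<omega> * (?W x \<omega> * ?W x \<omega>) \<partial>M)"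
  proof (rule integral_cong_AE)
    show "AE \<omega> in M. g (Z x y s \<omega>) * (N y t \<omega> - N x t \<omega> - (N y s \<omega> - N x s \<omega>))\<^sup>2 =
      g0 \<omega> * (?W y \<omega> * ?W y \<omega>) - 2 * (g0 \<omega> * (?W y \<omega> * ?W x \<omega>)) + g0 \<omega> * (?W x \<omega> * ?W x \<omega>)"
      using g0(3) AE_N_W[OF t, of x] AE_N_W[OF t, of y] AE_N_W[OF 16(1), of x] AE_N_W[OF 16(1), of y]
      by eventually_elim (simp add: power2_eq_square algebra_simps)
  qed measurable
  also have "\<dots> = (\<integral>\<omega>. g0 \<omega> * ?C y y \<omega> \<partial>M) - 2 * (\<integral>\<omega>. g0 \<omega> * ?C y x \<omega> \<partial>M) + (\<integral>\<omega>. g0 \<omega> * ?C x x \<omega> \<partial>M)"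
    using gW by (simp add: W_covariation[OF 16(1,2) g0(1,2)])
  also have "\<dots> = (\<integral>\<omega>. g0 \<omega> * ?C y y \<omega> - 2 * (g0 \<omega> * ?C y x \<omega>) + g0 \<omega> * ?C x x \<omega> \<partial>M)"
    using gC[of y y] gC[of y x] gC[of x x] by simp
  also have "\<dots> = (\<integral>\<omega>. g (Z x y s \<omega>) * (LINT r:{s..t}|lborel. 2 * (1 - \<phi> (Z x y r \<omega>))) \<partial>M)"
  proof (rule integral_cong_AE)
    show "(\<lambda>\<omega>. g (Z x y s \<omega>) * (LINT r:{s..t}|lborel. 2 * (1 - \<phi> (Z x y r \<omega>)))) \<in> borel_measurable M"
      unfolding V by measurable
    show "AE \<omega> in M. g0 \<omega> * ?C y y \<omega> - 2 * (g0 \<omega> * ?C y x \<omega>) + g0 \<omega> * ?C x x \<omega> =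
        g (Z x y s \<omega>) * (LINT r:{s..t}|lborel. 2 * (1 - \<phi> (Z x y r \<omega>)))"
      using g0(3) unfolding V by eventually_elim (simp add: algebra_simps)
  qed measurable
  finally show ?case .
qed measurable

end

section \<open>Separation probability\<close>

text \<open>A nonintegrable function has Bochner integral 0; for an integrable one, passing to the
  positive part only increases the integral.\<close>

lemma ennreal_integral_le_nn_integral:
  fixes f :: "'a \<Rightarrow> real"
  shows "ennreal (\<integral>x. f x \<partial>M) \<le> (\<integral>\<^sup>+x. ennreal (f x) \<partial>M)"
proof (cases "integrable M f")
  case True
  then have i: "integrable M (\<lambda>x. max 0 (f x))" by simp
  have "ennreal (\<integral>x. f x \<partial>M) \<le> ennreal (\<integral>x. max 0 (f x) \<partial>M)"
    by (intro ennreal_leI integral_mono True i) auto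
  also have "\<dots> = (\<integral>\<^sup>+x. ennreal (max 0 (f x)) \<partial>M)"
    by (rule nn_integral_eq_integral[symmetric, OF i]) simp
  also have "\<dots> = (\<integral>\<^sup>+x. ennreal (f x) \<partial>M)"
    by (rule nn_integral_cong) (simp add: max_def ennreal_neg)
  finally show ?thesis .
qed (simp add: not_integrable_integral_eq)

lemma ennreal_add_le: "ennreal (x + y) \<le> ennreal x + ennreal y"
proof -
  have "ennreal (x + y) \<le> ennreal (max 0 x + max 0 y)" by (intro ennreal_leI) auto
  then show ?thesis by (simp add: ennreal_plus)
qed

context harris begin

text \<open>\<open>Z\<close> may be negative where only one of the two modifications follows the flow.\<close>

definition Zp where "Zp x y r \<omega> = max 0 (Z x y r \<omega>)"

lemma Zp_nonneg: "0 \<le> Zp x y r \<omega>" by (simp add: Zp_def)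

lemma Zp_meas [measurable]: "Zp x y r \<in> borel_measurable M"
  unfolding Zp_def[abs_def] by measurable

lemma Zp_joint [measurable]: "(\<lambda>p. Zp x y (fst p) (snd p)) \<in> borel_measurable (lborel \<Otimes>\<^sub>M M)"
  unfolding Zp_def by measurable

lemma AE_Zp: 
  assumes "x \<le> y" shows "AE \<omega> in M. \<forall>r\<ge>0. Z x y r \<omega> = Zp x y r \<omega> \<and> Zp x y r \<omega> = X 0 r \<omega> y - X 0 r \<omega> x"
  using AE_G[of x] AE_G[of y]
proof eventually_elim
  case (elim \<omega>)
  have "X 0 r \<omega> x \<le> X 0 r \<omega> y" if "0 \<le> r" for r
    using X_D_up[OF order_refl that G_space[OF elim(1)]] assms by (auto simp: D_up_def mono_def)
  then show ?case using elim by (auto simp: Zp_def Z_def Y_eq_X)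
qed

text \<open>The expected occupation functional of the gap. Values in \<open>ennreal\<close> allow it
  to be compared and passed to limits before it is known to be finite.\<close>

definition occ :: "real \<Rightarrow> real \<Rightarrow> real \<Rightarrow> real \<Rightarrow> (real \<Rightarrow> real) \<Rightarrow> ennreal" where
  "occ x y s t k = (\<integral>\<^sup>+\<omega>. (\<integral>\<^sup>+r\<in>{s..t}. ennreal (k (Zp x y r \<omega>)) \<partial>lborel) \<partial>M)"

lemma joint_swap_measurable:
  fixes f :: "real \<Rightarrow> 'a \<Rightarrow> ennreal"
  assumes "(\<lambda>p. f (fst p) (snd p)) \<in> borel_measurable (lborel \<Otimes>\<^sub>M M)"
  shows "(\<lambda>p. f (snd p) (fst p)) \<in> borel_measurable (M \<Otimes>\<^sub>M lborel)"
  using measurable_compose[OF measurable_pair_swap' assms] by (simp add: case_prod_beta)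

lemma path_nn_integral_measurable:
  fixes f :: "real \<Rightarrow> 'a \<Rightarrow> ennreal"
  assumes "(\<lambda>p. f (fst p) (snd p)) \<in> borel_measurable (lborel \<Otimes>\<^sub>M M)"
  shows "(\<lambda>\<omega>. \<integral>\<^sup>+r\<in>{s..t}. f r \<omega> \<partial>lborel) \<in> borel_measurable M"
proof -
  note [measurable] = joint_swap_measurable[OF assms]
  have "(\<lambda>p. f (snd p) (fst p) * indicator {s..t} (snd p)) \<in> borel_measurable (M \<Otimes>\<^sub>M lborel)"
    by measurable
  then show ?thesis by (intro lborel.borel_measurable_nn_integral) (simp add: case_prod_beta)
qed

lemma Zp_path_measurable [measurable]: "(\<lambda>r. Zp x y r \<omega>) \<in> borel_measurable borel"
  unfolding Zp_def Z_def
  by (intro borel_measurable_continuous_onI continuous_intros Y_cont)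

text \<open>Monotone convergence in time and then in \<omega>. The conditions are asked for
  nonnegative \<open>z\<close> only: there \<open>Zp\<close> takes its values, and there the damped
  slopes are monotone in their shifts.\<close>

lemma occ_limit:
  assumes k [measurable]: "\<And>n. k n \<in> borel_measurable borel"
    and mono: "\<And>n z. 0 \<le> z \<Longrightarrow> k n z \<le> k (Suc n) z"
    and lim: "\<And>z. 0 \<le> z \<Longrightarrow> (\<lambda>n. k n z) \<longlonglongrightarrow> l z"
  shows "(\<lambda>n. occ x y s t (k n)) \<longlonglongrightarrow> occ x y s t l"
  unfolding occ_def
proof (rule nn_integral_LIMSEQ)
  have joint: "(\<lambda>p. ennreal (k n (Zp x y (fst p) (snd p)))) \<in> borel_measurable (lborel \<Otimes>\<^sub>M M)" for n
    by measurable
  show "incseq (\<lambda>n \<omega>. \<integral>\<^sup>+r\<in>{s..t}. ennreal (k n (Zp x y r \<omega>)) \<partial>lborel)"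
    using mono Zp_nonneg by (intro incseq_SucI le_funI nn_integral_mono mult_right_mono ennreal_leI) auto
  show "(\<lambda>\<omega>. \<integral>\<^sup>+r\<in>{s..t}. ennreal (k n (Zp x y r \<omega>)) \<partial>lborel) \<in> borel_measurable M" for n
    by (rule path_nn_integral_measurable[OF joint])
  fix \<omega>
  show "(\<lambda>n. \<integral>\<^sup>+r\<in>{s..t}. ennreal (k n (Zp x y r \<omega>)) \<partial>lborel) \<longlonglongrightarrow> (\<integral>\<^sup>+r\<in>{s..t}. ennreal (l (Zp x y r \<omega>)) \<partial>lborel)"
  proof (rule nn_integral_LIMSEQ)
    show "incseq (\<lambda>n r. ennreal (k n (Zp x y r \<omega>)) * indicator {s..t} r)"
      using mono Zp_nonneg by (intro incseq_SucI le_funI mult_right_mono ennreal_leI) auto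
    show "(\<lambda>r. ennreal (k n (Zp x y r \<omega>)) * indicator {s..t} r) \<in> borel_measurable lborel" for n
      by measurable
    show "(\<lambda>n. ennreal (k n (Zp x y r \<omega>)) * indicator {s..t} r) \<longlonglongrightarrow> ennreal (l (Zp x y r \<omega>)) * indicator {s..t} r" for r
    proof (cases "r \<in> {s..t}")
      case True
      then show ?thesis using tendsto_ennrealI[OF lim[OF Zp_nonneg]] by simp
    qed simp
  qed
qed

lemma expectation_limit:
  assumes k [measurable]: "\<And>n. k n \<in> borel_measurable borel"
    and mono: "\<And>n z. 0 \<le> z \<Longrightarrow> k n z \<le> k (Suc n) z"
    and lim: "\<And>z. 0 \<le> z \<Longrightarrow> (\<lambda>n. k n z) \<longlonglongrightarrow> l z"
  shows "(\<lambda>n. \<integral>\<^sup>+\<omega>. ennreal (k n (Zp x y t \<omega>)) \<partial>M) \<longlonglongrightarrow> (\<integral>\<^sup>+\<omega>. ennreal (l (Zp x y t \<omega>)) \<partial>M)"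
proof (rule nn_integral_LIMSEQ)
  show "incseq (\<lambda>n \<omega>. ennreal (k n (Zp x y t \<omega>)))"
    using mono Zp_nonneg by (intro incseq_SucI le_funI ennreal_leI) auto
  show "(\<lambda>n. ennreal (k n (Zp x y t \<omega>))) \<longlonglongrightarrow> ennreal (l (Zp x y t \<omega>))" for \<omega>
    using tendsto_ennrealI[OF lim[OF Zp_nonneg]] by simp
qed measurable

lemma occ_Fubini:
  assumes [measurable]: "k \<in> borel_measurable borel"
  shows "occ x y s t k = (\<integral>\<^sup>+r\<in>{s..t}. (\<integral>\<^sup>+\<omega>. ennreal (k (Zp x y r \<omega>)) \<partial>M) \<partial>lborel)"
proof -
  interpret P: pair_sigma_finite lborel M ..
  have "(\<lambda>p. ennreal (k (Zp x y (fst p) (snd p))) * indicator {s..t} (fst p)) \<in> borel_measurable (lborel \<Otimes>\<^sub>M M)"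
    by measurable
  then have "occ x y s t k = (\<integral>\<^sup>+r. (\<integral>\<^sup>+\<omega>. ennreal (k (Zp x y r \<omega>)) * indicator {s..t} r \<partial>M) \<partial>lborel)"
    unfolding occ_def by (intro P.Fubini') (simp add: case_prod_unfold)
  also have "\<dots> = (\<integral>\<^sup>+r\<in>{s..t}. (\<integral>\<^sup>+\<omega>. ennreal (k (Zp x y r \<omega>)) \<partial>M) \<partial>lborel)"
    by (intro nn_integral_cong nn_integral_multc) measurable
  finally show ?thesis .
qed

end

section \<open>The supermartingale inequality for the gap\<close>

locale degenerate_flow = harris M \<phi> a X K for M :: "'a measure" and \<phi> a X K +
  fixes \<alpha> \<gamma> \<epsilon> c\<phi> c\<rho> :: real
  assumes \<alpha>: "0 < \<alpha>" and \<gamma>: "0 < \<gamma>" "\<gamma> \<le> 1" "\<alpha> + \<gamma> < 2" and \<epsilon>: "0 < \<epsilon>" "\<epsilon> \<le> 1" and c: "0 < c\<phi>" "0 < c\<rho>"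
    and \<phi>_gap: "\<And>z. 0 < z \<Longrightarrow> z \<le> \<epsilon> \<Longrightarrow> c\<phi> * z powr \<alpha> \<le> 1 - \<phi> z"
    and a_modulus: "\<And>x z. 0 < z \<Longrightarrow> z \<le> \<epsilon> \<Longrightarrow> \<bar>a (x + z) - a x\<bar> \<le> c\<rho> * z powr (\<alpha> + \<gamma> - 1)"
begin

text \<open>Chosen so that \<open>L * \<gamma> * c\<phi> = 2 * c\<rho>\<close>: the second order
  term then dominates the drift term twice over.\<close>

definition L where "L = 2 * c\<rho> / (c\<phi> * \<gamma>)"

lemma L_pos: "0 < L" using c \<gamma> by (simp add: L_def)
lemma L_eq: "L * \<gamma> * c\<phi> = 2 * c\<rho>" using c \<gamma> by (simp add: L_def)

abbreviation g where "g p \<equiv> damped_slope p L \<gamma> \<epsilon>"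

text \<open>The concavity bound \<open>m * g m \<le> F z\<close> at
  \<open>m = min z (\<epsilon> / 2)\<close>. Stopping at \<open>\<epsilon> / 2\<close> keeps the
  cut-off factor away from 0.\<close>

abbreviation terminal where "terminal p \<kappa> \<kappa>' z \<equiv> min z (\<epsilon> / 2) * g p \<kappa> \<kappa>' (min z (\<epsilon> / 2))"

lemma g_measurable [measurable]: "g p \<kappa> \<kappa>' \<in> borel_measurable borel"
  unfolding damped_slope_def[abs_def] by measurable

lemma drift_bound:
  assumes "x \<le> y"
  shows "AE \<omega> in M. \<forall>r\<ge>0. Zp x y r \<omega> \<le> \<epsilon> \<longrightarrow>
    \<bar>drift y r \<omega> - drift x r \<omega>\<bar> \<le> c\<rho> * Zp x y r \<omega> powr (\<alpha> + \<gamma> - 1)"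
  using AE_G[of x] AE_G[of y] AE_Zp[OF assms]
proof eventually_elim
  case (elim \<omega>)
  show ?case
  proof (intro allI impI)
    fix r :: real assume r: "0 \<le> r" "Zp x y r \<omega> \<le> \<epsilon>"
    have e: "X 0 r \<omega> y = X 0 r \<omega> x + Zp x y r \<omega>" using elim(3) r(1) by auto
    have d: "drift y r \<omega> - drift x r \<omega> = a (X 0 r \<omega> x + Zp x y r \<omega>) - a (X 0 r \<omega> x)"
      using elim(1,2) r(1) by (simp add: drift_def Y_eq_X e)
    show "\<bar>drift y r \<omega> - drift x r \<omega>\<bar> \<le> c\<rho> * Zp x y r \<omega> powr (\<alpha> + \<gamma> - 1)"
    proof (cases "Zp x y r \<omega> = 0")
      case False
      then have "0 < Zp x y r \<omega>" using Zp_nonneg[of x y r \<omega>] by linarith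
      then show ?thesis unfolding d using r(2) by (rule a_modulus)
    qed (simp add: d)
  qed
qed

text \<open>The slope is taken with second shift 0, where it is largest, so one quantity bounds the
  drift contribution for all \<kappa>' and stays fixed while \<kappa>' tends to 0.\<close>

definition drift_term where
  "drift_term p x y s t \<kappa> = (\<integral>\<^sup>+\<omega>. (\<integral>\<^sup>+r\<in>{s..t}. ennreal (\<bar>drift y r \<omega> - drift x r \<omega>\<bar> * g p \<kappa> 0 (Zp x y r \<omega>)) \<partial>lborel) \<partial>M)"

text \<open>For positive \<kappa> the slope is at most \<open>\<kappa> powr (p - 1)\<close>, and the
  drift difference is integrable by linear growth. Finiteness permits the later cancellation in
  \<open>ennreal\<close>.\<close>

lemma drift_term_finite:
  assumes "0 < p" "p \<le> 1" "0 < \<kappa>" "0 \<le> s" "s \<le> t"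
  shows "drift_term p x y s t \<kappa> < \<infinity>"
proof -
  have g: "g p \<kappa> 0 z \<le> \<kappa> powr (p - 1)" if "0 \<le> z" for z
  proof -
    have "g p \<kappa> 0 z \<le> (z + \<kappa>) powr (p - 1)" using that assms \<epsilon> L_pos by (intro damped_slope_le_powr) auto
    also have "\<dots> \<le> \<kappa> powr (p - 1)" using that assms by (intro powr_mono2') auto
    finally show ?thesis .
  qed
  let ?b = "\<lambda>r \<omega>. \<bar>drift y r \<omega> - drift x r \<omega>\<bar>"
  have "drift_term p x y s t \<kappa> \<le> (\<integral>\<^sup>+\<omega>. ennreal (\<kappa> powr (p - 1) * (LINT r:{s..t}|lborel. ?b r \<omega>)) \<partial>M)"
    unfolding drift_term_def
  proof (rule nn_integral_mono)
    fix \<omega>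
    have i: "set_integrable lborel {s..t} (\<lambda>r. \<kappa> powr (p - 1) * ?b r \<omega>)"
      using drift_int[OF assms(4)] by (intro set_integrable_mult_right set_integrable_abs set_integral_diff) auto
    have "(\<integral>\<^sup>+r\<in>{s..t}. ennreal (?b r \<omega> * g p \<kappa> 0 (Zp x y r \<omega>)) \<partial>lborel) \<le> (\<integral>\<^sup>+r. ennreal (indicator {s..t} r *\<^sub>R (\<kappa> powr (p - 1) * ?b r \<omega>)) \<partial>lborel)"
      using g[OF Zp_nonneg] by (intro nn_integral_mono) (auto simp: indicator_def mult.commute[of "\<bar>_\<bar>"] intro!: ennreal_leI mult_right_mono)
    also have "\<dots> = ennreal (LINT r:{s..t}|lborel. \<kappa> powr (p - 1) * ?b r \<omega>)"
      unfolding set_lebesgue_integral_def using i unfolding set_integrable_def by (intro nn_integral_eq_integral) auto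
    finally show "(\<integral>\<^sup>+r\<in>{s..t}. ennreal (?b r \<omega> * g p \<kappa> 0 (Zp x y r \<omega>)) \<partial>lborel) \<le> ennreal (\<kappa> powr (p - 1) * (LINT r:{s..t}|lborel. ?b r \<omega>))"
      by simp
  qed
  also have "\<dots> < \<infinity>"
  proof -
    have "integrable M (\<lambda>\<omega>. \<kappa> powr (p - 1) * (LINT r:{s..t}|lborel. ?b r \<omega>))"
      using drift_diff_dominated[OF assms(4,5)] by simp
    moreover have "0 \<le> \<kappa> powr (p - 1) * (LINT r:{s..t}|lborel. ?b r \<omega>)" for \<omega>
      unfolding set_lebesgue_integral_def by (intro mult_nonneg_nonneg Bochner_Integration.integral_nonneg) auto
    ultimately show ?thesis by (subst nn_integral_eq_integral) auto
  qed
  finally show ?thesis .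
qed

text \<open>Ito's formula for the concave test function. The factor 1/2 of the second order term
  cancels the factor 2 in the bracket rate \<open>2 * (1 - \<phi> Z)\<close>, which leaves
  \<open>h * (1 - \<phi>)\<close>; the choice of \<open>L\<close> turns its lower bound into the
  factor \<open>2 * c\<rho>\<close>.\<close>

lemma regularized_inequality:
  assumes p: "0 < p" "p \<le> 1" and \<kappa>: "0 < \<kappa>" "0 < \<kappa>'" and st: "0 \<le> s" "s < t" and xy: "x \<le> y"
  shows "(\<integral>\<^sup>+\<omega>. ennreal (terminal p \<kappa> \<kappa>' (Zp x y t \<omega>)) \<partial>M)
    + occ x y s t (\<lambda>z. 2 * c\<rho> * (z + \<kappa>') powr (\<gamma> - 1) * z powr \<alpha> * g p \<kappa> \<kappa>' z)
    \<le> (\<integral>\<^sup>+\<omega>. ennreal (min (Zp x y s \<omega>) \<epsilon> powr p / p) \<partial>M) + drift_term p x y s t \<kappa>"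
proof -
  obtain F G h B where
    F: "\<And>x. (F has_real_derivative G x) (at x)" and G: "\<And>x. (G has_real_derivative - h x) (at x)" and
    B: "\<And>x. \<bar>G x\<bar> \<le> B" "\<And>x. \<bar>h x\<bar> \<le> B" "uniformly_continuous_on UNIV h" and
    Gg: "\<And>z. 0 \<le> z \<Longrightarrow> G z = g p \<kappa> \<kappa>' z" and
    low: "\<And>z. 0 \<le> z \<Longrightarrow> L * \<gamma> * (z + \<kappa>') powr (\<gamma> - 1) * g p \<kappa> \<kappa>' z \<le> h z" and
    out: "\<And>z. \<epsilon> \<le> z \<Longrightarrow> h z = 0" and
    Fu: "\<And>z. 0 \<le> z \<Longrightarrow> F z \<le> min z \<epsilon> powr p / p" and
    Fl: "\<And>z m. 0 \<le> m \<Longrightarrow> m \<le> z \<Longrightarrow> m * g p \<kappa> \<kappa>' m \<le> F z"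
  proof (rule concave_test_function[OF p L_pos \<gamma>(1,2) \<epsilon> \<kappa>], goal_cases)
    case (1 F G h B)
    from 1(2-) show ?case by (rule 1(1))
  qed
  interpret I: ito_process M "Z x y" "\<lambda>r \<omega>. N y r \<omega> - N x r \<omega>" "\<lambda>r \<omega>. drift y r \<omega> - drift x r \<omega>" "\<lambda>r \<omega>. 2 * (1 - \<phi> (Z x y r \<omega>))" 48
    by (rule ito_process_pair)
  interpret I: ito_test M "Z x y" "\<lambda>r \<omega>. N y r \<omega> - N x r \<omega>" "\<lambda>r \<omega>. drift y r \<omega> - drift x r \<omega>" "\<lambda>r \<omega>. 2 * (1 - \<phi> (Z x y r \<omega>))" 48 F G h B s t
    by unfold_locales (use F G B st in auto)
  let ?b = "\<lambda>r \<omega>. drift y r \<omega> - drift x r \<omega>"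
  let ?lo = "\<lambda>z. 2 * c\<rho> * (z + \<kappa>') powr (\<gamma> - 1) * z powr \<alpha> * g p \<kappa> \<kappa>' z"
  let ?Hi = "\<lambda>\<omega>. LINT r:{s..t}|lborel. h (Z x y r \<omega>) * (2 * (1 - \<phi> (Z x y r \<omega>)))"
  let ?Bi = "\<lambda>\<omega>. LINT r:{s..t}|lborel. G (Z x y r \<omega>) * ?b r \<omega>"
  have F0: "0 \<le> F z" if "0 \<le> z" for z using Fl[of 0 z] that by simp
  have Fint: "integrable M (\<lambda>\<omega>. F (Zp x y r \<omega>))" for r
  proof (rule integrable_const_bound[where B="\<epsilon> powr p / p"])
    have "F z \<le> \<epsilon> powr p / p" if "0 \<le> z" for z
    proof (rule order_trans[OF Fu[OF that]])
      show "min z \<epsilon> powr p / p \<le> \<epsilon> powr p / p" using p that \<epsilon> by (intro divide_right_mono powr_mono2) auto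
    qed
    then show "AE \<omega> in M. norm (F (Zp x y r \<omega>)) \<le> \<epsilon> powr p / p"
      using F0 Zp_nonneg by (intro AE_I2) auto
  qed measurable
  have "(\<integral>\<omega>. F (Z x y t \<omega>) - F (Z x y s \<omega>) \<partial>M) = (\<integral>\<omega>. F (Zp x y t \<omega>) - F (Zp x y s \<omega>) \<partial>M)"
    using AE_Zp[OF xy] st by (intro integral_cong_AE) (auto elim!: AE_mp)
  also have "\<dots> = (\<integral>\<omega>. F (Zp x y t \<omega>) \<partial>M) - (\<integral>\<omega>. F (Zp x y s \<omega>) \<partial>M)" using Fint by simp
  finally have eq: "(\<integral>\<omega>. F (Zp x y t \<omega>) \<partial>M) + (\<integral>\<omega>. ?Hi \<omega> / 2 \<partial>M) = (\<integral>\<omega>. F (Zp x y s \<omega>) \<partial>M) + (\<integral>\<omega>. ?Bi \<omega> \<partial>M)"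
    using I.ito_expectation(2) by simp
  have h_int: "set_integrable lborel {s..t} (\<lambda>r. h (Z x y r \<omega>) * (2 * (1 - \<phi> (Z x y r \<omega>))))" if "\<omega> \<in> space M" for \<omega>
    by (intro borel_integrable_atLeastAtMost' continuous_intros I.path_cont(4)[OF that] 
         continuous_on_compose2[OF \<phi>_cont I.path_cont(1)[OF that]]) auto
  have low': "?lo z \<le> h z * (1 - \<phi> z)" if z: "0 \<le> z" for z
  proof -
    \<comment> \<open>At 0 both sides vanish because \<open>0 powr \<alpha> = 0\<close> and
      \<open>\<phi> 0 = 1\<close>; beyond \<epsilon> both the slope and the curvature vanish. The
      gap condition on \<phi> is therefore applied exactly where it holds.\<close>
    consider "z = 0" | "0 < z" "z \<le> \<epsilon>" | "\<epsilon> < z" using z by linarith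
    then show ?thesis
    proof cases
      case 2
      have "(L * \<gamma> * (z + \<kappa>') powr (\<gamma> - 1) * g p \<kappa> \<kappa>' z) * (c\<phi> * z powr \<alpha>) \<le> h z * (1 - \<phi> z)"
        using low[OF z] \<phi>_gap[OF 2] c L_pos \<gamma> \<phi>_bound[of z]
        by (intro mult_mono) (auto intro!: mult_nonneg_nonneg damped_slope_nonneg order_trans[OF _ low[OF z]])
      also have "(L * \<gamma> * (z + \<kappa>') powr (\<gamma> - 1) * g p \<kappa> \<kappa>' z) * (c\<phi> * z powr \<alpha>) = (L * \<gamma> * c\<phi>) * (z + \<kappa>') powr (\<gamma> - 1) * z powr \<alpha> * g p \<kappa> \<kappa>' z"
        by simp
      finally show ?thesis unfolding L_eq .
    qed (use out[of z] in \<open>auto simp: damped_slope_eq_0 \<phi>_0\<close>)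
  qed
  have lowpos: "0 \<le> ?lo z" for z
    using c by (intro mult_nonneg_nonneg damped_slope_nonneg) auto
  have Hpath: "AE \<omega> in M. (\<integral>\<^sup>+r\<in>{s..t}. ennreal (?lo (Zp x y r \<omega>)) \<partial>lborel)
      \<le> ennreal (?Hi \<omega> / 2) \<and> 0 \<le> ?Hi \<omega> / 2"
    using AE_Zp[OF xy] AE_space
  proof eventually_elim
    case (elim \<omega>)
    let ?k = "\<lambda>r. h (Z x y r \<omega>) * (2 * (1 - \<phi> (Z x y r \<omega>)))"
    have k: "2 * (?lo (Zp x y r \<omega>)) \<le> ?k r" if "r \<in> {s..t}" for r
    proof -
      have "Z x y r \<omega> = Zp x y r \<omega>" using elim(1) that st by auto
      moreover have "h (Zp x y r \<omega>) * (2 * (1 - \<phi> (Zp x y r \<omega>))) = 2 * (h (Zp x y r \<omega>) * (1 - \<phi> (Zp x y r \<omega>)))" by simp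
      ultimately show ?thesis using mult_left_mono[OF low'[OF Zp_nonneg[of x y r \<omega>]], of 2] by (simp only:)
    qed
    have k0: "0 \<le> ?k r" if "r \<in> {s..t}" for r
      by (rule order_trans[OF _ k[OF that]]) (use lowpos in simp)
    have "(\<integral>\<^sup>+r\<in>{s..t}. ennreal (?lo (Zp x y r \<omega>)) \<partial>lborel)
      \<le> (\<integral>\<^sup>+r. ennreal (indicator {s..t} r *\<^sub>R (?k r / 2)) \<partial>lborel)"
      using k by (intro nn_integral_mono) (force simp: indicator_def intro!: ennreal_leI)
    also have "\<dots> = ennreal (LINT r:{s..t}|lborel. ?k r / 2)"
      unfolding set_lebesgue_integral_def
    proof (intro nn_integral_eq_integral)
      show "integrable lborel (\<lambda>r. indicator {s..t} r *\<^sub>R (?k r / 2))"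
        using h_int[OF elim(2)] set_integrable_divide[OF h_int[OF elim(2)], of 2] unfolding set_integrable_def by simp
      show "AE r in lborel. 0 \<le> indicator {s..t} r *\<^sub>R (?k r / 2)" using k0 by (intro AE_I2) (auto simp: indicator_def)
    qed
    also have "(LINT r:{s..t}|lborel. ?k r / 2) = ?Hi \<omega> / 2" by (rule set_integral_divide_zero)
    finally show ?case 
      using k0 by (auto simp: set_lebesgue_integral_def indicator_def intro!: Bochner_Integration.integral_nonneg)
  qed
  have Bpath: "AE \<omega> in M. ennreal (?Bi \<omega>) \<le> (\<integral>\<^sup>+r\<in>{s..t}. ennreal (\<bar>?b r \<omega>\<bar> * g p \<kappa> 0 (Zp x y r \<omega>)) \<partial>lborel)"
    using AE_Zp[OF xy] AE_space
  proof eventually_elim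
    case (elim \<omega>)
    have "ennreal (?Bi \<omega>) \<le> (\<integral>\<^sup>+r. ennreal (indicator {s..t} r *\<^sub>R (G (Z x y r \<omega>) * ?b r \<omega>)) \<partial>lborel)"
      unfolding set_lebesgue_integral_def by (rule ennreal_integral_le_nn_integral)
    also have "\<dots> \<le> (\<integral>\<^sup>+r\<in>{s..t}. ennreal (\<bar>?b r \<omega>\<bar> * g p \<kappa> 0 (Zp x y r \<omega>)) \<partial>lborel)"
    proof (rule nn_integral_mono)
      fix r
      show "ennreal (indicator {s..t} r *\<^sub>R (G (Z x y r \<omega>) * ?b r \<omega>)) \<le> ennreal (\<bar>?b r \<omega>\<bar> * g p \<kappa> 0 (Zp x y r \<omega>)) * indicator {s..t} r"
      proof (cases "r \<in> {s..t}")
        case True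
        then have Z: "Z x y r \<omega> = Zp x y r \<omega>" using elim(1) st by auto
        have "G (Zp x y r \<omega>) * ?b r \<omega> \<le> G (Zp x y r \<omega>) * \<bar>?b r \<omega>\<bar>"
          using Gg[OF Zp_nonneg] damped_slope_nonneg by (intro mult_left_mono) auto
        also have "\<dots> \<le> g p \<kappa> 0 (Zp x y r \<omega>) * \<bar>?b r \<omega>\<bar>"
          unfolding Gg[OF Zp_nonneg] using Zp_nonneg[of x y r \<omega>] p \<kappa> L_pos \<gamma> by (intro mult_right_mono damped_slope_antimono) auto
        finally show ?thesis using True by (simp add: Z mult.commute ennreal_leI)
      qed simp
    qed
    finally show ?case .
  qed
  have "(\<integral>\<^sup>+\<omega>. ennreal (terminal p \<kappa> \<kappa>' (Zp x y t \<omega>)) \<partial>M)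
     \<le> (\<integral>\<^sup>+\<omega>. ennreal (F (Zp x y t \<omega>)) \<partial>M)"
    using Fl Zp_nonneg \<epsilon> by (intro nn_integral_mono ennreal_leI Fl) auto
  also have "\<dots> = ennreal (\<integral>\<omega>. F (Zp x y t \<omega>) \<partial>M)"
    by (rule nn_integral_eq_integral[OF Fint]) (use F0 Zp_nonneg in auto)
  finally have 1: "(\<integral>\<^sup>+\<omega>. ennreal (terminal p \<kappa> \<kappa>' (Zp x y t \<omega>)) \<partial>M) \<le> ennreal (\<integral>\<omega>. F (Zp x y t \<omega>) \<partial>M)" .
  have "occ x y s t ?lo \<le> (\<integral>\<^sup>+\<omega>. ennreal (?Hi \<omega> / 2) \<partial>M)"
    unfolding occ_def using Hpath by (intro nn_integral_mono_AE) (auto elim: AE_mp)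
  also have "\<dots> = ennreal (\<integral>\<omega>. ?Hi \<omega> / 2 \<partial>M)"
    using I.DH_limits(3) Hpath by (intro nn_integral_eq_integral) (auto elim: AE_mp)
  finally have 2: "occ x y s t ?lo \<le> ennreal (\<integral>\<omega>. ?Hi \<omega> / 2 \<partial>M)" .
  have Hi0: "0 \<le> (\<integral>\<omega>. ?Hi \<omega> / 2 \<partial>M)" and F0i: "0 \<le> (\<integral>\<omega>. F (Zp x y r \<omega>) \<partial>M)" for r
    using Hpath F0 Zp_nonneg by (auto intro!: integral_nonneg_AE elim: AE_mp)
  \<comment> \<open>The expected drift contribution may be negative, so the right side splits in
    \<open>ennreal\<close> only as an inequality, in the direction that is wanted.\<close>
  have "ennreal (\<integral>\<omega>. F (Zp x y t \<omega>) \<partial>M) + ennreal (\<integral>\<omega>. ?Hi \<omega> / 2 \<partial>M) = ennreal ((\<integral>\<omega>. F (Zp x y s \<omega>) \<partial>M) + (\<integral>\<omega>. ?Bi \<omega> \<partial>M))"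
    unfolding ennreal_plus[OF F0i Hi0, symmetric] eq by (rule refl)
  also have "\<dots> \<le> ennreal (\<integral>\<omega>. F (Zp x y s \<omega>) \<partial>M) + ennreal (\<integral>\<omega>. ?Bi \<omega> \<partial>M)"
    by (rule ennreal_add_le)
  also have "\<dots> \<le> (\<integral>\<^sup>+\<omega>. ennreal (min (Zp x y s \<omega>) \<epsilon> powr p / p) \<partial>M) + drift_term p x y s t \<kappa>"
  proof (rule add_mono)
    have "ennreal (\<integral>\<omega>. F (Zp x y s \<omega>) \<partial>M) \<le> (\<integral>\<^sup>+\<omega>. ennreal (F (Zp x y s \<omega>)) \<partial>M)" by (rule ennreal_integral_le_nn_integral)
    also have "\<dots> \<le> (\<integral>\<^sup>+\<omega>. ennreal (min (Zp x y s \<omega>) \<epsilon> powr p / p) \<partial>M)"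
      using Fu[OF Zp_nonneg] by (intro nn_integral_mono ennreal_leI)
    finally show "ennreal (\<integral>\<omega>. F (Zp x y s \<omega>) \<partial>M) \<le> (\<integral>\<^sup>+\<omega>. ennreal (min (Zp x y s \<omega>) \<epsilon> powr p / p) \<partial>M)" .
    have "ennreal (\<integral>\<omega>. ?Bi \<omega> \<partial>M) \<le> (\<integral>\<^sup>+\<omega>. ennreal (?Bi \<omega>) \<partial>M)" by (rule ennreal_integral_le_nn_integral)
    also have "\<dots> \<le> drift_term p x y s t \<kappa>" unfolding drift_term_def using Bpath by (rule nn_integral_mono_AE)
    finally show "ennreal (\<integral>\<omega>. ?Bi \<omega> \<partial>M) \<le> drift_term p x y s t \<kappa>" .
  qed
  finally show ?thesis using add_mono[OF 1 2] by (rule order_trans[rotated])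
qed


lemma powr_inverse_Suc_decreasing: "inverse (real (Suc (Suc n))) \<le> inverse (real (Suc n))"
  by (intro le_imp_inverse_le) auto

lemma g_limit_inner:
  assumes "0 < z" "0 < \<kappa>"
  shows "(\<lambda>n. g p \<kappa> (inverse (real (Suc n))) z) \<longlonglongrightarrow> g p \<kappa> 0 z"
  unfolding damped_slope_def using assms
  by (intro tendsto_intros LIMSEQ_inverse_real_of_nat) auto

lemma g_limit_outer:
  assumes "0 < z"
  shows "(\<lambda>n. g p (inverse (real (Suc n))) 0 z) \<longlonglongrightarrow> g p 0 0 z"
  unfolding damped_slope_def using assms
  by (intro tendsto_intros LIMSEQ_inverse_real_of_nat) auto

lemma occ_add:
  assumes [measurable]: "k \<in> borel_measurable borel" "l \<in> borel_measurable borel"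
    and "\<And>z. 0 \<le> z \<Longrightarrow> 0 \<le> k z" "\<And>z. 0 \<le> z \<Longrightarrow> 0 \<le> l z"
  shows "occ x y s t (\<lambda>z. k z + l z) = occ x y s t k + occ x y s t l"
proof -
  have m: "(\<lambda>\<omega>. \<integral>\<^sup>+r\<in>{s..t}. ennreal (f (Zp x y r \<omega>)) \<partial>lborel) \<in> borel_measurable M"
    if [measurable]: "f \<in> borel_measurable borel" for f :: "real \<Rightarrow> real"
    by (rule path_nn_integral_measurable) measurable
  have "(\<integral>\<^sup>+r\<in>{s..t}. ennreal (k (Zp x y r \<omega>) + l (Zp x y r \<omega>)) \<partial>lborel) =
     (\<integral>\<^sup>+r\<in>{s..t}. ennreal (k (Zp x y r \<omega>)) \<partial>lborel) + (\<integral>\<^sup>+r\<in>{s..t}. ennreal (l (Zp x y r \<omega>)) \<partial>lborel)" for \<omega>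
    using assms(3,4)[OF Zp_nonneg] by (simp add: ennreal_plus distrib_right nn_integral_add)
  then have "occ x y s t (\<lambda>z. k z + l z) = (\<integral>\<^sup>+\<omega>. (\<integral>\<^sup>+r\<in>{s..t}. ennreal (k (Zp x y r \<omega>)) \<partial>lborel) + (\<integral>\<^sup>+r\<in>{s..t}. ennreal (l (Zp x y r \<omega>)) \<partial>lborel) \<partial>M)"
    unfolding occ_def by simp
  also have "\<dots> = occ x y s t k + occ x y s t l"
    unfolding occ_def by (intro nn_integral_add m) fact+
  finally show ?thesis .
qed

text \<open>Letting \<open>\<kappa>'\<close> tend to \<open>0\<close> first, while \<open>\<kappa> > 0\<close> still bounds the slope, keeps the drift term finite,
  so it can be cancelled against half of the occupation term.\<close>

lemma half_regularized_inequality: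
  assumes p: "0 < p" "p \<le> 1" and \<kappa>: "0 < \<kappa>" and st: "0 \<le> s" "s < t" and xy: "x \<le> y"
  shows "(\<integral>\<^sup>+\<omega>. ennreal (terminal p \<kappa> 0 (Zp x y t \<omega>)) \<partial>M)
    + occ x y s t (\<lambda>z. c\<rho> * z powr (\<alpha> + \<gamma> - 1) * g p \<kappa> 0 z)
    \<le> (\<integral>\<^sup>+\<omega>. ennreal (min (Zp x y s \<omega>) \<epsilon> powr p / p) \<partial>M)"
proof -
  let ?i = "\<lambda>n. inverse (real (Suc n))"
  let ?A = "\<lambda>\<kappa>'. \<integral>\<^sup>+\<omega>. ennreal (terminal p \<kappa> \<kappa>' (Zp x y t \<omega>)) \<partial>M"
  let ?k = "\<lambda>\<kappa>' z. 2 * c\<rho> * (z + \<kappa>') powr (\<gamma> - 1) * z powr \<alpha> * g p \<kappa> \<kappa>' z"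
  let ?R = "(\<integral>\<^sup>+\<omega>. ennreal (min (Zp x y s \<omega>) \<epsilon> powr p / p) \<partial>M)"
  let ?l = "\<lambda>z. c\<rho> * z powr (\<alpha> + \<gamma> - 1) * g p \<kappa> 0 z"
  have g_mono: "g p \<kappa> (?i n) z \<le> g p \<kappa> (?i (Suc n)) z" if "0 \<le> z" for n z
    using that p \<kappa> L_pos \<gamma> powr_inverse_Suc_decreasing[of n] by (intro damped_slope_antimono) (auto simp del: of_nat_Suc)
  have A: "(\<lambda>n. ?A (?i n)) \<longlonglongrightarrow> ?A 0"
  proof (rule expectation_limit[where k="\<lambda>n z. terminal p \<kappa> (?i n) z" and l="\<lambda>z. terminal p \<kappa> 0 z"])
    show "terminal p \<kappa> (?i n) z \<le> terminal p \<kappa> (?i (Suc n)) z" if "0 \<le> z" for n z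
      using that \<epsilon> by (intro mult_left_mono g_mono) auto
    show "(\<lambda>n. terminal p \<kappa> (?i n) z) \<longlonglongrightarrow> terminal p \<kappa> 0 z" if "0 \<le> z" for z
    proof (cases "z = 0")
      case False
      then show ?thesis using that \<epsilon> \<kappa> by (intro tendsto_mult_left g_limit_inner) auto
    qed (use \<epsilon> in simp)
  qed measurable
  have T: "(\<lambda>n. occ x y s t (?k (?i n))) \<longlonglongrightarrow> occ x y s t (\<lambda>z. 2 * ?l z)"
  proof (rule occ_limit)
    fix n z assume z: "0 \<le> (z :: real)"
    have "(z + ?i n) powr (\<gamma> - 1) \<le> (z + ?i (Suc n)) powr (\<gamma> - 1)"
      using z \<gamma> powr_inverse_Suc_decreasing[of n] by (intro powr_mono2') (auto simp del: of_nat_Suc intro: add_nonneg_pos)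
    then show "?k (?i n) z \<le> ?k (?i (Suc n)) z"
      using c g_mono[OF z, of n] by (intro mult_mono mult_nonneg_nonneg damped_slope_nonneg) auto
  next
    fix z assume z: "0 \<le> (z :: real)"
    show "(\<lambda>n. ?k (?i n) z) \<longlonglongrightarrow> 2 * ?l z"
    \<comment> \<open>The shifted powers need not converge at \<open>z = 0\<close>, but there the
      factor \<open>z powr \<alpha>\<close> makes every term and the limit 0.\<close>
    proof (cases "z = 0")
      case False
      then have "0 < z" using z by simp
      have "(\<lambda>n. ?k (?i n) z) \<longlonglongrightarrow> 2 * c\<rho> * (z + 0) powr (\<gamma> - 1) * z powr \<alpha> * g p \<kappa> 0 z"
        using \<open>0 < z\<close> \<kappa> by (intro tendsto_intros g_limit_inner LIMSEQ_inverse_real_of_nat) auto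
      also have "2 * c\<rho> * (z + 0) powr (\<gamma> - 1) * z powr \<alpha> * g p \<kappa> 0 z = 2 * ?l z"
        using \<open>0 < z\<close> by (simp add: powr_add[symmetric] add_ac diff_conv_add_uminus del: add_uminus_conv_diff)
      finally show ?thesis .
    qed simp
  qed measurable
  have "?A 0 + occ x y s t (\<lambda>z. 2 * ?l z) \<le> ?R + drift_term p x y s t \<kappa>"
    by (rule LIMSEQ_le_const2[OF tendsto_add[OF A T]])
       (use regularized_inequality[OF p \<kappa> _ st xy] in \<open>auto simp del: of_nat_Suc\<close>)
  also have "occ x y s t (\<lambda>z. 2 * ?l z) = occ x y s t ?l + occ x y s t ?l"
    unfolding mult_2 by (rule occ_add) (use c in \<open>auto simp: damped_slope_nonneg\<close>)
  finally have 1: "?A 0 + (occ x y s t ?l + occ x y s t ?l) \<le> ?R + drift_term p x y s t \<kappa>" .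
  \<comment> \<open>For gaps up to \<epsilon> this is the modulus of \<open>a\<close>; for larger
    gaps the slope is 0. The drift term thus costs one of the two copies of the occupation
    term.\<close>
  have "drift_term p x y s t \<kappa> \<le> occ x y s t ?l"
    unfolding drift_term_def occ_def
  proof (rule nn_integral_mono_AE)
    show "AE \<omega> in M. (\<integral>\<^sup>+r\<in>{s..t}. ennreal (\<bar>drift y r \<omega> - drift x r \<omega>\<bar> * g p \<kappa> 0 (Zp x y r \<omega>)) \<partial>lborel)
        \<le> (\<integral>\<^sup>+r\<in>{s..t}. ennreal (?l (Zp x y r \<omega>)) \<partial>lborel)"
      using drift_bound[OF xy]
    proof eventually_elim
      case (elim \<omega>)
      have "\<bar>drift y r \<omega> - drift x r \<omega>\<bar> * g p \<kappa> 0 (Zp x y r \<omega>) \<le> ?l (Zp x y r \<omega>)" if "0 \<le> r" for r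
      proof (cases "Zp x y r \<omega> \<le> \<epsilon>")
        case True
        then show ?thesis using elim that damped_slope_nonneg by (intro mult_right_mono) auto
      qed (simp add: damped_slope_eq_0)
      then show ?case using st by (intro nn_integral_mono) (auto simp: indicator_def intro!: ennreal_leI)
    qed
  qed
  then have "drift_term p x y s t \<kappa> + (?A 0 + occ x y s t ?l) \<le> occ x y s t ?l + (?A 0 + occ x y s t ?l)"
    by (rule add_right_mono)
  also have "\<dots> = ?A 0 + (occ x y s t ?l + occ x y s t ?l)" by (simp only: add_ac)
  also have "\<dots> \<le> drift_term p x y s t \<kappa> + ?R" using 1 by (simp only: add.commute)
  finally have "drift_term p x y s t \<kappa> + (?A 0 + occ x y s t ?l) \<le> drift_term p x y s t \<kappa> + ?R" .
  moreover have "drift_term p x y s t \<kappa> \<noteq> \<infinity>"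
    using drift_term_finite[OF p \<kappa>, of s t x y] st by (metis less_imp_le less_irrefl)
  ultimately show ?thesis by (simp only: ennreal_add_left_cancel_le) blast
qed

text \<open>The drift term is already cancelled, so \<kappa> can tend to 0 by monotone convergence
  although the slope may become unbounded at 0.\<close>

lemma unregularized_inequality:
  assumes p: "0 < p" "p \<le> 1" and st: "0 \<le> s" "s < t" and xy: "x \<le> y"
  shows "(\<integral>\<^sup>+\<omega>. ennreal (terminal p 0 0 (Zp x y t \<omega>)) \<partial>M)
    + occ x y s t (\<lambda>z. c\<rho> * z powr (\<alpha> + \<gamma> - 1) * g p 0 0 z)
    \<le> (\<integral>\<^sup>+\<omega>. ennreal (min (Zp x y s \<omega>) \<epsilon> powr p / p) \<partial>M)"
proof -
  let ?i = "\<lambda>n. inverse (real (Suc n))"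
  let ?A = "\<lambda>\<kappa>. \<integral>\<^sup>+\<omega>. ennreal (terminal p \<kappa> 0 (Zp x y t \<omega>)) \<partial>M"
  let ?l = "\<lambda>\<kappa> z. c\<rho> * z powr (\<alpha> + \<gamma> - 1) * g p \<kappa> 0 z"
  have g_mono: "g p (?i n) 0 z \<le> g p (?i (Suc n)) 0 z" if "0 \<le> z" for n z
    using that p L_pos \<gamma> powr_inverse_Suc_decreasing[of n] by (intro damped_slope_antimono) (auto simp del: of_nat_Suc intro: add_nonneg_pos)
  have A: "(\<lambda>n. ?A (?i n)) \<longlonglongrightarrow> ?A 0"
  proof (rule expectation_limit[where k="\<lambda>n z. terminal p (?i n) 0 z" and l="\<lambda>z. terminal p 0 0 z"])
    show "terminal p (?i n) 0 z \<le> terminal p (?i (Suc n)) 0 z" if "0 \<le> z" for n z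
      using that \<epsilon> by (intro mult_left_mono g_mono) auto
    show "(\<lambda>n. terminal p (?i n) 0 z) \<longlonglongrightarrow> terminal p 0 0 z" if "0 \<le> z" for z
    proof (cases "z = 0")
      case False
      then show ?thesis using that \<epsilon> by (intro tendsto_mult_left g_limit_outer) auto
    qed (use \<epsilon> in simp)
  qed measurable
  have T: "(\<lambda>n. occ x y s t (?l (?i n))) \<longlonglongrightarrow> occ x y s t (?l 0)"
  proof (rule occ_limit)
    fix n z assume z: "0 \<le> (z :: real)"
    show "?l (?i n) z \<le> ?l (?i (Suc n)) z"
      using c g_mono[OF z, of n] by (intro mult_left_mono) auto
  next
    fix z assume z: "0 \<le> (z :: real)"
    show "(\<lambda>n. ?l (?i n) z) \<longlonglongrightarrow> ?l 0 z"
    proof (cases "z = 0")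
      case False
      then show ?thesis using z by (intro tendsto_mult_left g_limit_outer) auto
    qed simp
  qed measurable
  show ?thesis
    by (rule LIMSEQ_le_const2[OF tendsto_add[OF A T]])
       (use half_regularized_inequality[OF p _ st xy] in \<open>auto simp del: of_nat_Suc\<close>)
qed

section \<open>Iteration over the moments of the truncated gap\<close>

text \<open>As \<open>0 powr 0 = 0\<close>, the function \<open>\<psi> 0\<close> is the indicator of the positive reals.\<close>

definition \<psi> :: "real \<Rightarrow> real \<Rightarrow> real" where "\<psi> q z = min z \<epsilon> powr q"

lemma \<psi>_measurable [measurable]: "\<psi> q \<in> borel_measurable borel"
  unfolding \<psi>_def[abs_def] by measurable

lemma \<psi>_nonneg: "0 \<le> \<psi> q z" by (simp add: \<psi>_def)

text \<open>On \<open>{0..\<epsilon> / 2}\<close> the exponential is at least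
  \<open>exp (- L)\<close> and the squared cut-off at least \<open>(\<epsilon> / 2)^2\<close>. The
  last factor 1/2 pays for replacing \<open>min z (\<epsilon> / 2)\<close> by
  \<open>min z \<epsilon>\<close>, which costs \<open>2 powr p \<le> 2\<close>.\<close>

definition c0 where "c0 = exp (- L) * (\<epsilon> / 2)\<^sup>2 / 2"

lemma c0_pos: "0 < c0" using \<epsilon> by (simp add: c0_def)

lemma g_lower:
  assumes "0 \<le> z" "z \<le> \<epsilon> / 2"
  shows "2 * c0 * z powr (p - 1) \<le> g p 0 0 z"
proof -
  have "z powr \<gamma> \<le> 1 powr \<gamma>" using assms \<epsilon> \<gamma> by (intro powr_mono2) auto
  then have "exp (- L) \<le> exp (- L * z powr \<gamma>)" using L_pos by simp
  moreover have "(\<epsilon> / 2)\<^sup>2 \<le> (max 0 (\<epsilon> - z))\<^sup>2" using assms \<epsilon> by (intro power_mono) auto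
  ultimately have "exp (- L) * (\<epsilon> / 2)\<^sup>2 \<le> exp (- L * z powr \<gamma>) * (max 0 (\<epsilon> - z))\<^sup>2" by (intro mult_mono) auto
  then have "z powr (p - 1) * (exp (- L) * (\<epsilon> / 2)\<^sup>2) \<le> z powr (p - 1) * (exp (- L * z powr \<gamma>) * (max 0 (\<epsilon> - z))\<^sup>2)"
    by (intro mult_left_mono) auto
  then show ?thesis by (simp add: damped_slope_def c0_def mult_ac)
qed

lemma \<psi>_le_terminal:
  assumes p: "0 < p" "p \<le> 1" and z: "0 \<le> z"
  shows "c0 * \<psi> p z \<le> terminal p 0 0 z"
proof (cases "z = 0")
  case False
  let ?m = "min z (\<epsilon> / 2)"
  have m: "0 < ?m" "?m \<le> \<epsilon> / 2" using z False \<epsilon> by auto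
  have "min z \<epsilon> / 2 \<le> ?m" using z \<epsilon> by auto
  then have "(min z \<epsilon> / 2) powr p \<le> ?m powr p" using p z \<epsilon> by (intro powr_mono2) auto
  moreover have "min z \<epsilon> powr p / 2 \<le> (min z \<epsilon> / 2) powr p"
  proof -
    have "(2::real) powr p \<le> 2 powr 1" using p by (intro powr_mono) auto
    then have "min z \<epsilon> powr p / 2 \<le> min z \<epsilon> powr p / 2 powr p" by (intro divide_left_mono) auto
    then show ?thesis using z \<epsilon> by (simp add: powr_divide)
  qed
  ultimately have "\<psi> p z \<le> 2 * ?m powr p" by (simp add: \<psi>_def)
  then have "c0 * \<psi> p z \<le> c0 * (2 * ?m powr p)" using c0_pos by (intro mult_left_mono) auto
  also have "\<dots> = ?m * (2 * c0 * ?m powr (p - 1))" using m(1) by (simp add: powr_diff)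
  also have "\<dots> \<le> ?m * g p 0 0 ?m" using m by (intro mult_left_mono g_lower) auto
  finally show ?thesis .
qed (use p \<epsilon> in \<open>simp add: \<psi>_def\<close>)

text \<open>For gaps up to \<open>\<epsilon> / 2\<close>, which are below 1, a larger exponent gives
  a smaller power, and the occupation integrand is of order
  \<open>z powr (p + \<alpha> + \<gamma> - 2)\<close>. For larger gaps \<open>\<psi> q\<close> is at
  most 1, which the first moment controls.\<close>

lemma \<psi>_le_occupation:
  assumes p: "0 < p" "p \<le> 1" and q: "p + \<alpha> + \<gamma> - 2 \<le> q" "0 \<le> q" and z: "0 \<le> z"
  shows "\<psi> q z \<le> 1 / (c\<rho> * c0) * (c\<rho> * z powr (\<alpha> + \<gamma> - 1) * g p 0 0 z) + 2 / \<epsilon> * \<psi> 1 z"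
proof -
  have g0: "0 \<le> 1 / (c\<rho> * c0) * (c\<rho> * z powr (\<alpha> + \<gamma> - 1) * g p 0 0 z)"
    using c c0_pos by (intro mult_nonneg_nonneg damped_slope_nonneg) auto
  have \<psi>0: "0 \<le> 2 / \<epsilon> * \<psi> 1 z" using \<epsilon> \<psi>_nonneg by auto
  consider "z = 0" | "0 < z" "z \<le> \<epsilon> / 2" | "\<epsilon> / 2 < z" using z by linarith
  then show ?thesis
  proof cases
    case 1
    then show ?thesis using \<epsilon> by (simp add: \<psi>_def)
  next
    case 2
    have "\<psi> q z = z powr q" using 2 \<epsilon> by (simp add: \<psi>_def min_def)
    also have "\<dots> \<le> z powr (p + \<alpha> + \<gamma> - 2)" using 2 \<epsilon> q by (intro powr_mono') auto
    also have "\<dots> = z powr (\<alpha> + \<gamma> - 1) * z powr (p - 1)" by (simp add: powr_add[symmetric] algebra_simps)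
    also have "\<dots> \<le> z powr (\<alpha> + \<gamma> - 1) * (g p 0 0 z / c0)"
    proof (rule mult_left_mono)
      have "c0 * z powr (p - 1) \<le> 2 * c0 * z powr (p - 1)" using c0_pos by simp
      also have "\<dots> \<le> g p 0 0 z" using 2 by (intro g_lower) auto
      finally show "z powr (p - 1) \<le> g p 0 0 z / c0" using c0_pos by (simp add: field_simps)
    qed simp
    also have "\<dots> = 1 / (c\<rho> * c0) * (c\<rho> * z powr (\<alpha> + \<gamma> - 1) * g p 0 0 z)" using c by simp
    finally show ?thesis using \<psi>0 by linarith
  next
    case 3
    have "\<psi> q z \<le> 1 powr q" unfolding \<psi>_def using q z \<epsilon> by (intro powr_mono2) auto
    also have "\<dots> \<le> 2 / \<epsilon> * \<psi> 1 z" using 3 \<epsilon> z by (simp add: \<psi>_def field_simps min_def)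
    finally show ?thesis using g0 by linarith
  qed
qed


lemma occ_mono:
  assumes "\<And>z. 0 \<le> z \<Longrightarrow> k z \<le> l z"
  shows "occ x y s t k \<le> occ x y s t l"
  unfolding occ_def using assms[OF Zp_nonneg]
  by (intro nn_integral_mono mult_right_mono ennreal_leI) auto

lemma occ_cmult:
  assumes [measurable]: "k \<in> borel_measurable borel" and "0 \<le> d"
  shows "occ x y s t (\<lambda>z. d * k z) = ennreal d * occ x y s t k"
proof -
  have "occ x y s t (\<lambda>z. d * k z) = (\<integral>\<^sup>+\<omega>. ennreal d * (\<integral>\<^sup>+r\<in>{s..t}. ennreal (k (Zp x y r \<omega>)) \<partial>lborel) \<partial>M)"
    unfolding occ_def using assms(2)
    by (subst nn_integral_cmult[symmetric]) (auto simp: ennreal_mult' mult.assoc)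
  also have "\<dots> = ennreal d * occ x y s t k"
    unfolding occ_def by (intro nn_integral_cmult path_nn_integral_measurable) measurable
  finally show ?thesis .
qed

abbreviation E\<psi> where "E\<psi> q x y t \<equiv> (\<integral>\<^sup>+\<omega>. ennreal (\<psi> q (Zp x y t \<omega>)) \<partial>M)"

text \<open>The supermartingale is a test function that is only comparable to
  \<open>\<psi> p\<close>: passing to it costs \<open>1 / p\<close> at time \<open>s\<close>, and
  returning costs \<open>1 / c0\<close> at time \<open>t\<close>.\<close>

lemma E\<psi>_decay_pos:
  assumes p: "0 < p" "p \<le> 1" and st: "0 \<le> s" "s < t" and xy: "x \<le> y"
  shows "E\<psi> p x y t \<le> ennreal (1 / (p * c0)) * E\<psi> p x y s"
proof -
  have "E\<psi> p x y t \<le> (\<integral>\<^sup>+\<omega>. ennreal (1 / c0) * ennreal (terminal p 0 0 (Zp x y t \<omega>)) \<partial>M)"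
    using \<psi>_le_terminal[OF p Zp_nonneg] c0_pos
    by (intro nn_integral_mono) (auto simp: ennreal_mult'[symmetric] field_simps intro!: ennreal_leI)
  also have "\<dots> = ennreal (1 / c0) * (\<integral>\<^sup>+\<omega>. ennreal (terminal p 0 0 (Zp x y t \<omega>)) \<partial>M)"
    by (rule nn_integral_cmult) measurable
  also have "\<dots> \<le> ennreal (1 / c0) * (\<integral>\<^sup>+\<omega>. ennreal (min (Zp x y s \<omega>) \<epsilon> powr p / p) \<partial>M)"
    by (intro mult_left_mono order_trans[OF _ unregularized_inequality[OF p st xy]]) auto
  also have "(\<integral>\<^sup>+\<omega>. ennreal (min (Zp x y s \<omega>) \<epsilon> powr p / p) \<partial>M) = (\<integral>\<^sup>+\<omega>. ennreal (1 / p) * ennreal (\<psi> p (Zp x y s \<omega>)) \<partial>M)"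
    using p by (intro nn_integral_cong) (simp add: \<psi>_def ennreal_mult'[symmetric])
  also have "\<dots> = ennreal (1 / p) * E\<psi> p x y s" by (rule nn_integral_cmult) measurable
  also have "ennreal (1 / c0) * (ennreal (1 / p) * E\<psi> p x y s) = ennreal (1 / (p * c0)) * E\<psi> p x y s"
    using p c0_pos by (simp add: mult.assoc[symmetric] ennreal_mult'[symmetric] mult.commute)
  finally show ?thesis .
qed

text \<open>Once two trajectories have met at a fixed time, the cocycle property keeps them together.\<close>

lemma E\<psi>_decay_0:
  assumes st: "0 \<le> s" "s \<le> t" and xy: "x \<le> y"
  shows "E\<psi> 0 x y t \<le> E\<psi> 0 x y s"
proof (rule nn_integral_mono_AE)
  show "AE \<omega> in M. ennreal (\<psi> 0 (Zp x y t \<omega>)) \<le> ennreal (\<psi> 0 (Zp x y s \<omega>))"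
    using AE_Zp[OF xy] flow_cocycle[OF order_refl st]
  proof eventually_elim
    case (elim \<omega>)
    have "Zp x y t \<omega> = 0" if "Zp x y s \<omega> = 0"
    proof -
      have "X 0 s \<omega> y = X 0 s \<omega> x" using elim(1) that st by auto
      then have "X 0 t \<omega> y = X 0 t \<omega> x" using elim(2) by simp
      then show ?thesis using elim(1) st by auto
    qed
    then show ?case using Zp_nonneg[of x y s \<omega>] \<epsilon>
      by (intro ennreal_leI) (auto simp: \<psi>_def)
  qed
qed

text \<open>The constant \<open>1 / (q * c0)\<close> degenerates at \<open>q = 0\<close>, where
  coalescence supplies the constant 1.\<close>

lemma E\<psi>_decay:
  assumes "0 \<le> q" "q \<le> 1"
  obtains D where "0 \<le> D" "\<And>x y s t. 0 \<le> s \<Longrightarrow> s < t \<Longrightarrow> x \<le> y \<Longrightarrow> E\<psi> q x y t \<le> ennreal D * E\<psi> q x y s"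
proof (cases "q = 0")
  case True
  then show ?thesis using that[of 1] E\<psi>_decay_0 by auto
next
  case False
  then show ?thesis using that[of "1 / (q * c0)"] E\<psi>_decay_pos[of q] assms c0_pos by auto
qed

text \<open>The start of the iteration: at time 0 the gap is exactly \<open>y - x\<close>.\<close>

lemma E\<psi>_1_bound:
  assumes "0 < t" "x \<le> y" shows "E\<psi> 1 x y t \<le> ennreal (1 / c0 * (y - x))"
proof -
  have "E\<psi> 1 x y t \<le> ennreal (1 / (1 * c0)) * E\<psi> 1 x y 0" using assms by (intro E\<psi>_decay_pos) auto
  also have "E\<psi> 1 x y 0 \<le> (\<integral>\<^sup>+\<omega>. ennreal (y - x) \<partial>M)"
  proof (rule nn_integral_mono_AE)
    show "AE \<omega> in M. ennreal (\<psi> 1 (Zp x y 0 \<omega>)) \<le> ennreal (y - x)"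
      using AE_Zp[OF assms(2)] flow_id[of 0, OF order_refl]
    proof eventually_elim
      case (elim \<omega>)
      then have "Zp x y 0 \<omega> = y - x" by auto
      then show ?case using assms \<epsilon> by (intro ennreal_leI) (simp add: \<psi>_def)
    qed
  qed
  also have "\<dots> = ennreal (y - x)" by (simp add: emeasure_space_1)
  also have "ennreal (1 / (1 * c0)) * ennreal (y - x) = ennreal (1 / c0 * (y - x))"
    using c0_pos by (subst ennreal_mult') auto
  finally show ?thesis by (simp add: mult_left_mono)
qed

lemma occ_\<psi>_1_bound:
  assumes "0 < s" "s \<le> t" "x \<le> y"
  shows "occ x y s t (\<psi> 1) \<le> ennreal ((t - s) / c0 * (y - x))"
proof -
  have "occ x y s t (\<psi> 1) \<le> (\<integral>\<^sup>+r\<in>{s..t}. ennreal (1 / c0 * (y - x)) \<partial>lborel)"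
    unfolding occ_Fubini[OF \<psi>_measurable] using assms E\<psi>_1_bound
    by (intro nn_integral_mono) (auto simp: indicator_def)
  also have "\<dots> = ennreal (1 / c0 * (y - x)) * ennreal (t - s)"
    using assms by (simp add: nn_integral_cmult_indicator)
  also have "\<dots> = ennreal ((t - s) / c0 * (y - x))"
    using assms c0_pos by (simp add: ennreal_mult'[symmetric] field_simps)
  finally show ?thesis .
qed

lemma occ_\<psi>_bound:
  assumes p: "0 < p" "p \<le> 1" and q: "p + \<alpha> + \<gamma> - 2 \<le> q" "0 \<le> q" and st: "0 < s" "s < t" and xy: "x \<le> y"
  shows "occ x y s t (\<psi> q) \<le> ennreal (1 / (c\<rho> * c0 * p)) * E\<psi> p x y s + ennreal (2 / \<epsilon> * ((t - s) / c0) * (y - x))"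
proof -
  let ?l = "\<lambda>z. c\<rho> * z powr (\<alpha> + \<gamma> - 1) * g p 0 0 z"
  have l0: "0 \<le> ?l z" for z using c by (intro mult_nonneg_nonneg damped_slope_nonneg) auto
  have cc: "0 \<le> 1 / (c\<rho> * c0)" "0 \<le> 2 / \<epsilon>" using c c0_pos \<epsilon> by auto
  have "occ x y s t (\<psi> q) \<le> occ x y s t (\<lambda>z. 1 / (c\<rho> * c0) * ?l z + 2 / \<epsilon> * \<psi> 1 z)"
    using \<psi>_le_occupation[OF p q] by (rule occ_mono)
  also have "\<dots> = occ x y s t (\<lambda>z. 1 / (c\<rho> * c0) * ?l z) + occ x y s t (\<lambda>z. 2 / \<epsilon> * \<psi> 1 z)"
    by (rule occ_add) (use cc l0 \<psi>_nonneg in \<open>auto intro!: mult_nonneg_nonneg simp del: times_divide_eq_left\<close>)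
  also have "\<dots> = ennreal (1 / (c\<rho> * c0)) * occ x y s t ?l + ennreal (2 / \<epsilon>) * occ x y s t (\<psi> 1)"
    using cc by (subst (1 2) occ_cmult) auto
  also have "\<dots> \<le> ennreal (1 / (c\<rho> * c0)) * (ennreal (1 / p) * E\<psi> p x y s) + ennreal (2 / \<epsilon>) * ennreal ((t - s) / c0 * (y - x))"
  proof (intro add_mono mult_left_mono)
    have "occ x y s t ?l \<le> (\<integral>\<^sup>+\<omega>. ennreal (min (Zp x y s \<omega>) \<epsilon> powr p / p) \<partial>M)"
      using order_trans[OF _ unregularized_inequality[OF p _ st(2) xy], of "occ x y s t ?l"] st by simp
    also have "\<dots> = (\<integral>\<^sup>+\<omega>. ennreal (1 / p) * ennreal (\<psi> p (Zp x y s \<omega>)) \<partial>M)"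
      using p by (intro nn_integral_cong) (simp add: \<psi>_def ennreal_mult'[symmetric])
    also have "\<dots> = ennreal (1 / p) * E\<psi> p x y s" by (rule nn_integral_cmult) measurable
    finally show "occ x y s t ?l \<le> ennreal (1 / p) * E\<psi> p x y s" .
    show "occ x y s t (\<psi> 1) \<le> ennreal ((t - s) / c0 * (y - x))" using occ_\<psi>_1_bound st xy by simp
  qed auto
  also have "ennreal (1 / (c\<rho> * c0)) * (ennreal (1 / p) * E\<psi> p x y s) = ennreal (1 / (c\<rho> * c0 * p)) * E\<psi> p x y s"
    using cc p by (simp add: mult.assoc[symmetric] ennreal_mult'[symmetric])
  also have "ennreal (2 / \<epsilon>) * ennreal ((t - s) / c0 * (y - x)) = ennreal (2 / \<epsilon> * ((t - s) / c0) * (y - x))"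
    unfolding mult.assoc by (rule ennreal_mult'[OF cc(2), symmetric])
  finally show ?thesis .
qed

definition lipschitz_moment :: "real \<Rightarrow> bool" where
  "lipschitz_moment q \<longleftrightarrow> (\<forall>t>0. \<exists>C\<ge>0. \<forall>x y. x \<le> y \<longrightarrow> E\<psi> q x y t \<le> ennreal (C * (y - x)))"

text \<open>The moment of order \<open>p\<close> at time \<open>s\<close> bounds the time integral
  of the moment of order \<open>q\<close> over \<open>{s..u}\<close>. By decay the moment at time
  \<open>t\<close> is at most \<open>D\<close> times the moment at each of these times, hence at
  most \<open>D\<close> times their average.\<close>

lemma lipschitz_moment_step:
  assumes p: "0 < p" "p \<le> 1" and "lipschitz_moment p" and q: "q = max 0 (p - (2 - \<alpha> - \<gamma>))"
  shows "lipschitz_moment q"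
  unfolding lipschitz_moment_def
proof (intro allI impI)
  fix t :: real assume t: "0 < t"
  \<comment> \<open>\<open>s\<close> is positive so that the bound for \<open>p\<close> applies, and
    \<open>u\<close> is below \<open>t\<close> because decay is stated for strictly earlier times;
    the averaging interval has length \<open>t / 4\<close>.\<close>
  define s u where "s = t / 2" and "u = 3 * t / 4"
  have su: "0 < s" "s < u" "u < t" "u - s = t / 4" using t by (auto simp: s_def u_def)
  obtain C where C: "0 \<le> C" "\<And>x y. x \<le> y \<Longrightarrow> E\<psi> p x y s \<le> ennreal (C * (y - x))"
    using assms(3) su unfolding lipschitz_moment_def by blast
  have q01: "0 \<le> q" "q \<le> 1" "p + \<alpha> + \<gamma> - 2 \<le> q" using q p \<gamma> by auto
  obtain D where D: "0 \<le> D" "\<And>x y s t. 0 \<le> s \<Longrightarrow> s < t \<Longrightarrow> x \<le> y \<Longrightarrow> E\<psi> q x y t \<le> ennreal D * E\<psi> q x y s"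
    using E\<psi>_decay[OF q01(1,2)] by metis
  define A where "A = 1 / (c\<rho> * c0 * p) * C + 2 / \<epsilon> * ((u - s) / c0)"
  have A0: "0 \<le> A" using C c c0_pos p \<epsilon> su by (auto simp: A_def intro!: add_nonneg_nonneg mult_nonneg_nonneg)
  show "\<exists>C\<ge>0. \<forall>x y. x \<le> y \<longrightarrow> E\<psi> q x y t \<le> ennreal (C * (y - x))"
  proof (intro exI[of _ "4 / t * (D * A)"] conjI allI impI)
    show "0 \<le> 4 / t * (D * A)" using t D A0 by auto
    fix x y :: real assume xy: "x \<le> y"
    have "occ x y s u (\<psi> q) \<le> ennreal (1 / (c\<rho> * c0 * p)) * E\<psi> p x y s + ennreal (2 / \<epsilon> * ((u - s) / c0) * (y - x))"
      by (rule occ_\<psi>_bound[OF p q01(3,1) su(1,2) xy])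
    also have "\<dots> \<le> ennreal (1 / (c\<rho> * c0 * p)) * ennreal (C * (y - x)) + ennreal (2 / \<epsilon> * ((u - s) / c0) * (y - x))"
      using C(2)[OF xy] by (intro add_mono mult_left_mono) auto
    also have "\<dots> = ennreal (A * (y - x))"
    proof -
      have "0 \<le> 1 / (c\<rho> * c0 * p) * (C * (y - x))" "0 \<le> 2 / \<epsilon> * ((u - s) / c0) * (y - x)"
        using C c c0_pos p \<epsilon> su xy by auto
      moreover have "ennreal (1 / (c\<rho> * c0 * p)) * ennreal (C * (y - x)) = ennreal (1 / (c\<rho> * c0 * p) * (C * (y - x)))"
        using c c0_pos p by (intro ennreal_mult'[symmetric]) auto
      ultimately show ?thesis
        unfolding A_def distrib_right mult.assoc by (simp only: ennreal_plus mult.assoc)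
    qed
    finally have occ: "occ x y s u (\<psi> q) \<le> ennreal (A * (y - x))" .
    have "E\<psi> q x y t * ennreal (t / 4) = (\<integral>\<^sup>+r\<in>{s..u}. E\<psi> q x y t \<partial>lborel)"
      unfolding su(4)[symmetric] using su(2) by (simp add: nn_integral_cmult_indicator)
    also have "\<dots> \<le> (\<integral>\<^sup>+r. ennreal D * (E\<psi> q x y r * indicator {s..u} r) \<partial>lborel)"
      using D(2)[OF _ _ xy] su by (intro nn_integral_mono) (auto simp: indicator_def)
    also have "\<dots> = ennreal D * occ x y s u (\<psi> q)"
      unfolding occ_Fubini[OF \<psi>_measurable]
    proof (rule nn_integral_cmult)
      have "(\<lambda>p. ennreal (\<psi> q (Zp x y (fst p) (snd p)))) \<in> borel_measurable (lborel \<Otimes>\<^sub>M M)" by measurable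
      then have "(\<lambda>r. E\<psi> q x y r) \<in> borel_measurable lborel"
        by (intro borel_measurable_nn_integral) (simp add: case_prod_unfold)
      then show "(\<lambda>r. E\<psi> q x y r * indicator {s..u} r) \<in> borel_measurable lborel" by measurable
    qed
    also have "\<dots> \<le> ennreal D * ennreal (A * (y - x))" using occ by (rule mult_left_mono) simp
    finally have "E\<psi> q x y t * ennreal (t / 4) \<le> ennreal D * ennreal (A * (y - x))" .
    then have "ennreal (4 / t) * (E\<psi> q x y t * ennreal (t / 4)) \<le> ennreal (4 / t) * (ennreal D * ennreal (A * (y - x)))"
      by (rule mult_left_mono) simp
    also have "ennreal (4 / t) * (E\<psi> q x y t * ennreal (t / 4)) = E\<psi> q x y t * (ennreal (4 / t) * ennreal (t / 4))"
      by (simp only: mult_ac)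
    also have "ennreal (4 / t) * ennreal (t / 4) = 1" using t by (simp add: ennreal_mult'[symmetric])
    also have "ennreal (4 / t) * (ennreal D * ennreal (A * (y - x))) = ennreal (4 / t * (D * A) * (y - x))"
      using t D A0 by (simp add: ennreal_mult'[symmetric] mult.assoc)
    finally show "E\<psi> q x y t \<le> ennreal (4 / t * (D * A) * (y - x))" by simp
  qed
qed

text \<open>Each round lowers the exponent by the fixed positive amount
  \<open>2 - \<alpha> - \<gamma>\<close>, so 0 is reached after finitely many rounds.\<close>

lemma lipschitz_moment_0: "lipschitz_moment 0"
proof -
  let ?d = "2 - \<alpha> - \<gamma>"
  have d: "0 < ?d" using \<gamma> by simp
  have "lipschitz_moment (max 0 (1 - real n * ?d))" for n
  proof (induction n)
    case 0
    have "lipschitz_moment 1"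
      unfolding lipschitz_moment_def using E\<psi>_1_bound c0_pos by (auto intro!: exI[of _ "1 / c0"])
    then show ?case by simp
  next
    case (Suc n)
    show ?case
    proof (cases "1 - real n * ?d \<le> 0")
      case True
      then have "1 - real (Suc n) * ?d \<le> 0" using d by (simp add: algebra_simps)
      then show ?thesis using Suc.IH by (simp only: max_absorb1[OF True] max_absorb1)
    next
      case False
      then have "0 < max 0 (1 - real n * ?d)" "max 0 (1 - real n * ?d) \<le> 1" using d by auto
      from lipschitz_moment_step[OF this Suc.IH refl]
      show ?thesis using False by (simp add: algebra_simps)
    qed
  qed
  moreover obtain n :: nat where "1 / ?d < real n" using reals_Archimedean2 by blast
  then have "1 - real n * ?d \<le> 0" using d by (simp add: field_simps)
  ultimately show ?thesis by (metis max_absorb1)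
qed

theorem separation_probability:
  assumes "0 < t"
  obtains C where "0 \<le> C" "\<And>x y. x \<le> y \<Longrightarrow> (\<integral>\<^sup>+\<omega>. (if X 0 t \<omega> y = X 0 t \<omega> x then 0 else 1) \<partial>M) \<le> ennreal (C * (y - x))"
proof -
  obtain C where C: "0 \<le> C" "\<And>x y. x \<le> y \<Longrightarrow> E\<psi> 0 x y t \<le> ennreal (C * (y - x))"
    using lipschitz_moment_0 assms unfolding lipschitz_moment_def by blast
  have "(\<integral>\<^sup>+\<omega>. (if X 0 t \<omega> y = X 0 t \<omega> x then 0 else 1) \<partial>M) \<le> E\<psi> 0 x y t" if "x \<le> y" for x y
  proof (rule nn_integral_mono_AE)
    show "AE \<omega> in M. (if X 0 t \<omega> y = X 0 t \<omega> x then 0 else 1) \<le> ennreal (\<psi> 0 (Zp x y t \<omega>))"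
      using AE_Zp[OF that]
    proof eventually_elim
      case (elim \<omega>)
      then show ?case using assms Zp_nonneg[of x y t \<omega>] \<epsilon> by (auto simp: \<psi>_def min_def)
    qed
  qed
  then show ?thesis using that[OF C(1)] C(2) order_trans by blast
qed

end

section \<open>From separation probabilities to the expected number of values\<close>

theorem mainTheorem2:
  fixes M :: "'a measure" and \<phi> a :: "real \<Rightarrow> real" and \<alpha> \<beta> C t :: real
    and X :: "real \<Rightarrow> real \<Rightarrow> 'a \<Rightarrow> real \<Rightarrow> real"
  assumes "prob_space M"
    and "0 < \<alpha>" and "\<alpha> < 2" and "\<beta> - \<alpha> > -1"
    and "\<phi> \<in> Phi_alpha \<alpha>" and "a \<in> A_beta \<beta>" and "linear_growth a"
    and "harris_flow M \<phi> a X"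
    and "C > 0" and "t > 0"
  shows "(\<integral>\<^sup>+ \<omega>. emeasure (count_space UNIV) (X 0 t \<omega> ` {-C..C}) \<partial>M) < \<infinity>"
proof -
  have star: "\<phi> \<in> Phi_star" using assms(5) by (simp add: Phi_alpha_def)
  obtain c1 e1 where \<phi>1: "c1 > 0" "e1 > 0" "\<And>x. \<bar>x\<bar> \<le> e1 \<Longrightarrow> c1 * \<bar>x\<bar> powr \<alpha> \<le> 1 - \<phi> x"
    using assms(5) unfolding Phi_alpha_def by blast
  obtain \<rho> c2 e2 where a2: "c2 > 0" "e2 > 0" "\<And>x y. y > 0 \<Longrightarrow> \<bar>a (x + y) - a x\<bar> \<le> \<rho> y"
    "\<And>x. 0 < x \<Longrightarrow> x \<le> e2 \<Longrightarrow> \<rho> x \<le> c2 * x powr \<beta>"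
    using assms(6) unfolding A_beta_def by blast
  obtain K where K: "\<And>x. \<bar>a x\<bar> \<le> K * (1 + \<bar>x\<bar>)" using assms(7) unfolding linear_growth_def by blast
  \<comment> \<open>The first entry gives \<open>\<alpha> + \<gamma> - 1 \<le> \<beta>\<close>, so
    that the bound of order \<beta> implies the one of order \<open>\<alpha> + \<gamma> - 1\<close>
    for arguments up to 1; the second gives \<open>\<alpha> + \<gamma> < 2\<close>.\<close>
  define \<gamma> where "\<gamma> = min (1 + \<beta> - \<alpha>) (min ((2 - \<alpha>) / 2) 1)"
  define \<epsilon> where "\<epsilon> = min 1 (min e1 e2)"
  interpret M: prob_space M by (rule assms(1))
  interpret degenerate_flow M \<phi> a X K \<alpha> \<gamma> \<epsilon> c1 c2
  proof unfold_locales
    show "continuous_on UNIV \<phi>" "\<phi> 0 = 1"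
      using star by (auto simp: Phi_star_def)
    show "\<bar>\<phi> x\<bar> \<le> 1" for x
      using star by (intro strictly_pos_def_fun_bound) (auto simp: Phi_star_def)
    show "a \<in> borel_measurable borel" using assms(6) by (auto simp: A_beta_def)
    show "0 < \<gamma>" "\<gamma> \<le> 1" using assms(3,4) by (auto simp: \<gamma>_def)
    have "\<gamma> \<le> (2 - \<alpha>) / 2" unfolding \<gamma>_def by linarith
    then show "\<alpha> + \<gamma> < 2" using assms(3) by (simp add: field_simps)
    show "0 < \<epsilon>" "\<epsilon> \<le> 1" using \<phi>1 a2 by (auto simp: \<epsilon>_def)
    show "c1 * z powr \<alpha> \<le> 1 - \<phi> z" if "0 < z" "z \<le> \<epsilon>" for z
      using \<phi>1(3)[of z] that by (simp add: \<epsilon>_def)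
    show "\<bar>a (x + z) - a x\<bar> \<le> c2 * z powr (\<alpha> + \<gamma> - 1)" if "0 < z" "z \<le> \<epsilon>" for x z
    proof -
      have "\<bar>a (x + z) - a x\<bar> \<le> c2 * z powr \<beta>"
        using a2(3)[of z x] a2(4)[of z] that by (simp add: \<epsilon>_def)
      also have "\<dots> \<le> c2 * z powr (\<alpha> + \<gamma> - 1)"
        using that a2(1) by (intro mult_left_mono powr_mono') (auto simp: \<epsilon>_def \<gamma>_def)
      finally show ?thesis .
    qed
  qed (use assms \<phi>1 a2 K in auto)
  obtain B where B: "0 \<le> B" "\<And>x y. x \<le> y \<Longrightarrow> (\<integral>\<^sup>+\<omega>. (if X 0 t \<omega> y = X 0 t \<omega> x then 0 else 1) \<partial>M) \<le> ennreal (B * (y - x))"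
    using separation_probability[OF assms(10)] by metis
  have [measurable]: "(\<lambda>\<omega>. X 0 t \<omega> x) \<in> borel_measurable M" for x
    using X_meas[of 0 t x] assms(10) by simp
  let ?D = "\<lambda>m i \<omega>. if X 0 t \<omega> (grid C m (Suc i)) = X 0 t \<omega> (grid C m i) then 0 else 1 :: ennreal"
  let ?N = "\<lambda>m \<omega>. 1 + (\<Sum>i<Suc m. ?D m i \<omega>)"
  \<comment> \<open>Monotonicity passes from the number of values to the grid counts; measurability
    enters in Fatou's lemma, for the grid counts.\<close>
  have "(\<integral>\<^sup>+ \<omega>. emeasure (count_space UNIV) (X 0 t \<omega> ` {-C..C}) \<partial>M) \<le> (\<integral>\<^sup>+ \<omega>. liminf (\<lambda>m. ?N m \<omega>) \<partial>M)"
  proof (rule nn_integral_mono)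
    fix \<omega> assume "\<omega> \<in> space M"
    then have "X 0 t \<omega> \<in> D_up" using X_D_up[of 0 t \<omega>] assms(10) by simp
    then show "emeasure (count_space UNIV) (X 0 t \<omega> ` {-C..C}) \<le> liminf (\<lambda>m. ?N m \<omega>)"
      using assms(9) by (intro emeasure_count_space_le finite_image_le_grid_changes)
  qed
  also have "\<dots> \<le> liminf (\<lambda>m. \<integral>\<^sup>+ \<omega>. ?N m \<omega> \<partial>M)"
    by (rule nn_integral_liminf) measurable
  also have "\<dots> \<le> ennreal (1 + 2 * B * C)"
  proof (rule Liminf_le[OF sequentially_bot always_eventually], rule allI)
    fix m
    have "(\<integral>\<^sup>+ \<omega>. ?N m \<omega> \<partial>M) = 1 + (\<Sum>i<Suc m. \<integral>\<^sup>+ \<omega>. ?D m i \<omega> \<partial>M)"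
      by (subst nn_integral_add, measurable, subst nn_integral_sum, measurable) (simp add: M.emeasure_space_1)
    \<comment> \<open>Each of the \<open>Suc m\<close> cells has length
      \<open>2 * C / Suc m\<close>. The separation probability is linear in this length, so the
      total does not depend on \<open>m\<close>.\<close>
    also have "\<dots> \<le> 1 + (\<Sum>i<Suc m. ennreal (B * (2 * C / real (Suc m))))"
    proof (intro add_left_mono sum_mono)
      fix i
      have "0 \<le> 2 * C / real (Suc m)" using assms(9) by simp
      then have "grid C m i \<le> grid C m (Suc i)" using grid_Suc[of C m i] by linarith
      from B(2)[OF this] show "(\<integral>\<^sup>+ \<omega>. ?D m i \<omega> \<partial>M) \<le> ennreal (B * (2 * C / real (Suc m)))"
        by (simp only: grid_Suc)
    qed
    also have "\<dots> = 1 + ennreal (\<Sum>i<Suc m. B * (2 * C / real (Suc m)))"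
      using B(1) assms(9) by (subst sum_ennreal) auto
    also have "(\<Sum>i<Suc m. B * (2 * C / real (Suc m))) = 2 * B * C" by (simp del: of_nat_Suc sum.lessThan_Suc)
    also have "1 + ennreal (2 * B * C) = ennreal (1 + 2 * B * C)" using B(1) assms(9) by (subst ennreal_plus) auto
    finally show "(\<integral>\<^sup>+ \<omega>. ?N m \<omega> \<partial>M) \<le> ennreal (1 + 2 * B * C)" .
  qed
  also have "\<dots> < \<infinity>" by simp
  finally show ?thesis .
qed

end
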